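(* Let $P\to M$ be a principal $G$-bundle. There are canonical injections of gauge transformation groups $$\mathrm{Aut}(P)\ \overset{\widehat{\ }}{\hookrightarrow}\ \mathrm{Aut}(\mathcal P^{(1)}(P))\ \overset{N^\bullet}{\hookrightarrow}\ \mathrm{Aut}(\mathcal P^\bullet(P))\ \simeq\ C^\infty_{G^\bullet\rtimes G}(\mathcal P^\bullet(P),G^\bullet\rtimes G),$$ where $\widehat f(p,q)=(f(p),f(q))$ for $f\in\mathrm{Aut}(P)$, $N^\bullet$ sends a groupoid morphism to the map it induces on nerves (so that $N^{k}(\widehat f)(p_0,\dots,p_k)=(f(p_0),\dots,f(p_k))$), and the last isomorphism is, for every $k$, a group isomorphism $\mathrm{Aut}(\mathcal P^{(k)}(P))\simeq C^\infty_{G^k\rtimes G}(\mathcal P^{(k)}(P),G^k\rtimes G)$.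
   Context: $G$ is a Lie group acting on the left on $P$. $\mathrm{Aut}(P)$ is the group of gauge transformations of $P$: smooth $G$-equivariant maps $P\to P$ covering $\mathrm{id}_M$ (these are automatically invertible). The Lie 2-group $G\rtimes G\rightrightarrows G$ has product $(h_2,g_2)(h_1,g_1)=(h_2\,g_2h_1g_2^{-1},g_2g_1)$, $\mathbf s(h,g)=g$, $\mathbf t(h,g)=hg$, composition $(h_2,h_1g_1)\circ(h_1,g_1)=(h_2h_1,g_1)$. It acts on the pair groupoid $\mathcal P^{(1)}(P)=P\times P\rightrightarrows P$ ($\mathbf s(p,q)=q$, $\mathbf t(p,q)=p$) by $(h,g)\cdot(p,q)=(hg\,p,g\,q)$, making it a principal $(G\rtimes G)$-bundle groupoid over the pair groupoid $\mathcal P^{(1)}(M)=M\times M$, i.e. the actions are free and proper, compatible with the groupoid structures, and have quotient $M\times M\rightrightarrows M$. $\mathrm{Aut}(\mathcal P^{(1)}(P))$ is the group of automorphisms of this principal bundle groupoid over the identity of its base: Lie groupoid morphisms $\mathcal P^{(1)}(P)\to\mathcal P^{(1)}(P)$ that are $(G\rtimes G)$-equivariant and cover the identity of $\mathcal P^{(1)}(M)$. The $k$-th level of the nerve is $\mathcal P^{(k)}(P)=P^{k+1}$, a tuple of points of $P$ encoding $k$ consecutive composable arrows. Listing the points as $(p_k,\dots,p_1,p_0)$ with arrows $(p_k,p_{k-1}),\dots,(p_1,p_0)$, the group $G^k\rtimes G$ ($G$ acting diagonally on $G^k$ by conjugation), identified with the group of composable $k$-tuples in $G\rtimes G$, acts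 by $(\mathbf h_k,\dots,\mathbf h_1,g)\cdot(p_k,\dots,p_1,p_0)=(\mathbf h_kg\,p_k,\dots,\mathbf h_1g\,p_1,g\,p_0)$, making $\mathcal P^{(k)}(P)\to\mathcal P^{(k)}(M)$ a principal bundle. $\mathrm{Aut}(\mathcal P^{(k)}(P))$, as a member of the family $\mathrm{Aut}(\mathcal P^\bullet(P))=\{\mathrm{Aut}(\mathcal P^{(k)}(P))\}_k$, is the group of smooth $G^k\rtimes G$-equivariant maps of $\mathcal P^{(k)}(P)$ covering the identity of $\mathcal P^{(k)}(M)$. $C^\infty_{G^k\rtimes G}(\mathcal P^{(k)}(P),G^k\rtimes G)$ is the group, under pointwise multiplication, of smooth maps equivariant for the given action and the conjugation action of $G^k\rtimes G$ on itself. *)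

theory Defs
  imports "HOL-Analysis.Analysis" "HOL-Algebra.Group_Action" "HOL-Algebra.Product_Groups"
begin

section \<open>Smooth maps between open subsets of Euclidean spaces\<close>

text \<open>
  The nerve of the pair groupoid involves the manifolds \<open>P^(k+1)\<close> for all \<open>k\<close> simultaneously, so
  dimensions have to be terms rather than types: the Euclidean space of dimension \<open>n\<close> is the library's
  \<^term>\<open>Euclidean_space n\<close>, whose points are the \<open>x :: nat \<Rightarrow> real\<close> with \<open>x i = 0\<close> for \<open>i \<ge> n\<close>.
  A real function is of class \<open>C^r\<close> on an open set \<open>V\<close> if all its iterated partial derivatives of order at
  most \<open>r\<close> exist and are continuous on \<open>V\<close>.  The predicates below are only meaningful for
  \<open>V\<close> open in \<^term>\<open>Euclidean_space n\<close>; then the derivatives depend on the values of \<open>f\<close> on \<open>V\<close> only.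
\<close>

definition partial_deriv :: "nat \<Rightarrow> ((nat \<Rightarrow> real) \<Rightarrow> real) \<Rightarrow> (nat \<Rightarrow> real) \<Rightarrow> real" where
  "partial_deriv i f x = deriv (\<lambda>t. f (x(i := t))) (x i)"

primrec Ck_on :: "nat \<Rightarrow> nat \<Rightarrow> (nat \<Rightarrow> real) set \<Rightarrow> ((nat \<Rightarrow> real) \<Rightarrow> real) \<Rightarrow> bool" where
  "Ck_on n 0 V f \<longleftrightarrow> continuous_map (subtopology (Euclidean_space n) V) euclideanreal f"
| "Ck_on n (Suc r) V f \<longleftrightarrow>
     continuous_map (subtopology (Euclidean_space n) V) euclideanreal f \<and>
     (\<forall>i<n. (\<forall>x\<in>V. (\<lambda>t. f (x(i := t))) field_differentiable (at (x i))) \<and>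
            Ck_on n r V (partial_deriv i f))"

definition smooth_between ::
    "nat \<Rightarrow> nat \<Rightarrow> (nat \<Rightarrow> real) set \<Rightarrow> ((nat \<Rightarrow> real) \<Rightarrow> (nat \<Rightarrow> real)) \<Rightarrow> bool" where
  "smooth_between n m V f \<longleftrightarrow> (\<forall>j<m. \<forall>r. Ck_on n r V (\<lambda>x. f x j))"


section \<open>Smooth manifolds\<close>

text \<open>
  A chart is a pair of its domain and its coordinate map.  The atlas is any smooth atlas
  (not necessarily maximal); smoothness of maps does not depend on the atlas within a smooth structure.
\<close>

type_synonym 'a chart = "'a set \<times> ('a \<Rightarrow> nat \<Rightarrow> real)"

record 'a manifold =
  mtop :: "'a topology"
  mdim :: nat
  matlas :: "'a chart set"

definition pts :: "'a manifold \<Rightarrow> 'a set" where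
  "pts X = topspace (mtop X)"

definition chart_on :: "'a topology \<Rightarrow> nat \<Rightarrow> 'a chart \<Rightarrow> bool" where
  "chart_on T n c \<longleftrightarrow> (case c of (U, \<phi>) \<Rightarrow>
     openin T U \<and> openin (Euclidean_space n) (\<phi> ` U) \<and>
     homeomorphic_map (subtopology T U) (subtopology (Euclidean_space n) (\<phi> ` U)) \<phi>)"

definition smooth_manifold :: "'a manifold \<Rightarrow> bool" where
  "smooth_manifold X \<longleftrightarrow>
     Hausdorff_space (mtop X) \<and> second_countable (mtop X) \<and>
     (\<forall>c\<in>matlas X. chart_on (mtop X) (mdim X) c) \<and>
     (\<Union>c\<in>matlas X. fst c) = pts X \<and>
     (\<forall>(U, \<phi>)\<in>matlas X. \<forall>(W, \<psi>)\<in>matlas X.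
        smooth_between (mdim X) (mdim X) (\<phi> ` (U \<inter> W)) (\<psi> \<circ> inv_into U \<phi>))"

definition smooth_map :: "'a manifold \<Rightarrow> 'b manifold \<Rightarrow> ('a \<Rightarrow> 'b) \<Rightarrow> bool" where
  "smooth_map X Y f \<longleftrightarrow>
     continuous_map (mtop X) (mtop Y) f \<and>
     (\<forall>(U, \<phi>)\<in>matlas X. \<forall>(W, \<psi>)\<in>matlas Y.
        smooth_between (mdim X) (mdim Y) (\<phi> ` {x\<in>U. f x \<in> W}) (\<psi> \<circ> f \<circ> inv_into U \<phi>))"

definition diffeomorphism :: "'a manifold \<Rightarrow> 'b manifold \<Rightarrow> ('a \<Rightarrow> 'b) \<Rightarrow> bool" where
  "diffeomorphism X Y f \<longleftrightarrow>
     bij_betw f (pts X) (pts Y) \<and> smooth_map X Y f \<and> smooth_map Y X (inv_into (pts X) f)"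

definition open_submanifold :: "'a manifold \<Rightarrow> 'a set \<Rightarrow> 'a manifold" where
  "open_submanifold X S =
     \<lparr>mtop = subtopology (mtop X) S, mdim = mdim X,
      matlas = (\<lambda>(U, \<phi>). (U \<inter> S, \<phi>)) ` matlas X\<rparr>"

text \<open>The coordinates of a product chart are those of the factors, concatenated.\<close>

definition prod_manifold :: "'a manifold \<Rightarrow> 'b manifold \<Rightarrow> ('a \<times> 'b) manifold" where
  "prod_manifold X Y =
     \<lparr>mtop = prod_topology (mtop X) (mtop Y), mdim = mdim X + mdim Y,
      matlas = {(U \<times> W, \<lambda>(x, y) i. if i < mdim X then \<phi> x i else \<psi> y (i - mdim X)) | U \<phi> W \<psi>.
                  (U, \<phi>) \<in> matlas X \<and> (W, \<psi>) \<in> matlas Y}\<rparr>"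

text \<open>
  \<open>power_manifold k X\<close> is the \<open>(k+1)\<close>-fold power of \<open>X\<close>; a tuple \<open>(x\<^sub>k, \<dots>, x\<^sub>1, x\<^sub>0)\<close> is the function
  \<open>x\<close> on \<open>{..k}\<close> with \<open>x i = x\<^sub>i\<close>.
\<close>

definition power_manifold :: "nat \<Rightarrow> 'a manifold \<Rightarrow> (nat \<Rightarrow> 'a) manifold" where
  "power_manifold k X =
     \<lparr>mtop = product_topology (\<lambda>_. mtop X) {..k}, mdim = Suc k * mdim X,
      matlas = {(\<Pi>\<^sub>E i\<in>{..k}. fst (c i),
                 \<lambda>x j. if j < Suc k * mdim X
                       then snd (c (j div mdim X)) (x (j div mdim X)) (j mod mdim X) else 0) | c.
                  \<forall>i\<le>k. c i \<in> matlas X}\<rparr>"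


section \<open>Lie groups and principal bundles\<close>

record 'g lie_group = "'g monoid" +
  gmfd :: "'g manifold"

definition is_lie_group :: "'g lie_group \<Rightarrow> bool" where
  "is_lie_group G \<longleftrightarrow>
     group G \<and> smooth_manifold (gmfd G) \<and> pts (gmfd G) = carrier G \<and>
     smooth_map (prod_manifold (gmfd G) (gmfd G)) (gmfd G) (\<lambda>(a, b). a \<otimes>\<^bsub>G\<^esub> b) \<and>
     smooth_map (gmfd G) (gmfd G) (\<lambda>a. inv\<^bsub>G\<^esub> a)"

text \<open>
  Principal bundles carry left actions and are locally trivial.  Freeness of the action and the fact that
  its orbits are the fibres of \<open>\<pi>\<close> follow from the local trivializations.
\<close>

definition local_trivialization ::
    "'g lie_group \<Rightarrow> 'p manifold \<Rightarrow> 'm manifold \<Rightarrow> ('p \<Rightarrow> 'm) \<Rightarrow> ('g \<Rightarrow> 'p \<Rightarrow> 'p) \<Rightarrow>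
     'm set \<Rightarrow> ('p \<Rightarrow> 'm \<times> 'g) \<Rightarrow> bool" where
  "local_trivialization G P M \<pi> act U \<Phi> \<longleftrightarrow>
     openin (mtop M) U \<and>
     diffeomorphism (open_submanifold P {p\<in>pts P. \<pi> p \<in> U})
       (prod_manifold (open_submanifold M U) (gmfd G)) \<Phi> \<and>
     (\<forall>p\<in>pts P. \<pi> p \<in> U \<longrightarrow>
        fst (\<Phi> p) = \<pi> p \<and>
        (\<forall>g\<in>carrier G. \<Phi> (act g p) = (\<pi> p, g \<otimes>\<^bsub>G\<^esub> snd (\<Phi> p))))"

definition principal_bundle ::
    "'g lie_group \<Rightarrow> 'p manifold \<Rightarrow> 'm manifold \<Rightarrow> ('p \<Rightarrow> 'm) \<Rightarrow> ('g \<Rightarrow> 'p \<Rightarrow> 'p) \<Rightarrow> bool" where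
  "principal_bundle G P M \<pi> act \<longleftrightarrow>
     is_lie_group G \<and> smooth_manifold P \<and> smooth_manifold M \<and>
     smooth_map P M \<pi> \<and> \<pi> ` pts P = pts M \<and>
     group_action G (pts P) act \<and>
     smooth_map (prod_manifold (gmfd G) P) P (\<lambda>(g, p). act g p) \<and>
     (\<forall>g\<in>carrier G. \<forall>p\<in>pts P. \<pi> (act g p) = \<pi> p) \<and>
     (\<forall>x\<in>pts M. \<exists>U \<Phi>. x \<in> U \<and> local_trivialization G P M \<pi> act U \<Phi>)"


section \<open>Gauge transformations and equivariant group-valued maps\<close>

text \<open>
  As in \<^const>\<open>BijGroup\<close>, maps between carrier sets are represented by extensional functions.
  \<open>K\<close> acts on \<open>X\<close> by \<open>act\<close>, and \<open>\<pi>\<close> is the bundle projection from \<open>X\<close>.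
\<close>

definition gauge_group ::
    "'k lie_group \<Rightarrow> 'x manifold \<Rightarrow> ('x \<Rightarrow> 'b) \<Rightarrow> ('k \<Rightarrow> 'x \<Rightarrow> 'x) \<Rightarrow> ('x \<Rightarrow> 'x) monoid" where
  "gauge_group K X \<pi> act =
     \<lparr>carrier = {f \<in> extensional (pts X). smooth_map X X f \<and>
                  (\<forall>a\<in>carrier K. \<forall>x\<in>pts X. f (act a x) = act a (f x)) \<and>
                  (\<forall>x\<in>pts X. \<pi> (f x) = \<pi> x)},
      mult = compose (pts X),
      one = (\<lambda>x\<in>pts X. x)\<rparr>"

definition equivariant_maps ::
    "'k lie_group \<Rightarrow> 'x manifold \<Rightarrow> ('k \<Rightarrow> 'x \<Rightarrow> 'x) \<Rightarrow> ('x \<Rightarrow> 'k) monoid" where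
  "equivariant_maps K X act =
     \<lparr>carrier = {\<tau> \<in> extensional (pts X). smooth_map X (gmfd K) \<tau> \<and>
                  (\<forall>a\<in>carrier K. \<forall>x\<in>pts X. \<tau> (act a x) = a \<otimes>\<^bsub>K\<^esub> \<tau> x \<otimes>\<^bsub>K\<^esub> inv\<^bsub>K\<^esub> a)},
      mult = (\<lambda>\<sigma> \<tau>. \<lambda>x\<in>pts X. \<sigma> x \<otimes>\<^bsub>K\<^esub> \<tau> x),
      one = (\<lambda>x\<in>pts X. \<one>\<^bsub>K\<^esub>)\<rparr>"

text \<open>
  The gauge transformation determined by an equivariant map \<open>\<tau>\<close>.  For left actions, \<open>x \<mapsto> \<tau>(x)\<cdot>x\<close> would turn
  pointwise products into compositions in the opposite order; the inverse makes it a homomorphism.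
\<close>

definition gauge_of_map ::
    "'k lie_group \<Rightarrow> 'x manifold \<Rightarrow> ('k \<Rightarrow> 'x \<Rightarrow> 'x) \<Rightarrow> ('x \<Rightarrow> 'k) \<Rightarrow> ('x \<Rightarrow> 'x)" where
  "gauge_of_map K X act \<tau> = (\<lambda>x\<in>pts X. act (inv\<^bsub>K\<^esub> (\<tau> x)) x)"


section \<open>The pair groupoid and its bundle groupoid automorphisms\<close>

text \<open>The structure maps of a Lie groupoid; \<open>gcomp x y\<close> is \<open>x \<circ> y\<close>, used when \<open>gsrc x = gtgt y\<close>.\<close>

record ('o, 'a) lie_groupoid =
  gobj :: "'o manifold"
  garr :: "'a manifold"
  gsrc :: "'a \<Rightarrow> 'o"
  gtgt :: "'a \<Rightarrow> 'o"
  gunit :: "'o \<Rightarrow> 'a"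
  gcomp :: "'a \<Rightarrow> 'a \<Rightarrow> 'a"

definition pair_groupoid :: "'p manifold \<Rightarrow> ('p, 'p \<times> 'p) lie_groupoid" where
  "pair_groupoid X =
     \<lparr>gobj = X, garr = prod_manifold X X, gsrc = snd, gtgt = fst,
      gunit = (\<lambda>p. (p, p)), gcomp = (\<lambda>(p, q) (q', r). (p, r))\<rparr>"

text \<open>A morphism is a pair of a map on arrows and a map on objects.\<close>

definition lie_groupoid_morphism ::
    "('o, 'a) lie_groupoid \<Rightarrow> ('o2, 'a2) lie_groupoid \<Rightarrow> ('a \<Rightarrow> 'a2) \<times> ('o \<Rightarrow> 'o2) \<Rightarrow> bool" where
  "lie_groupoid_morphism A B = (\<lambda>(F, F\<^sub>0).
     smooth_map (garr A) (garr B) F \<and> smooth_map (gobj A) (gobj B) F\<^sub>0 \<and>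
     (\<forall>x\<in>pts (garr A). gsrc B (F x) = F\<^sub>0 (gsrc A x) \<and> gtgt B (F x) = F\<^sub>0 (gtgt A x)) \<and>
     (\<forall>p\<in>pts (gobj A). F (gunit A p) = gunit B (F\<^sub>0 p)) \<and>
     (\<forall>x\<in>pts (garr A). \<forall>y\<in>pts (garr A).
        gsrc A x = gtgt A y \<longrightarrow> F (gcomp A x y) = gcomp B (F x) (F y)))"

text \<open>
  The Lie group of arrows of the Lie 2-group \<open>G \<rtimes> G \<rightrightarrows> G\<close>, with elements \<open>(h, g)\<close>, and its action
  on the arrows of the pair groupoid.
\<close>

definition two_group_arrows :: "'g lie_group \<Rightarrow> ('g \<times> 'g) lie_group" where
  "two_group_arrows G =
     \<lparr>carrier = carrier G \<times> carrier G,
      mult = (\<lambda>(h\<^sub>2, g\<^sub>2) (h\<^sub>1, g\<^sub>1). (h\<^sub>2 \<otimes>\<^bsub>G\<^esub> (g\<^sub>2 \<otimes>\<^bsub>G\<^esub> h\<^sub>1 \<otimes>\<^bsub>G\<^esub> inv\<^bsub>G\<^esub> g\<^sub>2), g\<^sub>2 \<otimes>\<^bsub>G\<^esub> g\<^sub>1)),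
      one = (\<one>\<^bsub>G\<^esub>, \<one>\<^bsub>G\<^esub>),
      gmfd = prod_manifold (gmfd G) (gmfd G)\<rparr>"

definition arrow_action ::
    "'g lie_group \<Rightarrow> ('g \<Rightarrow> 'p \<Rightarrow> 'p) \<Rightarrow> 'g \<times> 'g \<Rightarrow> 'p \<times> 'p \<Rightarrow> 'p \<times> 'p" where
  "arrow_action G act = (\<lambda>(h, g) (p, q). (act (h \<otimes>\<^bsub>G\<^esub> g) p, act g q))"

definition pair_groupoid_gauge_group ::
    "'g lie_group \<Rightarrow> 'p manifold \<Rightarrow> ('p \<Rightarrow> 'm) \<Rightarrow> ('g \<Rightarrow> 'p \<Rightarrow> 'p) \<Rightarrow>
     (('p \<times> 'p \<Rightarrow> 'p \<times> 'p) \<times> ('p \<Rightarrow> 'p)) monoid" where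
  "pair_groupoid_gauge_group G P \<pi> act =
     (let \<Gamma> = pair_groupoid P in
      \<lparr>carrier = {(F, F\<^sub>0).
         F \<in> extensional (pts (garr \<Gamma>)) \<and> F\<^sub>0 \<in> extensional (pts (gobj \<Gamma>)) \<and>
         lie_groupoid_morphism \<Gamma> \<Gamma> (F, F\<^sub>0) \<and>
         (\<forall>a\<in>carrier (two_group_arrows G). \<forall>x\<in>pts (garr \<Gamma>).
            F (arrow_action G act a x) = arrow_action G act a (F x)) \<and>
         (\<forall>g\<in>carrier G. \<forall>p\<in>pts (gobj \<Gamma>). F\<^sub>0 (act g p) = act g (F\<^sub>0 p)) \<and>
         (\<forall>x\<in>pts (garr \<Gamma>). map_prod \<pi> \<pi> (F x) = map_prod \<pi> \<pi> x) \<and>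
         (\<forall>p\<in>pts (gobj \<Gamma>). \<pi> (F\<^sub>0 p) = \<pi> p)},
       mult = (\<lambda>(F, F\<^sub>0) (H, H\<^sub>0). (compose (pts (garr \<Gamma>)) F H, compose (pts (gobj \<Gamma>)) F\<^sub>0 H\<^sub>0)),
       one = (\<lambda>x\<in>pts (garr \<Gamma>). x, \<lambda>p\<in>pts (gobj \<Gamma>). p)\<rparr>)"

definition hat :: "'p manifold \<Rightarrow> ('p \<Rightarrow> 'p) \<Rightarrow> ('p \<times> 'p \<Rightarrow> 'p \<times> 'p) \<times> ('p \<Rightarrow> 'p)" where
  "hat P f = (\<lambda>(p, q)\<in>pts (prod_manifold P P). (f p, f q), f)"


section \<open>The nerve of the pair groupoid\<close>

text \<open>
  Level \<open>k\<close> of the nerve of the pair groupoid of \<open>X\<close> is \<open>power_manifold k X\<close>.  For \<open>k \<ge> 1\<close>, the tuple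
  \<open>(x\<^sub>k, \<dots>, x\<^sub>0)\<close> encodes the composable arrows \<open>(x\<^sub>k, x\<^sub>k\<^sub>-\<^sub>1), \<dots>, (x\<^sub>1, x\<^sub>0)\<close>, indexed by \<open>{1..k}\<close>;
  \<open>nerve_vertices k\<close> recovers the tuple from the arrows.
\<close>

definition nerve_edges :: "nat \<Rightarrow> (nat \<Rightarrow> 'p) \<Rightarrow> (nat \<Rightarrow> 'p \<times> 'p)" where
  "nerve_edges k x = (\<lambda>i\<in>{1..k}. (x i, x (i - 1)))"

definition nerve_vertices :: "nat \<Rightarrow> (nat \<Rightarrow> 'p \<times> 'p) \<Rightarrow> (nat \<Rightarrow> 'p)" where
  "nerve_vertices k e = (\<lambda>i\<in>{..k}. if i = 0 then snd (e 1) else fst (e i))"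

text \<open>A morphism acts on objects for \<open>k = 0\<close>, and on each arrow of a composable string for \<open>k \<ge> 1\<close>.\<close>

definition nerve_map ::
    "'p manifold \<Rightarrow> nat \<Rightarrow> ('p \<times> 'p \<Rightarrow> 'p \<times> 'p) \<times> ('p \<Rightarrow> 'p) \<Rightarrow> (nat \<Rightarrow> 'p) \<Rightarrow> (nat \<Rightarrow> 'p)" where
  "nerve_map P k = (\<lambda>(F, F\<^sub>0). \<lambda>x\<in>pts (power_manifold k P).
     if k = 0 then (\<lambda>i\<in>{..0}. F\<^sub>0 (x i))
     else nerve_vertices k (\<lambda>i\<in>{1..k}. F (nerve_edges k x i)))"

text \<open>
  The Lie group \<open>G^k \<rtimes> G\<close>: the element \<open>(h\<^sub>k, \<dots>, h\<^sub>1, g)\<close> is the function \<open>a\<close> on \<open>{..k}\<close> with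
  \<open>a 0 = g\<close> and \<open>a i = h\<^sub>i\<close> for \<open>1 \<le> i \<le> k\<close>.
\<close>

definition nerve_group :: "nat \<Rightarrow> 'g lie_group \<Rightarrow> (nat \<Rightarrow> 'g) lie_group" where
  "nerve_group k G =
     \<lparr>carrier = (\<Pi>\<^sub>E i\<in>{..k}. carrier G),
      mult = (\<lambda>a b. \<lambda>i\<in>{..k}. if i = 0 then a 0 \<otimes>\<^bsub>G\<^esub> b 0
                             else a i \<otimes>\<^bsub>G\<^esub> (a 0 \<otimes>\<^bsub>G\<^esub> b i \<otimes>\<^bsub>G\<^esub> inv\<^bsub>G\<^esub> (a 0))),
      one = (\<lambda>i\<in>{..k}. \<one>\<^bsub>G\<^esub>),
      gmfd = power_manifold k (gmfd G)\<rparr>"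

definition nerve_action ::
    "nat \<Rightarrow> 'g lie_group \<Rightarrow> ('g \<Rightarrow> 'p \<Rightarrow> 'p) \<Rightarrow> (nat \<Rightarrow> 'g) \<Rightarrow> (nat \<Rightarrow> 'p) \<Rightarrow> (nat \<Rightarrow> 'p)" where
  "nerve_action k G act a x =
     (\<lambda>i\<in>{..k}. if i = 0 then act (a 0) (x 0) else act (a i \<otimes>\<^bsub>G\<^esub> a 0) (x i))"

definition nerve_proj :: "nat \<Rightarrow> ('p \<Rightarrow> 'm) \<Rightarrow> (nat \<Rightarrow> 'p) \<Rightarrow> (nat \<Rightarrow> 'm)" where
  "nerve_proj k \<pi> x = (\<lambda>i\<in>{..k}. \<pi> (x i))"

definition nerve_gauge_group ::
    "'g lie_group \<Rightarrow> 'p manifold \<Rightarrow> ('p \<Rightarrow> 'm) \<Rightarrow> ('g \<Rightarrow> 'p \<Rightarrow> 'p) \<Rightarrow> nat \<Rightarrow>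
     ((nat \<Rightarrow> 'p) \<Rightarrow> (nat \<Rightarrow> 'p)) monoid" where
  "nerve_gauge_group G P \<pi> act k =
     gauge_group (nerve_group k G) (power_manifold k P) (nerve_proj k \<pi>) (nerve_action k G act)"

definition nerve_equivariant_maps ::
    "'g lie_group \<Rightarrow> 'p manifold \<Rightarrow> ('g \<Rightarrow> 'p \<Rightarrow> 'p) \<Rightarrow> nat \<Rightarrow>
     ((nat \<Rightarrow> 'p) \<Rightarrow> (nat \<Rightarrow> 'g)) monoid" where
  "nerve_equivariant_maps G P act k =
     equivariant_maps (nerve_group k G) (power_manifold k P) (nerve_action k G act)"

end

theory Submission
  imports Defs
begin

text \<open>
  A gauge transformation \<open>f\<close> of a principal \<open>K\<close>-bundle \<open>X\<close> moves each point within its orbit, so freeness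
  gives a unique map \<open>\<sigma> : X \<rightarrow> K\<close> with \<open>f x = \<sigma>(x) \<cdot> x\<close>.  In a local trivialization \<open>\<sigma>\<close> is a quotient of
  fibre coordinates, hence smooth, and equivariance of \<open>f\<close> becomes conjugation equivariance of \<open>\<sigma>\<close>.
  The inverse \<open>\<tau> = \<sigma>\<inverse>\<close> turns composition into the pointwise product; in particular gauge
  transformations are invertible.  On the nerve the division map is computed component by component:
  if \<open>f(x)\<^sub>i = d\<^sub>i(x) \<cdot> x\<^sub>i\<close> with \<open>d\<^sub>i\<close> in \<open>G\<close>, the element of \<open>G^k \<rtimes> G\<close> is \<open>(d\<^sub>k d\<^sub>0\<inverse>, \<dots>, d\<^sub>1 d\<^sub>0\<inverse>, d\<^sub>0)\<close>.
  Since an arrow of the pair groupoid is determined by its end points, every automorphism of the pair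
  groupoid is \<open>f \<times> f\<close> for its object map \<open>f\<close>, and \<open>f\<close> can be read off from constant tuples in the nerve.
\<close>

section \<open>Smooth functions on Euclidean spaces\<close>

text \<open>The analytic obstacle: smoothness is quantified over pairs of charts and expressed by
  iterated partial derivatives, while a composite has to pass through charts of the middle manifold
  that cover the image only locally. Hence a chain rule is derived from the mean value theorem, and
  smoothness is recast as a property at a point, which survives composition and shrinking of
  neighbourhoods. The geometric part is arranged so that \<open>P\<close> and all its powers are
  instances of one locale. Its smoothness conditions concern maps out of \<open>X\<close>, and for a
  power these reduce to the components. Local triviality enters only through freeness of the action
  on \<open>P\<close> and through division of two maps into \<open>P\<close> from an arbitrary
  source; trivializations of the powers are never built. Inverse gauge transformations are not
  constructed directly. The group structure is transported from the equivariant maps, where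
  inversion is pointwise, and then along \<open>hat\<close>.\<close>

abbreviation Espace :: "nat \<Rightarrow> (nat \<Rightarrow> real) set" where
  "Espace n \<equiv> topspace (Euclidean_space n)"

lemma in_Espace: "x \<in> Espace n \<longleftrightarrow> (\<forall>i\<ge>n. x i = 0)"
  by (simp add: topspace_Euclidean_space)

lemma Espace_eqI:
  assumes "x \<in> Espace n" "y \<in> Espace n" "\<And>i. i < n \<Longrightarrow> x i = y i"
  shows "x = y"
proof
  fix i show "x i = y i"
    using assms by (cases "i < n") (auto simp: in_Espace)
qed

lemma Espace_upd: "x \<in> Espace n \<Longrightarrow> i < n \<Longrightarrow> x(i := t) \<in> Espace n"
  by (auto simp: in_Espace)

lemma Euclidean_space_eq_top_of_set: "Euclidean_space n = top_of_set (Espace n)"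
  by (simp add: Euclidean_space_def euclidean_product_topology topspace_Euclidean_space)

lemma continuous_map_Euclidean_sub_iff:
  "continuous_map (subtopology (Euclidean_space n) V) euclideanreal f
     \<longleftrightarrow> continuous_on (Espace n \<inter> V) f"
  by (subst Euclidean_space_eq_top_of_set) (simp add: subtopology_subtopology)

lemma openin_Euclidean_iff:
  "openin (Euclidean_space n) W \<longleftrightarrow> (\<exists>T. open T \<and> W = Espace n \<inter> T)"
  by (subst Euclidean_space_eq_top_of_set) (simp add: openin_open)

text \<open>Only the first \<open>n\<close> coordinates of a basic neighbourhood matter: beyond them
  the points of \<open>Espace n\<close> coincide with \<open>x\<close>, so the least of finitely
  many radii works.\<close>

lemma openin_Euclidean_box:
  assumes "openin (Euclidean_space n) V" "x \<in> V"
  obtains d where "d > 0" "\<And>z. z \<in> Espace n \<Longrightarrow> (\<And>i. i < n \<Longrightarrow> \<bar>z i - x i\<bar> < d) \<Longrightarrow> z \<in> V"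
proof -
  obtain T where T: "openin (powertop_real UNIV) T" "V = T \<inter> {x. \<forall>i\<ge>n. x i = 0}"
    using assms(1) by (auto simp: Euclidean_space_def openin_subtopology)
  then have "x \<in> T" using assms(2) by auto
  from product_topology_open_contains_basis[OF T(1) this]
  obtain X where X: "x \<in> (\<Pi>\<^sub>E i\<in>UNIV. X i)" "\<And>i. open (X i)" "(\<Pi>\<^sub>E i\<in>UNIV. X i) \<subseteq> T"
    by auto
  have "\<exists>e>0. ball (x i) e \<subseteq> X i" for i
    using X(1,2) by (meson PiE_mem UNIV_I open_contains_ball_eq)
  then obtain e where e: "\<And>i. e i > 0" "\<And>i. ball (x i) (e i) \<subseteq> X i" by metis
  \<comment> \<open>\<open>insert 1\<close> keeps the minimum meaningful and positive when
    \<open>n = 0\<close>.\<close>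
  define d where "d = Min (insert 1 (e ` {..<n}))"
  have d: "d > 0" "\<And>i. i < n \<Longrightarrow> d \<le> e i" using e(1) by (auto simp: d_def)
  have "z \<in> V" if z: "z \<in> Espace n" "\<And>i. i < n \<Longrightarrow> \<bar>z i - x i\<bar> < d" for z
  proof -
    have "z i \<in> X i" for i
    proof (cases "i < n")
      case True
      then have "z i \<in> ball (x i) (e i)" using z(2)[OF True] d(2)[OF True]
        by (auto simp: dist_real_def abs_minus_commute)
      then show ?thesis using e(2) by blast
    next
      case False
      then have "z i = x i" using z(1) assms(2) T(2) by (auto simp: in_Espace)
      then show ?thesis using X(1) by (auto simp: PiE_iff)
    qed
    then show ?thesis using X(3) z(1) T(2) by (auto simp: in_Espace PiE_iff)
  qed
  with d(1) that show ?thesis by blast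
qed

text \<open>This is how openness reaches partial derivatives: near \<open>x i\<close> the coordinate
  line through \<open>x\<close> stays in \<open>V\<close>, so \<open>deriv\<close> sees only values
  taken on \<open>V\<close>.\<close>

lemma openin_Euclidean_line:
  assumes "openin (Euclidean_space n) V" "x \<in> V" "i < n"
  shows "\<forall>\<^sub>F t in nhds (x i). x(i := t) \<in> V"
proof -
  obtain d where d: "d > 0" "\<And>z. z \<in> Espace n \<Longrightarrow> (\<And>i. i < n \<Longrightarrow> \<bar>z i - x i\<bar> < d) \<Longrightarrow> z \<in> V"
    using openin_Euclidean_box[OF assms(1,2)] by blast
  have "x \<in> Espace n" using assms openin_subset by blast
  have "\<forall>\<^sub>F t in nhds (x i). dist t (x i) < d" using d(1) eventually_nhds_metric by blast
  then show ?thesis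
  proof eventually_elim
    case (elim t)
    then show ?case using d \<open>x \<in> Espace n\<close> \<open>i < n\<close>
      by (intro d(2) Espace_upd) (auto simp: dist_real_def)
  qed
qed

section \<open>Locality and arithmetic of C^r functions\<close>

lemma partial_deriv_cong:
  assumes "openin (Euclidean_space n) V" "x \<in> V" "i < n" "\<And>y. y \<in> V \<Longrightarrow> f y = g y"
  shows "partial_deriv i f x = partial_deriv i g x"
  unfolding partial_deriv_def
  by (rule deriv_cong_ev, rule eventually_mono[OF openin_Euclidean_line[OF assms(1-3)]]) (auto simp: assms(4))

lemma Ck_on_subset: "Ck_on n r V f \<Longrightarrow> W \<subseteq> V \<Longrightarrow> Ck_on n r W f"
  by (induction r arbitrary: f)
     (auto simp: continuous_map_Euclidean_sub_iff intro: continuous_on_subset)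

lemma Ck_on_imp_continuous_on: "Ck_on n r V f \<Longrightarrow> continuous_on (Espace n \<inter> V) f"
  by (cases r) (auto simp: continuous_map_Euclidean_sub_iff)

lemma Ck_on_Suc_imp: "Ck_on n (Suc r) V f \<Longrightarrow> Ck_on n r V f"
  by (induction r arbitrary: f) auto

lemma Ck_on_cong:
  assumes "openin (Euclidean_space n) V" "\<And>y. y \<in> V \<Longrightarrow> f y = g y" "Ck_on n r V f"
  shows "Ck_on n r V g"
  using assms(2,3)
proof (induction r arbitrary: f g)
  case (0 f g)
  then show ?case
    by (simp add: continuous_map_Euclidean_sub_iff) (metis IntD2 continuous_on_cong)
next
  case (Suc r f g)
  have "(\<lambda>t. g (x(i := t))) field_differentiable at (x i)" if "i < n" "x \<in> V" for i x
  proof -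
    have "(\<lambda>t. f (x(i := t))) field_differentiable at (x i)" using Suc.prems(2) that by auto
    moreover have "\<forall>\<^sub>F t in nhds (x i). f (x(i := t)) = g (x(i := t))"
      by (rule eventually_mono[OF openin_Euclidean_line[OF assms(1) that(2,1)]]) (rule Suc.prems(1))
    ultimately show ?thesis unfolding field_differentiable_def
      using DERIV_cong_ev[of "x i" "x i" "\<lambda>t. f (x(i := t))" "\<lambda>t. g (x(i := t))"] by metis
  qed
  moreover have "Ck_on n r V (partial_deriv i g)" if "i < n" for i
    using Suc.IH[of "partial_deriv i f" "partial_deriv i g"] Suc.prems that
      partial_deriv_cong[OF assms(1) _ that, of _ f g] by auto
  moreover have "continuous_map (subtopology (Euclidean_space n) V) euclideanreal g"
    using Suc.prems by (simp add: continuous_map_Euclidean_sub_iff) (metis IntD2 continuous_on_cong)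
  ultimately show ?case by simp
qed

text \<open>Every clause of \<open>Ck_on\<close> can be checked point by point. For continuity, an
  open \<open>W\<close> around \<open>y\<close> leaves the filter
  \<open>at y within Espace n\<close> unchanged; differentiability along a line and the functions
  \<open>partial_deriv i f\<close> do not mention the domain at all.\<close>

lemma Ck_on_local:
  assumes "V \<subseteq> Espace n"
    and "\<And>y. y \<in> V \<Longrightarrow> \<exists>W. openin (Euclidean_space n) W \<and> y \<in> W \<and> Ck_on n r W f"
  shows "Ck_on n r V f"
proof -
  have cont: "continuous_on (Espace n \<inter> V) f"
    if loc: "\<forall>y\<in>V. \<exists>W. openin (Euclidean_space n) W \<and> y \<in> W \<and> continuous_on (Espace n \<inter> W) f"
    for f :: "(nat \<Rightarrow> real) \<Rightarrow> real"
    unfolding continuous_on_eq_continuous_within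
  proof
    fix y assume y: "y \<in> Espace n \<inter> V"
    then obtain W where W: "openin (Euclidean_space n) W" "y \<in> W" "continuous_on (Espace n \<inter> W) f"
      using loc by blast
    obtain T where T: "open T" "W = Espace n \<inter> T"
      using W(1) openin_Euclidean_iff by blast
    have "continuous (at y within Espace n \<inter> W) f"
      using W y unfolding continuous_on_eq_continuous_within by blast
    moreover have "at y within Espace n \<inter> W = at y within Espace n"
      using T W(2) by (intro at_within_nhd[of y T]) auto
    ultimately have "continuous (at y within Espace n) f" by simp
    then show "continuous (at y within Espace n \<inter> V) f"
      by (rule continuous_within_subset) simp
  qed
  show ?thesis using assms(2)
  proof (induction r arbitrary: f)
    case (0 f)
    then show ?case
      unfolding Ck_on.simps continuous_map_Euclidean_sub_iff using cont by blast
  next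
    case (Suc r f)
    have "continuous_on (Espace n \<inter> V) f"
    proof (rule cont, rule ballI)
      fix y assume "y \<in> V"
      from Suc.prems[OF this] show "\<exists>W. openin (Euclidean_space n) W \<and> y \<in> W \<and> continuous_on (Espace n \<inter> W) f"
        using Ck_on_imp_continuous_on by blast
    qed
    moreover have "Ck_on n r V (partial_deriv i f)" if "i < n" for i
    proof (rule Suc.IH)
      fix y assume "y \<in> V"
      from Suc.prems[OF this] that
      show "\<exists>W. openin (Euclidean_space n) W \<and> y \<in> W \<and> Ck_on n r W (partial_deriv i f)"
        unfolding Ck_on.simps by blast
    qed
    moreover have "(\<lambda>t. f (x(i := t))) field_differentiable at (x i)" if "i < n" "x \<in> V" for i x
      using Suc.prems[OF that(2)] that(1) unfolding Ck_on.simps by blast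
    ultimately show ?case by (simp add: continuous_map_Euclidean_sub_iff)
  qed
qed

lemma Ck_on_const: "Ck_on n r V (\<lambda>_. c)"
proof (induction r arbitrary: c)
  case (Suc r)
  have "partial_deriv i (\<lambda>_. c) = (\<lambda>_. 0)" for i by (auto simp: partial_deriv_def)
  with Suc show ?case by (auto simp: continuous_map_Euclidean_sub_iff)
qed (auto simp: continuous_map_Euclidean_sub_iff)

text \<open>No induction is required: the partial derivatives are the constants 0 and 1, already
  known to be of every class.\<close>

lemma Ck_on_coordinate: "Ck_on n r V (\<lambda>x. x j)"
proof (cases r)
  case 0 then show ?thesis by (auto simp: continuous_map_Euclidean_sub_iff intro!: continuous_on_product_coordinates continuous_on_subset[OF continuous_on_product_coordinates])
next
  case (Suc r)
  have "partial_deriv i (\<lambda>x. x j) = (\<lambda>_. if i = j then 1 else 0)" for i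
    by (auto simp: partial_deriv_def)
  moreover have "(\<lambda>t. (x(i := t)) j) field_differentiable at s" for x :: "nat \<Rightarrow> real" and i s
    by (cases "i = j") (auto intro: field_differentiable_ident)
  ultimately show ?thesis using Suc
    by (auto simp: continuous_map_Euclidean_sub_iff Ck_on_const simp del: fun_upd_apply intro!: continuous_on_subset[OF continuous_on_product_coordinates])
qed

lemma Ck_on_SucD:
  assumes "Ck_on n (Suc r) V f" "i < n"
  shows "x \<in> V \<Longrightarrow> (\<lambda>t. f (x(i := t))) field_differentiable at (x i)"
    and "Ck_on n r V (partial_deriv i f)"
  using assms unfolding Ck_on.simps by blast+

lemma Ck_on_add:
  assumes "openin (Euclidean_space n) V" "Ck_on n r V f" "Ck_on n r V g"
  shows "Ck_on n r V (\<lambda>x. f x + g x)"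
  using assms(2,3)
proof (induction r arbitrary: f g)
  case (0 f g)
  then show ?case unfolding Ck_on.simps continuous_map_Euclidean_sub_iff by (rule continuous_on_add)
next
  case (Suc r f g)
  have "Ck_on n r V (partial_deriv i (\<lambda>x. f x + g x))" if "i < n" for i
  proof (rule Ck_on_cong[OF assms(1)])
    show "Ck_on n r V (\<lambda>x. partial_deriv i f x + partial_deriv i g x)"
      by (intro Suc.IH Ck_on_SucD[OF _ that] Suc.prems)
    fix x assume "x \<in> V"
    then show "partial_deriv i f x + partial_deriv i g x = partial_deriv i (\<lambda>x. f x + g x) x"
      unfolding partial_deriv_def
      by (intro deriv_add[symmetric] Ck_on_SucD(1)[OF Suc.prems(1) that(1)] Ck_on_SucD(1)[OF Suc.prems(2) that(1)])
  qed
  moreover have "(\<lambda>t. f (x(i := t)) + g (x(i := t))) field_differentiable at (x i)" if "i < n" "x \<in> V" for i x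
    using that by (intro field_differentiable_add Ck_on_SucD(1)[OF Suc.prems(1) that(1)] Ck_on_SucD(1)[OF Suc.prems(2) that(1)])
  moreover have "continuous_on (Espace n \<inter> V) (\<lambda>x. f x + g x)"
    by (intro continuous_on_add Ck_on_imp_continuous_on[OF Suc.prems(1)] Ck_on_imp_continuous_on[OF Suc.prems(2)])
  ultimately show ?case unfolding Ck_on.simps continuous_map_Euclidean_sub_iff by blast
qed

text \<open>The product rule pairs a derivative of one factor with the other factor itself, whose
  class is lowered from \<open>Suc r\<close> to \<open>r\<close> before the induction hypothesis
  applies.\<close>

lemma Ck_on_mult:
  assumes "openin (Euclidean_space n) V" "Ck_on n r V f" "Ck_on n r V g"
  shows "Ck_on n r V (\<lambda>x. f x * g x)"
  using assms(2,3)
proof (induction r arbitrary: f g)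
  case (0 f g)
  then show ?case unfolding Ck_on.simps continuous_map_Euclidean_sub_iff by (rule continuous_on_mult)
next
  case (Suc r f g)
  have "Ck_on n r V (partial_deriv i (\<lambda>x. f x * g x))" if "i < n" for i
  proof (rule Ck_on_cong[OF assms(1)])
    show "Ck_on n r V (\<lambda>x. f x * partial_deriv i g x + partial_deriv i f x * g x)"
      by (intro Ck_on_add[OF assms(1)] Suc.IH Ck_on_SucD[OF _ that] Ck_on_Suc_imp[OF Suc.prems(1)]
          Ck_on_Suc_imp[OF Suc.prems(2)] Suc.prems)
    fix x assume "x \<in> V"
    \<comment> \<open>\<open>deriv_mult\<close> evaluates the undifferentiated factors on the
      coordinate line, hence the detour through \<open>x(i := x i)\<close>, which is
      \<open>x\<close>.\<close>
    have "partial_deriv i (\<lambda>x. f x * g x) x = f (x(i := x i)) * partial_deriv i g x + partial_deriv i f x * g (x(i := x i))"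
      unfolding partial_deriv_def
      by (intro deriv_mult Ck_on_SucD(1)[OF Suc.prems(1) that(1)] Ck_on_SucD(1)[OF Suc.prems(2) that(1)] \<open>x \<in> V\<close>)
    then show "f x * partial_deriv i g x + partial_deriv i f x * g x = partial_deriv i (\<lambda>x. f x * g x) x"
      by simp
  qed
  moreover have "(\<lambda>t. f (x(i := t)) * g (x(i := t))) field_differentiable at (x i)" if "i < n" "x \<in> V" for i x
    using that by (intro field_differentiable_mult Ck_on_SucD(1)[OF Suc.prems(1) that(1)] Ck_on_SucD(1)[OF Suc.prems(2) that(1)])
  moreover have "continuous_on (Espace n \<inter> V) (\<lambda>x. f x * g x)"
    by (intro continuous_on_mult Ck_on_imp_continuous_on[OF Suc.prems(1)] Ck_on_imp_continuous_on[OF Suc.prems(2)])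
  ultimately show ?case unfolding Ck_on.simps continuous_map_Euclidean_sub_iff by blast
qed

lemma Ck_on_sum:
  assumes "openin (Euclidean_space n) V" "\<And>j. j < (m::nat) \<Longrightarrow> Ck_on n r V (f j)"
  shows "Ck_on n r V (\<lambda>x. \<Sum>j<m. f j x)"
  using assms(2) by (induction m) (auto intro: Ck_on_const Ck_on_add[OF assms(1)])

section \<open>The chain rule\<close>

lemma mean_value_between:
  fixes h :: "real \<Rightarrow> real"
  assumes "\<And>t. \<bar>t - a\<bar> \<le> \<bar>b - a\<bar> \<Longrightarrow> (h has_real_derivative h' t) (at t)"
  obtains \<xi> where "\<bar>\<xi> - a\<bar> \<le> \<bar>b - a\<bar>" "h b - h a = h' \<xi> * (b - a)"
proof (cases a b rule: linorder_cases)
  case less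
  with MVT2[OF less, of h h'] assms obtain z where "a < z" "z < b" "h b - h a = (b - a) * h' z"
    by auto
  with that[of z] show ?thesis by (simp add: mult.commute)
next
  case greater
  with MVT2[OF greater, of h h'] assms obtain z where "b < z" "z < a" "h a - h b = (a - b) * h' z"
    by auto
  with that[of z] show ?thesis by (simp add: algebra_simps)
qed (use that[of a] in simp)

lemma openin_Ck_on_preimage:
  fixes f :: "(nat \<Rightarrow> real) \<Rightarrow> real"
  assumes "openin (Euclidean_space n) V" "continuous_on (Espace n \<inter> V) f" "open S"
  shows "openin (Euclidean_space n) {x \<in> V. f x \<in> S}"
proof -
  have "continuous_map (subtopology (Euclidean_space n) V) euclideanreal f"
    using assms(2) by (simp add: continuous_map_Euclidean_sub_iff)
  from openin_continuous_map_preimage[OF this, of S] assms(3)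
  have "openin (subtopology (Euclidean_space n) V) {x \<in> Espace n \<inter> V. f x \<in> S}" by simp
  moreover have "{x \<in> Espace n \<inter> V. f x \<in> S} = {x \<in> V. f x \<in> S}"
    using openin_subset[OF assms(1)] by blast
  ultimately show ?thesis using openin_open_subtopology[OF assms(1)] by simp
qed

text \<open>The increment of \<open>g\<close> is telescoped by moving one coordinate at a time, and the mean value
  theorem is applied to each step.\<close>

lemma has_real_derivative_along_curve:
  fixes \<gamma> :: "real \<Rightarrow> nat \<Rightarrow> real"
  assumes W: "openin (Euclidean_space m) W" and g: "Ck_on m 1 W g"
    and \<gamma>W: "\<gamma> t0 \<in> W" and \<gamma>E: "\<forall>\<^sub>F s in nhds t0. \<gamma> s \<in> Espace m"
    and der: "\<And>j. j < m \<Longrightarrow> ((\<lambda>s. \<gamma> s j) has_real_derivative c j) (at t0)"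
  shows "((\<lambda>s. g (\<gamma> s)) has_real_derivative (\<Sum>j<m. partial_deriv j g (\<gamma> t0) * c j)) (at t0)"
proof -
  \<comment> \<open>\<open>Z j s\<close> has exchanged the first \<open>j\<close> coordinates of
    \<open>\<gamma> t0\<close> for those of \<open>\<gamma> s\<close>; for \<open>s\<close> near
    \<open>t0\<close> it leads from \<open>\<gamma> t0\<close> at \<open>j = 0\<close> to
    \<open>\<gamma> s\<close> at \<open>j = m\<close>.\<close>
  define Z where "Z j s = (\<lambda>i. if i < j then \<gamma> s i else \<gamma> t0 i)" for j :: nat and s
  define D where "D j = partial_deriv j g (\<gamma> t0)" for j
  \<comment> \<open>The slope of \<open>g\<close> in step \<open>j\<close>. Where that coordinate
    does not move, the expected limit \<open>D j\<close> is used as default, so that the increment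
    of \<open>g\<close> is always \<open>q j s\<close> times the increment of the
    coordinate.\<close>
  define q where "q j s = (if \<gamma> s j = \<gamma> t0 j then D j
      else (g (Z (Suc j) s) - g (Z j s)) / (\<gamma> s j - \<gamma> t0 j))" for j s
  have E0: "\<gamma> t0 \<in> Espace m" using W \<gamma>W openin_subset by blast
  have near: "\<forall>\<^sub>F s in at t0. \<forall>i<m. \<bar>\<gamma> s i - \<gamma> t0 i\<bar> < d" if "d > 0" for d
  proof -
    have "\<forall>\<^sub>F s in at t0. \<bar>\<gamma> s i - \<gamma> t0 i\<bar> < d" if "i < m" for i
    proof -
      have "isCont (\<lambda>s. \<gamma> s i) t0" using der[OF that] DERIV_isCont by blast
      then show ?thesis using \<open>d > 0\<close>
        by (auto simp: isCont_def tendsto_iff dist_real_def)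
    qed
    then have "\<forall>\<^sub>F s in at t0. \<forall>i\<in>{..<m}. \<bar>\<gamma> s i - \<gamma> t0 i\<bar> < d"
      by (intro eventually_ball_finite) auto
    then show ?thesis by (simp add: Ball_def)
  qed
  have evE: "\<forall>\<^sub>F s in at t0. \<gamma> s \<in> Espace m"
    using \<gamma>E eventually_nhds_conv_at by blast
  have q_lim: "((\<lambda>s. q j s) \<longlongrightarrow> D j) (at t0)" if j: "j < m" for j
  proof (rule tendstoI)
    fix e :: real assume "e > 0"
    let ?W = "{z \<in> W. partial_deriv j g z \<in> ball (D j) e}"
    have "Ck_on m 0 W (partial_deriv j g)" using Ck_on_SucD(2)[of m 0 W g j] g j by simp
    then have "openin (Euclidean_space m) ?W"
      by (intro openin_Ck_on_preimage[OF W]) (auto simp: continuous_map_Euclidean_sub_iff)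
    moreover have "\<gamma> t0 \<in> ?W" using \<open>e > 0\<close> \<gamma>W by (simp add: D_def)
    ultimately obtain d where d: "d > 0"
        "\<And>z. z \<in> Espace m \<Longrightarrow> (\<And>i. i < m \<Longrightarrow> \<bar>z i - \<gamma> t0 i\<bar> < d) \<Longrightarrow> z \<in> ?W"
      using openin_Euclidean_box by blast
    show "\<forall>\<^sub>F s in at t0. dist (q j s) (D j) < e"
      using near[OF d(1)] evE
    proof eventually_elim
      case (elim s)
      show ?case
      proof (cases "\<gamma> s j = \<gamma> t0 j")
        case True then show ?thesis using \<open>e > 0\<close> by (simp add: q_def)
      next
        case False
        \<comment> \<open>The whole segment of step \<open>j\<close> lies in the box on which the
          \<open>j\<close>-th partial derivative is within \<open>e\<close> of \<open>D j\<close>.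
          This covers the unknown point \<xi> supplied by the mean value theorem.\<close>
        have box: "(Z j s)(j := t) \<in> ?W" if "\<bar>t - \<gamma> t0 j\<bar> \<le> \<bar>\<gamma> s j - \<gamma> t0 j\<bar>" for t
        proof (rule d(2))
          show "(Z j s)(j := t) \<in> Espace m"
            using E0 elim(2) j by (auto simp: Z_def in_Espace)
          fix i assume "i < m"
          then show "\<bar>((Z j s)(j := t)) i - \<gamma> t0 i\<bar> < d"
            using elim(1) that d(1) by (auto simp: Z_def intro: le_less_trans)
        qed
        have "((\<lambda>t. g ((Z j s)(j := t))) has_real_derivative partial_deriv j g ((Z j s)(j := t))) (at t)"
          if "\<bar>t - \<gamma> t0 j\<bar> \<le> \<bar>\<gamma> s j - \<gamma> t0 j\<bar>" for t
        proof -
          have "(Z j s)(j := t) \<in> W" using box[OF that] by blast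
          from Ck_on_SucD(1)[of m 0 W g j, OF _ j this] g
          have "(\<lambda>\<tau>. g ((Z j s)(j := \<tau>))) field_differentiable at t" by simp
          then show ?thesis unfolding partial_deriv_def
            by (simp add: field_differentiable_derivI)
        qed
        then obtain \<xi> where \<xi>: "\<bar>\<xi> - \<gamma> t0 j\<bar> \<le> \<bar>\<gamma> s j - \<gamma> t0 j\<bar>"
          "g ((Z j s)(j := \<gamma> s j)) - g ((Z j s)(j := \<gamma> t0 j))
             = partial_deriv j g ((Z j s)(j := \<xi>)) * (\<gamma> s j - \<gamma> t0 j)"
          by (rule mean_value_between)
        have "(Z j s)(j := \<gamma> s j) = Z (Suc j) s" "(Z j s)(j := \<gamma> t0 j) = Z j s"
          by (auto simp: Z_def fun_eq_iff)
        then have "q j s = partial_deriv j g ((Z j s)(j := \<xi>))"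
          using \<xi>(2) False by (simp add: q_def)
        then show ?thesis using box[OF \<xi>(1)] by (simp add: dist_commute)
      qed
    qed
  qed
  have "((\<lambda>s. \<Sum>j<m. q j s * ((\<gamma> s j - \<gamma> t0 j) / (s - t0))) \<longlongrightarrow> (\<Sum>j<m. D j * c j)) (at t0)"
    using der by (intro tendsto_sum tendsto_mult q_lim) (auto simp: has_field_derivative_iff)
  moreover have "\<forall>\<^sub>F s in at t0. (\<Sum>j<m. q j s * ((\<gamma> s j - \<gamma> t0 j) / (s - t0)))
      = (g (\<gamma> s) - g (\<gamma> t0)) / (s - t0)"
    using evE
  proof eventually_elim
    case (elim s)
    \<comment> \<open>From coordinate \<open>m\<close> on both points vanish, so exchanging the
      first \<open>m\<close> coordinates exchanges all of them.\<close>
    have "Z m s = \<gamma> s" "Z 0 s = \<gamma> t0"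
      using elim E0 by (auto simp: Z_def in_Espace fun_eq_iff)
    then have "g (\<gamma> s) - g (\<gamma> t0) = (\<Sum>j<m. g (Z (Suc j) s) - g (Z j s))"
      using sum_lessThan_telescope[of "\<lambda>j. g (Z j s)" m] by simp
    also have "\<dots> = (\<Sum>j<m. q j s * (\<gamma> s j - \<gamma> t0 j))"
    proof (intro sum.cong refl)
      fix j
      have "Z (Suc j) s = Z j s" if "\<gamma> s j = \<gamma> t0 j"
        using that by (auto simp: Z_def fun_eq_iff less_Suc_eq)
      then show "g (Z (Suc j) s) - g (Z j s) = q j s * (\<gamma> s j - \<gamma> t0 j)"
        by (simp add: q_def)
    qed
    finally show ?case by (simp add: sum_divide_distrib)
  qed
  ultimately show ?thesis
    unfolding has_field_derivative_iff D_def by (rule Lim_transform_eventually)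
qed

lemma continuous_on_into_Euclidean:
  fixes u :: "'a::topological_space \<Rightarrow> nat \<Rightarrow> real"
  assumes "\<And>x. x \<in> S \<Longrightarrow> u x \<in> Espace m" "\<And>j. j < m \<Longrightarrow> continuous_on S (\<lambda>x. u x j)"
  shows "continuous_on S u"
proof (rule continuous_on_coordinatewise_then_product)
  fix j show "continuous_on S (\<lambda>x. u x j)"
  proof (cases "j < m")
    case False
    then have "u x j = 0" if "x \<in> S" for x using assms(1)[OF that] by (simp add: in_Espace)
    then show ?thesis using continuous_on_cong[of S S "\<lambda>x. u x j" "\<lambda>_. 0"] by simp
  qed (use assms(2) in simp)
qed

text \<open>Induction on \<open>r\<close> for all outer functions \<open>H\<close>, with
  \<open>u\<close> fixed. By the chain rule a partial derivative of the composite is a sum of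
  products of \<open>partial_deriv j H\<close> after \<open>u\<close>, covered by the induction
  hypothesis, and partial derivatives of the coordinates of \<open>u\<close>.\<close>

lemma Ck_on_compose:
  assumes V: "openin (Euclidean_space n) V" and W: "openin (Euclidean_space m) W"
    and uVW: "\<And>x. x \<in> V \<Longrightarrow> u x \<in> W"
    and "\<And>j. j < m \<Longrightarrow> Ck_on n r V (\<lambda>x. u x j)" "Ck_on m r W H"
  shows "Ck_on n r V (\<lambda>x. H (u x))"
  using assms(4,5)
proof (induction r arbitrary: H)
  have WE: "W \<subseteq> Espace m" using W openin_subset by blast
  have cont: "continuous_on (Espace n \<inter> V) (\<lambda>x. H (u x))"
    if u: "\<And>j. j < m \<Longrightarrow> Ck_on n r V (\<lambda>x. u x j)" and H: "Ck_on m r W H" for r H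
  proof (rule continuous_on_compose2[OF Ck_on_imp_continuous_on[OF H]])
    show "continuous_on (Espace n \<inter> V) u"
      using uVW WE by (intro continuous_on_into_Euclidean[of _ _ m] Ck_on_imp_continuous_on[OF u]) auto
  qed (use uVW WE in auto)
  {
    case (0 H)
    then show ?case using cont[OF 0] by (simp add: continuous_map_Euclidean_sub_iff)
  next
    case (Suc r H)
    have u: "Ck_on n r V (\<lambda>x. u x j)" if "j < m" for j
      using Ck_on_Suc_imp[OF Suc.prems(1)[OF that]] .
    have H: "Ck_on m (Suc 0) W H"
      using Suc.prems(2) by (induction r) (use Ck_on_Suc_imp in blast)+
    have der: "((\<lambda>t. H (u (x(i := t)))) has_real_derivative
        (\<Sum>j<m. partial_deriv j H (u x) * partial_deriv i (\<lambda>x. u x j) x)) (at (x i))"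
      if "i < n" "x \<in> V" for i x
    proof -
      have "((\<lambda>t. H (u (x(i := t)))) has_real_derivative
        (\<Sum>j<m. partial_deriv j H (u (x(i := x i))) * partial_deriv i (\<lambda>x. u x j) x)) (at (x i))"
      proof (rule has_real_derivative_along_curve[OF W])
        show "Ck_on m 1 W H" using H by simp
        show "u (x(i := x i)) \<in> W" using uVW that by simp
        show "\<forall>\<^sub>F s in nhds (x i). u (x(i := s)) \<in> Espace m"
          by (rule eventually_mono[OF openin_Euclidean_line[OF V that(2,1)]]) (use uVW WE in blast)
        fix j assume "j < m"
        show "((\<lambda>s. u (x(i := s)) j) has_real_derivative partial_deriv i (\<lambda>x. u x j) x) (at (x i))"
          unfolding partial_deriv_def
          by (intro field_differentiable_derivI Ck_on_SucD(1)[OF Suc.prems(1)[OF \<open>j < m\<close>] that])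
      qed
      then show ?thesis by simp
    qed
    have "Ck_on n r V (partial_deriv i (\<lambda>x. H (u x)))" if "i < n" for i
    proof (rule Ck_on_cong[OF V])
      show "Ck_on n r V (\<lambda>x. \<Sum>j<m. partial_deriv j H (u x) * partial_deriv i (\<lambda>x. u x j) x)"
      proof (intro Ck_on_sum[OF V] Ck_on_mult[OF V])
        fix j assume "j < m"
        show "Ck_on n r V (\<lambda>x. partial_deriv j H (u x))"
          by (rule Suc.IH[OF u Ck_on_SucD(2)[OF Suc.prems(2) \<open>j < m\<close>]])
        show "Ck_on n r V (partial_deriv i (\<lambda>x. u x j))"
          by (rule Ck_on_SucD(2)[OF Suc.prems(1)[OF \<open>j < m\<close>] that])
      qed
      show "(\<Sum>j<m. partial_deriv j H (u x) * partial_deriv i (\<lambda>x. u x j) x) = partial_deriv i (\<lambda>x. H (u x)) x"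
        if "x \<in> V" for x
        using DERIV_imp_deriv[OF der[OF \<open>i < n\<close> that]] by (simp add: partial_deriv_def)
    qed
    moreover have "(\<lambda>t. H (u (x(i := t)))) field_differentiable at (x i)" if "i < n" "x \<in> V" for i x
      using der[OF that] field_differentiable_def by blast
    ultimately show ?case
      using cont[OF Suc.prems] unfolding Ck_on.simps continuous_map_Euclidean_sub_iff by blast
  }
qed

text \<open>The neighbourhood is chosen before the order: one \<open>V\<close> serves every
  \<open>r\<close>, as in \<open>smooth_between\<close>, where the set is fixed.\<close>

definition smooth_fun_at :: "nat \<Rightarrow> ((nat \<Rightarrow> real) \<Rightarrow> real) \<Rightarrow> (nat \<Rightarrow> real) \<Rightarrow> bool" where
  "smooth_fun_at n h y \<longleftrightarrow> (\<exists>V. openin (Euclidean_space n) V \<and> y \<in> V \<and> (\<forall>r. Ck_on n r V h))"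

lemma Ck_on_all_imp_smooth_fun_at:
  "openin (Euclidean_space n) V \<Longrightarrow> \<forall>r. Ck_on n r V h \<Longrightarrow> y \<in> V \<Longrightarrow> smooth_fun_at n h y"
  unfolding smooth_fun_at_def by blast

lemma smooth_fun_at_imp_Ck_on:
  "V \<subseteq> Espace n \<Longrightarrow> (\<And>y. y \<in> V \<Longrightarrow> smooth_fun_at n h y) \<Longrightarrow> Ck_on n r V h"
  unfolding smooth_fun_at_def by (rule Ck_on_local) meson+

lemma smooth_fun_at_cong:
  assumes "smooth_fun_at n h y" "openin (Euclidean_space n) V" "y \<in> V" "\<And>z. z \<in> V \<Longrightarrow> h z = h' z"
  shows "smooth_fun_at n h' y"
proof -
  obtain U where U: "openin (Euclidean_space n) U" "y \<in> U" "\<And>r. Ck_on n r U h"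
    using assms(1) by (auto simp: smooth_fun_at_def)
  have "Ck_on n r (U \<inter> V) h'" for r
    using Ck_on_cong[OF openin_Int[OF U(1) assms(2)], of h h' r] Ck_on_subset[OF U(3), of "U \<inter> V"] assms(4)
    by auto
  then show ?thesis using openin_Int[OF U(1) assms(2)] U(2) assms(3) unfolding smooth_fun_at_def by blast
qed

lemma smooth_fun_at_coordinate: "y \<in> Espace n \<Longrightarrow> smooth_fun_at n (\<lambda>z. z j) y"
  unfolding smooth_fun_at_def using Ck_on_coordinate by blast

text \<open>The neighbourhoods belonging to the \<open>m\<close> coordinates of \<open>u\<close> are
  intersected and then shrunk once more, so that \<open>u\<close> maps into a neighbourhood of
  \<open>u y\<close> on which \<open>H\<close> is smooth. There \<open>Ck_on_compose\<close>
  applies.\<close>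

lemma smooth_fun_at_compose:
  assumes V: "openin (Euclidean_space n) V" "y \<in> V" "\<And>z. z \<in> V \<Longrightarrow> u z \<in> Espace m"
    and u: "\<And>j. j < m \<Longrightarrow> smooth_fun_at n (\<lambda>z. u z j) y" and H: "smooth_fun_at m H (u y)"
  shows "smooth_fun_at n (\<lambda>z. H (u z)) y"
proof -
  obtain W where W: "openin (Euclidean_space m) W" "u y \<in> W" "\<And>r. Ck_on m r W H"
    using H by (auto simp: smooth_fun_at_def)
  obtain U where U: "\<And>j. j < m \<Longrightarrow> openin (Euclidean_space n) (U j) \<and> y \<in> U j \<and> (\<forall>r. Ck_on n r (U j) (\<lambda>z. u z j))"
    using u unfolding smooth_fun_at_def by metis
  define V' where "V' = V \<inter> {z. \<forall>j<m. z \<in> U j}"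
  \<comment> \<open>For \<open>m = 0\<close> the intersection of the family is \<open>UNIV\<close>,
    which is not a subset of \<open>Espace n\<close>; this case has to be split off.\<close>
  have "V' = (if m = 0 then V else V \<inter> (\<Inter>j\<in>{..<m}. U j))" unfolding V'_def by auto
  moreover have "openin (Euclidean_space n) (\<Inter>j\<in>{..<m}. U j)" if "m \<noteq> 0"
    by (rule openin_INT2) (use U that in auto)
  ultimately have oV': "openin (Euclidean_space n) V'" using V(1) by (simp add: openin_Int)
  have yV': "y \<in> V'" and V'V: "V' \<subseteq> V" using V(2) U unfolding V'_def by blast+
  have u': "Ck_on n r V' (\<lambda>z. u z j)" if "j < m" for j r
  proof (rule Ck_on_subset)
    show "Ck_on n r (U j) (\<lambda>z. u z j)" using U[OF that] by blast
    show "V' \<subseteq> U j" using that unfolding V'_def by blast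
  qed
  have "continuous_on (Espace n \<inter> V') u"
  proof (rule continuous_on_into_Euclidean[of _ _ m])
    show "continuous_on (Espace n \<inter> V') (\<lambda>z. u z j)" if "j < m" for j
      using Ck_on_imp_continuous_on[OF u'[OF that, of 0]] .
  qed (use V(3) V'V in blast)
  obtain T where T: "open T" "W = Espace m \<inter> T" using W(1) openin_Euclidean_iff by blast
  define V'' where "V'' = {z \<in> V'. u z \<in> W}"
  have "openin (subtopology (Euclidean_space n) V') (Espace n \<inter> V' \<inter> u -` T)"
    using continuous_openin_preimage_gen[OF \<open>continuous_on (Espace n \<inter> V') u\<close> T(1)]
    by (subst Euclidean_space_eq_top_of_set) (simp add: subtopology_subtopology)
  moreover have "Espace n \<inter> V' \<inter> u -` T = V''"
    using openin_subset[OF oV'] V(3) V'V T(2) unfolding V''_def by blast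
  ultimately have "openin (Euclidean_space n) V''"
    using openin_open_subtopology[OF oV'] by simp
  moreover have "y \<in> V''" using yV' W(2) by (simp add: V''_def)
  moreover have "Ck_on n r V'' (\<lambda>z. H (u z))" for r
  proof (rule Ck_on_compose[OF \<open>openin _ V''\<close> W(1) _ _ W(3)])
    show "Ck_on n r V'' (\<lambda>z. u z j)" if "j < m" for j
      by (rule Ck_on_subset[OF u'[OF that]]) (auto simp: V''_def)
  qed (simp add: V''_def)
  ultimately show ?thesis unfolding smooth_fun_at_def by meson
qed

section \<open>Smooth maps between manifolds\<close>

lemma continuous_map_Euclidean_iff:
  "continuous_map X (Euclidean_space n) f \<longleftrightarrow>
     (\<forall>x\<in>topspace X. f x \<in> Espace n) \<and> (\<forall>i<n. continuous_map X euclideanreal (\<lambda>x. f x i))"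
proof (cases "\<forall>x\<in>topspace X. f x \<in> Espace n")
  case True
  \<comment> \<open>Truncation gives \<open>f\<close> the syntactic shape for which continuity into
    \<open>Euclidean_space n\<close> is known coordinatewise.\<close>
  define g where "g = (\<lambda>x i. if i < n then f x i else 0)"
  have eq: "f x = g x" if "x \<in> topspace X" for x
    using True that by (auto simp: in_Espace fun_eq_iff g_def)
  have "continuous_map X (Euclidean_space n) f \<longleftrightarrow> continuous_map X (Euclidean_space n) g"
    by (intro iffI; erule continuous_map_eq) (simp_all add: eq)
  then show ?thesis
    using True unfolding g_def continuous_map_componentwise_Euclidean_space by simp
next
  case False
  then show ?thesis by (auto simp: continuous_map_def)
qed

lemma continuous_map_Euclidean_coordinate:
  "continuous_map (Euclidean_space n) euclideanreal (\<lambda>z. z i)"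
  using continuous_map_Euclidean_sub_iff[of n UNIV] continuous_on_subset[OF continuous_on_product_coordinates]
  by (simp add: subtopology_UNIV)

text \<open>The coordinate form of a projection: product and power charts concatenate coordinates,
  so passing to a factor reads \<open>n\<close> consecutive coordinates from offset
  \<open>b\<close>. The zero padding makes the result a point of
  \<open>Euclidean_space n\<close>.\<close>

definition block :: "nat \<Rightarrow> nat \<Rightarrow> (nat \<Rightarrow> real) \<Rightarrow> (nat \<Rightarrow> real)" where
  "block b n z = (\<lambda>i. if i < n then z (b + i) else 0)"

lemma block_in_Espace: "block b n z \<in> Espace n"
  by (simp add: block_def in_Espace)

lemma continuous_map_block: "continuous_map (Euclidean_space N) (Euclidean_space n) (block b n)"
  unfolding continuous_map_Euclidean_iff
  by (auto simp: block_in_Espace) (simp add: block_def continuous_map_Euclidean_coordinate)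

text \<open>For charts with an explicit inverse \<open>\<psi>\<close> on an explicitly described
  open set \<open>S\<close>. The image of \<open>U\<close>, on which \<open>chart_on\<close>
  depends, is then identified with \<open>S\<close>.\<close>

lemma chart_onI:
  assumes "openin T U" "openin (Euclidean_space n) S"
    "continuous_map (subtopology T U) (Euclidean_space n) \<phi>"
    "continuous_map (subtopology (Euclidean_space n) S) T \<psi>"
    "\<And>x. x \<in> U \<Longrightarrow> \<phi> x \<in> S \<and> \<psi> (\<phi> x) = x" "\<And>z. z \<in> S \<Longrightarrow> \<psi> z \<in> U \<and> \<phi> (\<psi> z) = z"
  shows "chart_on T n (U, \<phi>)"
proof -
  have "\<phi> ` U = S" using assms(5,6) by force
  moreover have "homeomorphic_maps (subtopology T U) (subtopology (Euclidean_space n) S) \<phi> \<psi>"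
    unfolding homeomorphic_maps_def continuous_map_in_subtopology using assms by auto
  ultimately show ?thesis
    unfolding chart_on_def homeomorphic_map_maps using assms(1,2) by auto
qed

section \<open>Charts as homeomorphisms onto open sets\<close>

context
  fixes T n U \<phi>
  assumes chart: "chart_on T n (U, \<phi>)"
begin

lemma chart_on_open: "openin T U" "openin (Euclidean_space n) (\<phi> ` U)"
  using chart by (auto simp: chart_on_def)

lemma chart_on_homeo: "homeomorphic_map (subtopology T U) (subtopology (Euclidean_space n) (\<phi> ` U)) \<phi>"
  using chart by (auto simp: chart_on_def)

lemma chart_on_topspace: "topspace (subtopology T U) = U"
  using openin_subset[OF chart_on_open(1)] by auto

lemma chart_on_inj: "inj_on \<phi> U"
  using homeomorphic_imp_injective_map[OF chart_on_homeo] chart_on_topspace by simp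

lemma chart_on_Espace: "x \<in> U \<Longrightarrow> \<phi> x \<in> Espace n"
  using openin_subset[OF chart_on_open(2)] by blast

lemma chart_on_continuous: "continuous_map (subtopology T U) (Euclidean_space n) \<phi>"
  using homeomorphic_imp_continuous_map[OF chart_on_homeo] continuous_map_into_fulltopology by blast

lemma chart_on_image_open:
  assumes "openin T S" "S \<subseteq> U"
  shows "openin (Euclidean_space n) (\<phi> ` S)"
proof -
  have "openin (subtopology T U) S" using assms openin_subtopology_alt by blast
  then have "openin (subtopology (Euclidean_space n) (\<phi> ` U)) (\<phi> ` S)"
    using homeomorphic_map_openness_eq[OF chart_on_homeo] by blast
  then show ?thesis using chart_on_open(2) openin_trans_full by blast
qed

lemma chart_on_inverse_continuous:
  "continuous_map (subtopology (Euclidean_space n) (\<phi> ` U)) T (inv_into U \<phi>)"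
proof -
  obtain g where g: "homeomorphic_maps (subtopology T U) (subtopology (Euclidean_space n) (\<phi> ` U)) \<phi> g"
    using chart_on_homeo unfolding homeomorphic_map_maps by blast
  then have "continuous_map (subtopology (Euclidean_space n) (\<phi> ` U)) T g"
    unfolding homeomorphic_maps_def continuous_map_in_subtopology by blast
  moreover have "g z = inv_into U \<phi> z" if "z \<in> topspace (subtopology (Euclidean_space n) (\<phi> ` U))" for z
  proof -
    from that obtain x where "x \<in> U" "z = \<phi> x" by auto
    then show ?thesis using g chart_on_topspace chart_on_inj unfolding homeomorphic_maps_def by simp
  qed
  ultimately show ?thesis by (rule continuous_map_eq)
qed

end

text \<open>Smoothness of maps only refers to the charts, so the remaining conditions of
  \<^const>\<open>smooth_manifold\<close> need not be checked for products and powers.\<close>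

definition charted :: "'a manifold \<Rightarrow> bool" where
  "charted X \<longleftrightarrow> (\<forall>c\<in>matlas X. chart_on (mtop X) (mdim X) c) \<and> (\<Union>c\<in>matlas X. fst c) = pts X"

lemma smooth_manifold_imp_charted: "smooth_manifold X \<Longrightarrow> charted X"
  by (simp add: smooth_manifold_def charted_def)

lemma charted_chart_on: "charted X \<Longrightarrow> (U, \<phi>) \<in> matlas X \<Longrightarrow> chart_on (mtop X) (mdim X) (U, \<phi>)"
  by (auto simp: charted_def)

lemma charted_obtain:
  assumes "charted X" "x \<in> pts X"
  obtains U \<phi> where "(U, \<phi>) \<in> matlas X" "x \<in> U"
proof -
  from assms obtain c where "c \<in> matlas X" "x \<in> fst c" unfolding charted_def by blast
  with that[of "fst c" "snd c"] show ?thesis by simp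
qed

text \<open>All charts around \<open>x\<close> are tested, matching the quantification over pairs of
  charts in \<open>smooth_map\<close>. This keeps the notion usable on a manifold that is only known
  to be \<open>charted\<close>.\<close>

definition smooth_real_at :: "'a manifold \<Rightarrow> ('a \<Rightarrow> real) \<Rightarrow> 'a \<Rightarrow> bool" where
  "smooth_real_at X h x \<longleftrightarrow>
     (\<forall>(U, \<phi>)\<in>matlas X. x \<in> U \<longrightarrow> smooth_fun_at (mdim X) (\<lambda>z. h (inv_into U \<phi> z)) (\<phi> x))"

lemma smooth_real_atD:
  "smooth_real_at X h x \<Longrightarrow> (U, \<phi>) \<in> matlas X \<Longrightarrow> x \<in> U \<Longrightarrow>
     smooth_fun_at (mdim X) (\<lambda>z. h (inv_into U \<phi> z)) (\<phi> x)"
  by (auto simp: smooth_real_at_def)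

lemma smooth_real_atI:
  "(\<And>U \<phi>. (U, \<phi>) \<in> matlas X \<Longrightarrow> x \<in> U \<Longrightarrow> smooth_fun_at (mdim X) (\<lambda>z. h (inv_into U \<phi> z)) (\<phi> x)) \<Longrightarrow>
   smooth_real_at X h x"
  by (auto simp: smooth_real_at_def)

lemma smooth_real_at_cong:
  assumes X: "charted X" and h: "smooth_real_at X h x"
    and S: "openin (mtop X) S" "x \<in> S" "\<And>y. y \<in> S \<Longrightarrow> h y = h' y"
  shows "smooth_real_at X h' x"
proof (rule smooth_real_atI)
  fix U \<phi> assume c: "(U, \<phi>) \<in> matlas X" "x \<in> U"
  note chart = charted_chart_on[OF X c(1)]
  show "smooth_fun_at (mdim X) (\<lambda>z. h' (inv_into U \<phi> z)) (\<phi> x)"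
  proof (rule smooth_fun_at_cong[OF smooth_real_atD[OF h c]])
    show "openin (Euclidean_space (mdim X)) (\<phi> ` (U \<inter> S))"
      using chart_on_open[OF chart] S(1) by (intro chart_on_image_open[OF chart]) auto
    show "\<phi> x \<in> \<phi> ` (U \<inter> S)" using c S by blast
    fix z assume "z \<in> \<phi> ` (U \<inter> S)"
    then obtain y where y: "y \<in> U" "y \<in> S" "z = \<phi> y" by blast
    then show "h (inv_into U \<phi> z) = h' (inv_into U \<phi> z)"
      using S(3) chart_on_inj[OF chart] by simp
  qed
qed

lemma smooth_real_at_compose:
  assumes X: "charted X" and S: "openin (mtop X) S" "x \<in> S" "\<And>y. y \<in> S \<Longrightarrow> u y \<in> Espace m"
    and u: "\<And>j. j < m \<Longrightarrow> smooth_real_at X (\<lambda>y. u y j) x" and H: "smooth_fun_at m H (u x)"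
  shows "smooth_real_at X (\<lambda>y. H (u y)) x"
proof (rule smooth_real_atI)
  fix U \<phi> assume c: "(U, \<phi>) \<in> matlas X" "x \<in> U"
  note chart = charted_chart_on[OF X c(1)]
  show "smooth_fun_at (mdim X) (\<lambda>z. H (u (inv_into U \<phi> z))) (\<phi> x)"
  proof (rule smooth_fun_at_compose[where u = "\<lambda>z. u (inv_into U \<phi> z)" and m = m])
    show "openin (Euclidean_space (mdim X)) (\<phi> ` (U \<inter> S))"
      using chart_on_open[OF chart] S(1) by (intro chart_on_image_open[OF chart]) auto
    show "\<phi> x \<in> \<phi> ` (U \<inter> S)" using c S by blast
    show "smooth_fun_at (mdim X) (\<lambda>z. u (inv_into U \<phi> z) j) (\<phi> x)" if "j < m" for j
      using smooth_real_atD[OF u[OF that] c] .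
    show "smooth_fun_at m H (u (inv_into U \<phi> (\<phi> x)))"
      using H c(2) chart_on_inj[OF chart] by simp
    fix z assume "z \<in> \<phi> ` (U \<inter> S)"
    then obtain y where y: "y \<in> U" "y \<in> S" "z = \<phi> y" by blast
    then show "u (inv_into U \<phi> z) \<in> Espace m"
      using S(3) chart_on_inj[OF chart] by simp
  qed
qed

text \<open>The second clause is continuity at \<open>x\<close>. It keeps \<open>f\<close> inside
  the chart domain \<open>W\<close> near \<open>x\<close>, so that the coordinate expressions of the
  third clause are meaningful on a neighbourhood.\<close>

definition smooth_at :: "'a manifold \<Rightarrow> 'b manifold \<Rightarrow> ('a \<Rightarrow> 'b) \<Rightarrow> 'a \<Rightarrow> bool" where
  "smooth_at X Y f x \<longleftrightarrow> f x \<in> pts Y \<and>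
     (\<forall>V. openin (mtop Y) V \<and> f x \<in> V \<longrightarrow> (\<exists>S. openin (mtop X) S \<and> x \<in> S \<and> f ` S \<subseteq> V)) \<and>
     (\<forall>(W, \<psi>)\<in>matlas Y. f x \<in> W \<longrightarrow> (\<forall>j<mdim Y. smooth_real_at X (\<lambda>y. \<psi> (f y) j) x))"

lemma smooth_atD:
  assumes "smooth_at X Y f x"
  shows "f x \<in> pts Y"
    and "openin (mtop Y) V \<Longrightarrow> f x \<in> V \<Longrightarrow> \<exists>S. openin (mtop X) S \<and> x \<in> S \<and> f ` S \<subseteq> V"
    and "(W, \<psi>) \<in> matlas Y \<Longrightarrow> f x \<in> W \<Longrightarrow> j < mdim Y \<Longrightarrow> smooth_real_at X (\<lambda>y. \<psi> (f y) j) x"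
  using assms by (auto simp: smooth_at_def)

text \<open>Continuity of \<open>f\<close> makes the set of points of \<open>U\<close> that
  \<open>f\<close> sends into \<open>W\<close>, and hence its chart image, open. On an open set,
  being of class C^r for all \<open>r\<close> is the same as being smooth at each point.\<close>

lemma smooth_map_iff:
  assumes X: "charted X" and Y: "charted Y"
  shows "smooth_map X Y f \<longleftrightarrow> continuous_map (mtop X) (mtop Y) f \<and>
    (\<forall>x\<in>pts X. \<forall>(W, \<psi>)\<in>matlas Y. f x \<in> W \<longrightarrow> (\<forall>j<mdim Y. smooth_real_at X (\<lambda>y. \<psi> (f y) j) x))"
    (is "_ \<longleftrightarrow> _ \<and> ?R")
proof (intro iffI conjI)
  assume f: "smooth_map X Y f"
  then show cont: "continuous_map (mtop X) (mtop Y) f" by (simp add: smooth_map_def)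
  have "smooth_real_at X (\<lambda>y. \<psi> (f y) j) x"
    if d: "(W, \<psi>) \<in> matlas Y" "f x \<in> W" and j: "j < mdim Y" for x W \<psi> j
  proof (rule smooth_real_atI)
    fix U \<phi> assume c: "(U, \<phi>) \<in> matlas X" "x \<in> U"
    note chart = charted_chart_on[OF X c(1)]
    have W: "openin (mtop Y) W" by (rule chart_on_open[OF charted_chart_on[OF Y d(1)]])
    have U: "openin (mtop X) U" by (rule chart_on_open[OF chart])
    have "{x \<in> U. f x \<in> W} = U \<inter> {x \<in> topspace (mtop X). f x \<in> W}"
      using openin_subset[OF U] by blast
    then have "openin (mtop X) {x \<in> U. f x \<in> W}"
      using openin_Int[OF U openin_continuous_map_preimage[OF cont W]] by metis
    then have op: "openin (Euclidean_space (mdim X)) (\<phi> ` {x \<in> U. f x \<in> W})"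
      by (intro chart_on_image_open[OF chart]) auto
    have "smooth_between (mdim X) (mdim Y) (\<phi> ` {x \<in> U. f x \<in> W}) (\<psi> \<circ> f \<circ> inv_into U \<phi>)"
      using f c d unfolding smooth_map_def by fast
    then have "\<forall>r. Ck_on (mdim X) r (\<phi> ` {x \<in> U. f x \<in> W}) (\<lambda>z. \<psi> (f (inv_into U \<phi> z)) j)"
      using j by (simp add: smooth_between_def)
    then show "smooth_fun_at (mdim X) (\<lambda>z. \<psi> (f (inv_into U \<phi> z)) j) (\<phi> x)"
      by (rule Ck_on_all_imp_smooth_fun_at[OF op]) (use c d in blast)
  qed
  then show ?R by blast
next
  assume R: "continuous_map (mtop X) (mtop Y) f \<and> ?R"
  have "smooth_between (mdim X) (mdim Y) (\<phi> ` {x \<in> U. f x \<in> W}) (\<psi> \<circ> f \<circ> inv_into U \<phi>)"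
    if c: "(U, \<phi>) \<in> matlas X" and d: "(W, \<psi>) \<in> matlas Y" for U \<phi> W \<psi>
    unfolding smooth_between_def
  proof (intro allI impI)
    fix j r assume j: "j < mdim Y"
    note chart = charted_chart_on[OF X c]
    have "Ck_on (mdim X) r (\<phi> ` {x \<in> U. f x \<in> W}) (\<lambda>z. \<psi> (f (inv_into U \<phi> z)) j)"
    proof (rule smooth_fun_at_imp_Ck_on)
      show "\<phi> ` {x \<in> U. f x \<in> W} \<subseteq> Espace (mdim X)" using chart_on_Espace[OF chart] by blast
      fix z assume "z \<in> \<phi> ` {x \<in> U. f x \<in> W}"
      then obtain x where x: "x \<in> U" "f x \<in> W" "z = \<phi> x" by blast
      then have "x \<in> pts X" using openin_subset[OF chart_on_open(1)[OF chart]] by (auto simp: pts_def)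
      then have "smooth_real_at X (\<lambda>y. \<psi> (f y) j) x" using R d x j by fast
      from smooth_real_atD[OF this c x(1)] x(3)
      show "smooth_fun_at (mdim X) (\<lambda>z. \<psi> (f (inv_into U \<phi> z)) j) z" by simp
    qed
    then show "Ck_on (mdim X) r (\<phi> ` {x \<in> U. f x \<in> W}) (\<lambda>x. (\<psi> \<circ> f \<circ> inv_into U \<phi>) x j)"
      by (simp add: comp_def)
  qed
  then show "smooth_map X Y f" using R unfolding smooth_map_def by fast
qed

lemma smooth_map_iff_smooth_at:
  assumes X: "charted X" and Y: "charted Y"
  shows "smooth_map X Y f \<longleftrightarrow> (\<forall>x\<in>pts X. smooth_at X Y f x)"
proof -
  have "continuous_map (mtop X) (mtop Y) f \<longleftrightarrow> (\<forall>x\<in>pts X. f x \<in> pts Y \<and>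
     (\<forall>V. openin (mtop Y) V \<and> f x \<in> V \<longrightarrow> (\<exists>S. openin (mtop X) S \<and> x \<in> S \<and> f ` S \<subseteq> V)))"
    (is "_ \<longleftrightarrow> ?R")
  proof
    assume c: "continuous_map (mtop X) (mtop Y) f"
    have "\<exists>S. openin (mtop X) S \<and> x \<in> S \<and> f ` S \<subseteq> V"
      if "x \<in> pts X" "openin (mtop Y) V" "f x \<in> V" for x V
      using openin_continuous_map_preimage[OF c that(2)] that
      by (intro exI[of _ "{x \<in> topspace (mtop X). f x \<in> V}"]) (auto simp: pts_def)
    then show ?R using c by (auto simp: pts_def continuous_map_def)
  next
    assume R: ?R
    have "openin (mtop X) {x \<in> topspace (mtop X). f x \<in> V}" if V: "openin (mtop Y) V" for V
    proof (subst openin_subopen, intro ballI)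
      fix x assume "x \<in> {x \<in> topspace (mtop X). f x \<in> V}"
      then have "x \<in> pts X" "openin (mtop Y) V \<and> f x \<in> V" using V by (auto simp: pts_def)
      with R obtain S where "openin (mtop X) S" "x \<in> S" "f ` S \<subseteq> V" by meson
      then show "\<exists>T. openin (mtop X) T \<and> x \<in> T \<and> T \<subseteq> {x \<in> topspace (mtop X). f x \<in> V}"
        using openin_subset by blast
    qed
    then show "continuous_map (mtop X) (mtop Y) f" using R by (auto simp: pts_def continuous_map_def)
  qed
  then show ?thesis by (simp only: smooth_map_iff[OF X Y] smooth_at_def ball_conj_distrib conj_assoc)
qed

lemma smooth_map_in_pts: "smooth_map X Y f \<Longrightarrow> x \<in> pts X \<Longrightarrow> f x \<in> pts Y"
  by (auto simp: smooth_map_def continuous_map_def pts_def)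

lemma smooth_at_cong:
  assumes X: "charted X" and f: "smooth_at X Y f x"
    and S: "openin (mtop X) S" "x \<in> S" "\<And>y. y \<in> S \<Longrightarrow> f y = g y"
  shows "smooth_at X Y g x"
  unfolding smooth_at_def
proof (intro conjI allI impI ballI)
  have gx: "g x = f x" using S by simp
  show "g x \<in> pts Y" using smooth_atD(1)[OF f] gx by simp
  show "\<exists>S. openin (mtop X) S \<and> x \<in> S \<and> g ` S \<subseteq> V" if "openin (mtop Y) V \<and> g x \<in> V" for V
  proof -
    obtain S' where "openin (mtop X) S'" "x \<in> S'" "f ` S' \<subseteq> V"
      using smooth_atD(2)[OF f, of V] gx \<open>_ \<and> _\<close> by auto
    then show ?thesis using S by (intro exI[of _ "S \<inter> S'"]) force
  qed
  fix c assume c: "c \<in> matlas Y"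
  have "smooth_real_at X (\<lambda>y. snd c (g y) j) x" if "g x \<in> fst c" "j < mdim Y" for j
  proof -
    have "smooth_real_at X (\<lambda>y. snd c (f y) j) x"
      by (rule smooth_atD(3)[OF f, of "fst c"]) (use c gx that in simp_all)
    then show ?thesis by (rule smooth_real_at_cong[OF X _ S(1,2)]) (simp add: S(3))
  qed
  then show "case c of (W, \<psi>) \<Rightarrow> g x \<in> W \<longrightarrow> (\<forall>j<mdim Y. smooth_real_at X (\<lambda>y. \<psi> (g y) j) x)"
    by (simp add: case_prod_beta)
qed

lemma smooth_map_cong:
  assumes "charted X" "charted Y" "smooth_map X Y f" "\<And>x. x \<in> pts X \<Longrightarrow> f x = g x"
  shows "smooth_map X Y g"
  unfolding smooth_map_iff_smooth_at[OF assms(1,2)]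
proof
  fix x assume "x \<in> pts X"
  then have "smooth_at X Y f x" using assms(3) smooth_map_iff_smooth_at[OF assms(1,2)] by simp
  then show "smooth_at X Y g x"
    by (rule smooth_at_cong[OF assms(1) _ openin_topspace]) (use \<open>x \<in> pts X\<close> assms(4) in \<open>simp_all add: pts_def\<close>)
qed

text \<open>A chart \<open>\<kappa>\<close> of \<open>Y\<close> at \<open>f x\<close> is inserted
  between the two maps: near \<open>x\<close>, the coordinates of \<open>g (f y)\<close> are those
  of \<open>g\<close> read through the inverse of \<open>\<kappa>\<close>, evaluated at
  \<open>\<kappa> (f y)\<close>. Continuity of \<open>f\<close> at \<open>x\<close> provides the
  neighbourhood on which this rewriting is valid.\<close>

lemma smooth_at_compose:
  assumes X: "charted X" and Y: "charted Y" and f: "smooth_at X Y f x" and g: "smooth_at Y Z g (f x)"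
  shows "smooth_at X Z (\<lambda>x. g (f x)) x"
  unfolding smooth_at_def
proof (intro conjI allI impI ballI)
  show "g (f x) \<in> pts Z" using smooth_atD(1)[OF g] .
  show "\<exists>S. openin (mtop X) S \<and> x \<in> S \<and> (\<lambda>x. g (f x)) ` S \<subseteq> V"
    if V: "openin (mtop Z) V \<and> g (f x) \<in> V" for V
  proof -
    obtain T where T: "openin (mtop Y) T" "f x \<in> T" "g ` T \<subseteq> V"
      using smooth_atD(2)[OF g, of V] V by auto
    obtain S where "openin (mtop X) S" "x \<in> S" "f ` S \<subseteq> T"
      using smooth_atD(2)[OF f T(1,2)] by auto
    with T(3) show ?thesis by (intro exI[of _ S]) auto
  qed
  fix c assume c: "c \<in> matlas Z"
  obtain V \<kappa> where V: "(V, \<kappa>) \<in> matlas Y" "f x \<in> V" using charted_obtain[OF Y smooth_atD(1)[OF f]] .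
  note chart = charted_chart_on[OF Y V(1)]
  obtain S where S: "openin (mtop X) S" "x \<in> S" "f ` S \<subseteq> V"
    using smooth_atD(2)[OF f chart_on_open(1)[OF chart] V(2)] by auto
  have "smooth_real_at X (\<lambda>y. snd c (g (f y)) j) x" if "g (f x) \<in> fst c" "j < mdim Z" for j
  proof (rule smooth_real_at_cong[OF X _ S(1,2)])
    have "smooth_real_at Y (\<lambda>y. snd c (g y) j) (f x)"
      by (rule smooth_atD(3)[OF g, of "fst c"]) (use c that in simp_all)
    note H = smooth_real_atD[OF this V]
    show "smooth_real_at X (\<lambda>y. (\<lambda>z. snd c (g (inv_into V \<kappa> z)) j) (\<kappa> (f y))) x"
    proof (rule smooth_real_at_compose[where u = "\<lambda>y. \<kappa> (f y)", OF X S(1,2) _ _ H])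
      show "\<kappa> (f y) \<in> Espace (mdim Y)" if "y \<in> S" for y
        using that S(3) by (intro chart_on_Espace[OF chart]) blast
    qed (rule smooth_atD(3)[OF f V])
    show "snd c (g (inv_into V \<kappa> (\<kappa> (f y)))) j = snd c (g (f y)) j" if "y \<in> S" for y
      using that S(3) chart_on_inj[OF chart] by (simp add: image_subset_iff)
  qed
  then show "case c of (W, \<psi>) \<Rightarrow> g (f x) \<in> W \<longrightarrow> (\<forall>j<mdim Z. smooth_real_at X (\<lambda>y. \<psi> (g (f y)) j) x)"
    by (simp add: case_prod_beta)
qed

lemma smooth_map_compose:
  assumes "charted X" "charted Y" "charted Z" "smooth_map X Y f" "smooth_map Y Z g"
  shows "smooth_map X Z (\<lambda>x. g (f x))"
  unfolding smooth_map_iff_smooth_at[OF assms(1,3)]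
proof
  fix x assume "x \<in> pts X"
  with assms(4,5) smooth_map_in_pts[OF assms(4)] have "smooth_at X Y f x" "smooth_at Y Z g (f x)"
    by (simp_all add: smooth_map_iff_smooth_at assms(1-3))
  then show "smooth_at X Z (\<lambda>x. g (f x)) x" by (rule smooth_at_compose[OF assms(1,2)])
qed

text \<open>Smoothness of the identity is exactly the compatibility of charts. For manifolds assumed
  only to be \<open>charted\<close>, it is therefore passed along as a separate hypothesis.\<close>

lemma smooth_map_id: "smooth_manifold X \<Longrightarrow> smooth_map X X (\<lambda>x. x)"
proof -
  assume X: "smooth_manifold X"
  have "smooth_between (mdim X) (mdim X) (\<phi> ` {x \<in> U. x \<in> W}) (\<psi> \<circ> (\<lambda>x. x) \<circ> inv_into U \<phi>)"
    if "(U, \<phi>) \<in> matlas X" "(W, \<psi>) \<in> matlas X" for U \<phi> W \<psi>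
  proof -
    have "smooth_between (mdim X) (mdim X) (\<phi> ` (U \<inter> W)) (\<psi> \<circ> inv_into U \<phi>)"
      using X that unfolding smooth_manifold_def by fast
    then show ?thesis by (simp add: comp_def Int_def)
  qed
  then show ?thesis unfolding smooth_map_def by auto
qed

section \<open>Maps read in charts, and block projections\<close>

lemma continuous_map_chart_compose:
  assumes "chart_on T n (U, \<phi>)" "continuous_map Z T p" "\<And>z. z \<in> topspace Z \<Longrightarrow> p z \<in> U"
  shows "continuous_map Z (Euclidean_space n) (\<lambda>z. \<phi> (p z))"
proof -
  have "continuous_map Z (subtopology T U) p"
    using assms(2,3) unfolding continuous_map_in_subtopology by auto
  from continuous_map_compose[OF this chart_on_continuous[OF assms(1)]] show ?thesis
    by (simp add: comp_def)
qed

lemma continuous_map_chart_inverse_compose: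
  assumes "chart_on T n (U, \<phi>)" "continuous_map Z (Euclidean_space n) q"
    "\<And>z. z \<in> topspace Z \<Longrightarrow> q z \<in> \<phi> ` U"
  shows "continuous_map Z T (\<lambda>z. inv_into U \<phi> (q z))"
proof -
  have "continuous_map Z (subtopology (Euclidean_space n) (\<phi> ` U)) q"
    using assms(2,3) unfolding continuous_map_in_subtopology by auto
  from continuous_map_compose[OF this chart_on_inverse_continuous[OF assms(1)]] show ?thesis
    by (simp add: comp_def)
qed

text \<open>The common core of \<open>fst\<close>, \<open>snd\<close> and the projections of a
  power. Each chart \<open>\<phi>\<close> of the source comes with one chart \<open>\<kappa>\<close>
  of the target in which \<open>p\<close> is a block; any other target chart is reached by a change
  of coordinates, smooth because the identity is.\<close>

lemma smooth_map_block_projection: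
  assumes Z: "charted Z" and X: "charted X" and idX: "smooth_map X X (\<lambda>x. x)"
    and p: "continuous_map (mtop Z) (mtop X) p"
    and blk: "\<And>U \<phi>. (U, \<phi>) \<in> matlas Z \<Longrightarrow>
      \<exists>V \<kappa>. (V, \<kappa>) \<in> matlas X \<and> p ` U \<subseteq> V \<and> (\<forall>y\<in>U. \<kappa> (p y) = block b (mdim X) (\<phi> y))"
  shows "smooth_map Z X p"
proof -
  have "smooth_real_at Z (\<lambda>y. \<psi> (p y) j) x"
    if d: "(W, \<psi>) \<in> matlas X" "p x \<in> W" and j: "j < mdim X" and x: "x \<in> pts Z" for x W \<psi> j
  proof (rule smooth_real_atI)
    fix U \<phi> assume c: "(U, \<phi>) \<in> matlas Z" "x \<in> U"
    note chart = charted_chart_on[OF Z c(1)]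
    obtain V \<kappa> where V: "(V, \<kappa>) \<in> matlas X" "p ` U \<subseteq> V"
      and \<kappa>: "\<And>y. y \<in> U \<Longrightarrow> \<kappa> (p y) = block b (mdim X) (\<phi> y)"
      using blk[OF c(1)] by meson
    have px: "p x \<in> pts X" "p x \<in> V" using p x V(2) c(2) by (auto simp: pts_def continuous_map_def)
    note chartV = charted_chart_on[OF X V(1)]
    \<comment> \<open>The change of coordinates from \<open>\<kappa>\<close> to
      \<open>\<psi>\<close> is smooth at the block of \<open>\<phi> x\<close>.\<close>
    have "smooth_at X X (\<lambda>x. x) (p x)" using idX px(1) smooth_map_iff_smooth_at[OF X X] by simp
    from smooth_real_atD[OF smooth_atD(3)[OF this d j] V(1) px(2)]
    have H: "smooth_fun_at (mdim X) (\<lambda>z. \<psi> (inv_into V \<kappa> z) j) (block b (mdim X) (\<phi> x))"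
      using \<kappa>[OF c(2)] by simp
    have "smooth_fun_at (mdim Z) (\<lambda>z. \<psi> (inv_into V \<kappa> (block b (mdim X) z)) j) (\<phi> x)"
    proof (rule smooth_fun_at_compose[where u = "block b (mdim X)", OF chart_on_open(2)[OF chart] _ _ _ H])
      show "\<phi> x \<in> \<phi> ` U" using c by blast
      show "smooth_fun_at (mdim Z) (\<lambda>z. block b (mdim X) z i) (\<phi> x)" if "i < mdim X" for i
        using smooth_fun_at_coordinate[OF chart_on_Espace[OF chart c(2)]] that by (simp add: block_def)
    qed (rule block_in_Espace)
    then show "smooth_fun_at (mdim Z) (\<lambda>z. \<psi> (p (inv_into U \<phi> z)) j) (\<phi> x)"
    proof (rule smooth_fun_at_cong[OF _ chart_on_open(2)[OF chart]])
      show "\<phi> x \<in> \<phi> ` U" using c by blast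
      fix z assume "z \<in> \<phi> ` U"
      then obtain y where y: "y \<in> U" "z = \<phi> y" by blast
      then have "inv_into V \<kappa> (block b (mdim X) z) = p y" "inv_into U \<phi> z = y"
        using \<kappa>[OF y(1)] chart_on_inj[OF chart] chart_on_inj[OF chartV] V(2)
        by (metis image_subset_iff inv_into_f_f, simp)
      then show "\<psi> (inv_into V \<kappa> (block b (mdim X) z)) j = \<psi> (p (inv_into U \<phi> z)) j" by simp
    qed
  qed
  then show ?thesis using p by (auto simp: smooth_map_iff[OF Z X])
qed

subsection \<open>Open submanifolds\<close>

lemma pts_open_submanifold: "pts (open_submanifold X S) = pts X \<inter> S"
  by (simp add: open_submanifold_def pts_def)

lemma charted_open_submanifold:
  assumes X: "charted X" and S: "openin (mtop X) S"
  shows "charted (open_submanifold X S)"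
proof -
  have "chart_on (subtopology (mtop X) S) (mdim X) (U \<inter> S, \<phi>)" if c: "(U, \<phi>) \<in> matlas X" for U \<phi>
  proof -
    note chart = charted_chart_on[OF X c]
    have US: "openin (mtop X) (U \<inter> S)" using chart_on_open(1)[OF chart] S by (rule openin_Int)
    show ?thesis
    proof (rule chart_onI)
      show "openin (subtopology (mtop X) S) (U \<inter> S)"
        using US by (simp add: openin_subset_topspace_eq openin_open_subtopology S)
      show "openin (Euclidean_space (mdim X)) (\<phi> ` (U \<inter> S))"
        using US by (rule chart_on_image_open[OF chart]) simp
      show "continuous_map (subtopology (subtopology (mtop X) S) (U \<inter> S)) (Euclidean_space (mdim X)) \<phi>"
        unfolding subtopology_subtopology
        using chart_on_continuous[OF chart] by (rule continuous_map_from_subtopology_mono) auto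
      show "continuous_map (subtopology (Euclidean_space (mdim X)) (\<phi> ` (U \<inter> S))) (subtopology (mtop X) S) (inv_into U \<phi>)"
        unfolding continuous_map_in_subtopology
      proof
        show "continuous_map (subtopology (Euclidean_space (mdim X)) (\<phi> ` (U \<inter> S))) (mtop X) (inv_into U \<phi>)"
          using chart_on_inverse_continuous[OF chart] by (rule continuous_map_from_subtopology_mono) auto
        show "inv_into U \<phi> \<in> topspace (subtopology (Euclidean_space (mdim X)) (\<phi> ` (U \<inter> S))) \<rightarrow> S"
          using chart_on_inj[OF chart] by auto
      qed
    qed (use chart_on_inj[OF chart] in auto)
  qed
  moreover have "(\<Union>c\<in>matlas (open_submanifold X S). fst c) = (\<Union>c\<in>matlas X. fst c) \<inter> S"
    by (auto simp: open_submanifold_def)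
  ultimately show ?thesis
    using X unfolding charted_def pts_open_submanifold
    by (auto simp: open_submanifold_def)
qed

text \<open>Shrinking the chart domain to \<open>U \<inter> S\<close> can alter the inverse of
  \<open>\<phi>\<close> only outside an open set containing \<open>\<phi> x\<close>, and smoothness
  at a point does not see that.\<close>

lemma smooth_real_at_open_submanifold:
  assumes X: "charted X" and S: "openin (mtop X) S" "x \<in> S"
  shows "smooth_real_at (open_submanifold X S) h x \<longleftrightarrow> smooth_real_at X h x"
proof -
  have "smooth_fun_at (mdim X) (\<lambda>z. h (inv_into (U \<inter> S) \<phi> z)) (\<phi> x) \<longleftrightarrow>
        smooth_fun_at (mdim X) (\<lambda>z. h (inv_into U \<phi> z)) (\<phi> x)"
    if c: "(U, \<phi>) \<in> matlas X" "x \<in> U" for U \<phi>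
  proof -
    note chart = charted_chart_on[OF X c(1)]
    have US: "openin (Euclidean_space (mdim X)) (\<phi> ` (U \<inter> S))"
      using openin_Int[OF chart_on_open(1)[OF chart] S(1)] by (rule chart_on_image_open[OF chart]) simp
    have x: "\<phi> x \<in> \<phi> ` (U \<inter> S)" using c S by blast
    have inj: "inj_on \<phi> (U \<inter> S)" using chart_on_inj[OF chart] by (rule inj_on_subset) simp
    have eq: "inv_into (U \<inter> S) \<phi> z = inv_into U \<phi> z" if "z \<in> \<phi> ` (U \<inter> S)" for z
      using that inj chart_on_inj[OF chart] by auto
    show ?thesis
      using smooth_fun_at_cong[OF _ US x, of "\<lambda>z. h (inv_into (U \<inter> S) \<phi> z)" "\<lambda>z. h (inv_into U \<phi> z)"]
        smooth_fun_at_cong[OF _ US x, of "\<lambda>z. h (inv_into U \<phi> z)" "\<lambda>z. h (inv_into (U \<inter> S) \<phi> z)"] eq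
      by auto
  qed
  then show ?thesis using S(2) unfolding smooth_real_at_def
    by (force simp: open_submanifold_def)
qed

lemma smooth_at_open_submanifold:
  assumes X: "charted X" and S: "openin (mtop X) S" "x \<in> S"
  shows "smooth_at (open_submanifold X S) Y f x \<longleftrightarrow> smooth_at X Y f x"
proof -
  have "(\<exists>T. openin (mtop (open_submanifold X S)) T \<and> x \<in> T \<and> f ` T \<subseteq> V) \<longleftrightarrow>
        (\<exists>T. openin (mtop X) T \<and> x \<in> T \<and> f ` T \<subseteq> V)" for V
  proof
    assume "\<exists>T. openin (mtop (open_submanifold X S)) T \<and> x \<in> T \<and> f ` T \<subseteq> V"
    then show "\<exists>T. openin (mtop X) T \<and> x \<in> T \<and> f ` T \<subseteq> V"
      using openin_open_subtopology[OF S(1)] by (auto simp: open_submanifold_def)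
  next
    assume "\<exists>T. openin (mtop X) T \<and> x \<in> T \<and> f ` T \<subseteq> V"
    then obtain T where "openin (mtop X) T" "x \<in> T" "f ` T \<subseteq> V" by auto
    then show "\<exists>T. openin (mtop (open_submanifold X S)) T \<and> x \<in> T \<and> f ` T \<subseteq> V"
      using S openin_open_subtopology[OF S(1), of "T \<inter> S"]
      by (intro exI[of _ "T \<inter> S"]) (auto simp: open_submanifold_def)
  qed
  then show ?thesis
    by (simp add: smooth_at_def smooth_real_at_open_submanifold[OF assms])
qed

subsection \<open>Products\<close>

lemma pts_prod_manifold: "pts (prod_manifold X Y) = pts X \<times> pts Y"
  by (simp add: prod_manifold_def pts_def)

lemma charted_prod_manifold:
  assumes X: "charted X" and Y: "charted Y"
  shows "charted (prod_manifold X Y)"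
proof -
  let ?n = "mdim X" and ?m = "mdim Y"
  have "chart_on (prod_topology (mtop X) (mtop Y)) (?n + ?m)
      (U \<times> W, \<lambda>(x, y) i. if i < ?n then \<phi> x i else \<psi> y (i - ?n))"
    if c: "(U, \<phi>) \<in> matlas X" and d: "(W, \<psi>) \<in> matlas Y" for U \<phi> W \<psi>
  proof -
    note chU = charted_chart_on[OF X c] and chW = charted_chart_on[OF Y d]
    define \<Phi> where "\<Phi> = (\<lambda>(x, y) i. if i < ?n then \<phi> x i else \<psi> y (i - ?n))"
    \<comment> \<open>The image of \<open>U \<times> W\<close>, described by its two coordinate
      blocks, so that its openness follows from continuity of \<open>block\<close>.\<close>
    define S where "S = {z \<in> Espace (?n + ?m). block 0 ?n z \<in> \<phi> ` U} \<inter>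
        {z \<in> Espace (?n + ?m). block ?n ?m z \<in> \<psi> ` W}"
    define \<Psi> where "\<Psi> z = (inv_into U \<phi> (block 0 ?n z), inv_into W \<psi> (block ?n ?m z))" for z
    have \<Phi>E: "\<Phi> (x, y) \<in> Espace (?n + ?m)" "block 0 ?n (\<Phi> (x, y)) = \<phi> x" "block ?n ?m (\<Phi> (x, y)) = \<psi> y"
      if "x \<in> U" "y \<in> W" for x y
      using chart_on_Espace[OF chU that(1)] chart_on_Espace[OF chW that(2)]
      by (auto simp: \<Phi>_def in_Espace block_def fun_eq_iff)
    have "chart_on (prod_topology (mtop X) (mtop Y)) (?n + ?m) (U \<times> W, \<Phi>)"
    proof (rule chart_onI[where S = S and \<psi> = \<Psi>])
      show "openin (prod_topology (mtop X) (mtop Y)) (U \<times> W)"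
        using chart_on_open(1)[OF chU] chart_on_open(1)[OF chW] by (simp add: openin_prod_Times_iff)
      show "openin (Euclidean_space (?n + ?m)) S" unfolding S_def
        by (intro openin_Int openin_continuous_map_preimage[OF continuous_map_block]
            chart_on_open(2)[OF chU] chart_on_open(2)[OF chW])
      let ?Z = "subtopology (prod_topology (mtop X) (mtop Y)) (U \<times> W)"
      have 1: "continuous_map ?Z (Euclidean_space ?n) (\<lambda>z. \<phi> (fst z))"
        by (rule continuous_map_chart_compose[OF chU continuous_map_subtopology_fst]) auto
      have 2: "continuous_map ?Z (Euclidean_space ?m) (\<lambda>z. \<psi> (snd z))"
        by (rule continuous_map_chart_compose[OF chW continuous_map_subtopology_snd]) auto
      have "continuous_map ?Z euclideanreal (\<lambda>z. \<Phi> z i)" if "i < ?n + ?m" for i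
        using 1 2 that unfolding continuous_map_Euclidean_iff \<Phi>_def case_prod_beta
        by (cases "i < ?n") auto
      moreover have "\<forall>z\<in>topspace ?Z. \<Phi> z \<in> Espace (?n + ?m)" using \<Phi>E(1) by auto
      ultimately show "continuous_map ?Z (Euclidean_space (?n + ?m)) \<Phi>"
        unfolding continuous_map_Euclidean_iff by blast
      show "continuous_map (subtopology (Euclidean_space (?n + ?m)) S) (prod_topology (mtop X) (mtop Y)) \<Psi>"
        unfolding \<Psi>_def
        by (intro continuous_map_pairedI continuous_map_chart_inverse_compose[OF chU]
            continuous_map_chart_inverse_compose[OF chW] continuous_map_from_subtopology continuous_map_block)
          (auto simp: S_def)
      show "\<Phi> z \<in> S \<and> \<Psi> (\<Phi> z) = z" if "z \<in> U \<times> W" for z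
        using that \<Phi>E chart_on_inj[OF chU] chart_on_inj[OF chW] by (auto simp: S_def \<Psi>_def)
      show "\<Psi> z \<in> U \<times> W \<and> \<Phi> (\<Psi> z) = z" if "z \<in> S" for z
      proof -
        from that obtain x y where xy: "x \<in> U" "y \<in> W" "block 0 ?n z = \<phi> x" "block ?n ?m z = \<psi> y"
          and z: "z \<in> Espace (?n + ?m)" unfolding S_def by blast
        have \<Psi>z: "\<Psi> z = (x, y)" using xy chart_on_inj[OF chU] chart_on_inj[OF chW] by (simp add: \<Psi>_def)
        have "\<Phi> (x, y) i = z i" if "i < ?n + ?m" for i
          unfolding \<Phi>_def prod.case xy(3,4)[symmetric] using that by (auto simp: block_def)
        then have "\<Phi> (x, y) = z" using Espace_eqI[OF \<Phi>E(1)[OF xy(1,2)] z] by blast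
        then show ?thesis using \<Psi>z xy by simp
      qed
    qed
    then show ?thesis by (simp add: \<Phi>_def)
  qed
  moreover have "(\<Union>c\<in>matlas (prod_manifold X Y). fst c) = (\<Union>c\<in>matlas X. fst c) \<times> (\<Union>c\<in>matlas Y. fst c)"
    by (force simp: prod_manifold_def)
  ultimately show ?thesis
    using X Y unfolding charted_def pts_prod_manifold by (auto simp: prod_manifold_def)
qed

lemma smooth_map_fst:
  assumes "charted X" "charted Y" "smooth_map X X (\<lambda>x. x)"
  shows "smooth_map (prod_manifold X Y) X fst"
proof (rule smooth_map_block_projection[OF charted_prod_manifold[OF assms(1,2)] assms(1,3), where b = 0])
  show "continuous_map (mtop (prod_manifold X Y)) (mtop X) fst"
    by (simp add: prod_manifold_def continuous_map_fst)
  fix V \<Phi> assume "(V, \<Phi>) \<in> matlas (prod_manifold X Y)"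
  then obtain U \<phi> W \<psi> where c: "(U, \<phi>) \<in> matlas X" "(W, \<psi>) \<in> matlas Y"
    "V = U \<times> W" "\<Phi> = (\<lambda>(x, y) i. if i < mdim X then \<phi> x i else \<psi> y (i - mdim X))"
    by (auto simp: prod_manifold_def)
  have "\<phi> (fst y) = block 0 (mdim X) (\<Phi> y)" if "y \<in> V" for y
    using chart_on_Espace[OF charted_chart_on[OF assms(1) c(1)], of "fst y"] that
    by (auto simp: c in_Espace block_def fun_eq_iff case_prod_beta)
  then show "\<exists>U \<kappa>. (U, \<kappa>) \<in> matlas X \<and> fst ` V \<subseteq> U \<and> (\<forall>y\<in>V. \<kappa> (fst y) = block 0 (mdim X) (\<Phi> y))"
    using c by (intro exI[of _ U] exI[of _ \<phi>]) auto
qed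

lemma smooth_map_snd:
  assumes "charted X" "charted Y" "smooth_map Y Y (\<lambda>x. x)"
  shows "smooth_map (prod_manifold X Y) Y snd"
proof (rule smooth_map_block_projection[OF charted_prod_manifold[OF assms(1,2)] assms(2,3), where b = "mdim X"])
  show "continuous_map (mtop (prod_manifold X Y)) (mtop Y) snd"
    by (simp add: prod_manifold_def continuous_map_snd)
  fix V \<Phi> assume "(V, \<Phi>) \<in> matlas (prod_manifold X Y)"
  then obtain U \<phi> W \<psi> where c: "(U, \<phi>) \<in> matlas X" "(W, \<psi>) \<in> matlas Y"
    "V = U \<times> W" "\<Phi> = (\<lambda>(x, y) i. if i < mdim X then \<phi> x i else \<psi> y (i - mdim X))"
    by (auto simp: prod_manifold_def)
  have "\<psi> (snd y) = block (mdim X) (mdim Y) (\<Phi> y)" if "y \<in> V" for y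
    using chart_on_Espace[OF charted_chart_on[OF assms(2) c(2)], of "snd y"] that
    by (auto simp: c in_Espace block_def fun_eq_iff case_prod_beta)
  then show "\<exists>U \<kappa>. (U, \<kappa>) \<in> matlas Y \<and> snd ` V \<subseteq> U \<and> (\<forall>y\<in>V. \<kappa> (snd y) = block (mdim X) (mdim Y) (\<Phi> y))"
    using c by (intro exI[of _ W] exI[of _ \<psi>]) auto
qed

lemma smooth_map_Pair:
  assumes X: "charted X" and A: "charted A" and B: "charted B"
    and f: "smooth_map X A f" and g: "smooth_map X B g"
  shows "smooth_map X (prod_manifold A B) (\<lambda>x. (f x, g x))"
  unfolding smooth_map_iff[OF X charted_prod_manifold[OF A B]]
proof (intro conjI ballI)
  show "continuous_map (mtop X) (mtop (prod_manifold A B)) (\<lambda>x. (f x, g x))"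
    using f g by (simp add: prod_manifold_def smooth_map_def continuous_map_paired)
  fix x c assume x: "x \<in> pts X" and "c \<in> matlas (prod_manifold A B)"
  then obtain U \<phi> W \<psi> where c: "(U, \<phi>) \<in> matlas A" "(W, \<psi>) \<in> matlas B"
    "c = (U \<times> W, \<lambda>(x, y) i. if i < mdim A then \<phi> x i else \<psi> y (i - mdim A))"
    by (auto simp: prod_manifold_def)
  have fx: "smooth_at X A f x" "smooth_at X B g x"
    using f g x by (simp_all add: smooth_map_iff_smooth_at X A B)
  have "smooth_real_at X (\<lambda>y. if j < mdim A then \<phi> (f y) j else \<psi> (g y) (j - mdim A)) x"
    if "f x \<in> U" "g x \<in> W" "j < mdim A + mdim B" for j
    using smooth_atD(3)[OF fx(1) c(1) that(1), of j] smooth_atD(3)[OF fx(2) c(2) that(2), of "j - mdim A"] that(3)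
    by (cases "j < mdim A") auto
  then show "case c of (W, \<psi>) \<Rightarrow> (f x, g x) \<in> W \<longrightarrow>
      (\<forall>j<mdim (prod_manifold A B). smooth_real_at X (\<lambda>y. \<psi> (f y, g y) j) x)"
    unfolding c(3) by (simp add: prod_manifold_def)
qed

subsection \<open>Powers\<close>

lemma pts_power_manifold: "pts (power_manifold k X) = (\<Pi>\<^sub>E i\<in>{..k}. pts X)"
  by (simp add: power_manifold_def pts_def)

text \<open>In a power chart, coordinate \<open>i * n + j\<close> is coordinate \<open>j\<close> of
  factor \<open>i\<close>.\<close>

lemma block_index:
  fixes i j k n :: nat
  assumes "i \<le> k" "j < n"
  shows "i * n + j < Suc k * n" "(i * n + j) div n = i" "(i * n + j) mod n = j"
proof -
  have "i * n + j < Suc i * n" using assms(2) by simp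
  also have "\<dots> \<le> Suc k * n" using assms(1) by (intro mult_le_mono1) simp
  finally show "i * n + j < Suc k * n" .
qed (use assms in simp_all)

lemma charted_power_manifold:
  assumes X: "charted X"
  shows "charted (power_manifold k X)"
proof -
  let ?n = "mdim X"
  define N where "N = Suc k * ?n"
  have "chart_on (product_topology (\<lambda>_. mtop X) {..k}) N
     (\<Pi>\<^sub>E i\<in>{..k}. fst (c i), \<lambda>x j. if j < N then snd (c (j div ?n)) (x (j div ?n)) (j mod ?n) else 0)"
    if c: "\<forall>i\<le>k. c i \<in> matlas X" for c
  proof -
    define U where "U i = fst (c i)" for i
    define \<phi> where "\<phi> i = snd (c i)" for i
    have ch: "chart_on (mtop X) ?n (U i, \<phi> i)" if "i \<le> k" for i
      using charted_chart_on[OF X, of "U i" "\<phi> i"] c that by (simp add: U_def \<phi>_def)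
    define \<Phi> where "\<Phi> = (\<lambda>x j. if j < N then \<phi> (j div ?n) (x (j div ?n)) (j mod ?n) else 0)"
    define S where "S = (\<Inter>i\<in>{..k}. {z \<in> Espace N. block (i * ?n) ?n z \<in> \<phi> i ` U i})"
    define \<Psi> where "\<Psi> z = (\<lambda>i\<in>{..k}. inv_into (U i) (\<phi> i) (block (i * ?n) ?n z))" for z
    have \<Phi>E: "\<Phi> x \<in> Espace N" for x by (simp add: \<Phi>_def in_Espace)
    have \<Phi>blk: "block (i * ?n) ?n (\<Phi> x) = \<phi> i (x i)" if "x i \<in> U i" "i \<le> k" for x i
    proof (rule Espace_eqI[OF block_in_Espace chart_on_Espace[OF ch[OF that(2)] that(1)]])
      fix j assume "j < ?n"
      then show "block (i * ?n) ?n (\<Phi> x) j = \<phi> i (x i) j"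
        using block_index[OF that(2) \<open>j < ?n\<close>] by (simp add: block_def \<Phi>_def N_def)
    qed
    \<comment> \<open>The reverse of \<open>block_index\<close>: every coordinate below
      \<open>N\<close> belongs to a factor of index at most \<open>k\<close>. In dimension 0 there
      is no such coordinate.\<close>
    have jdiv: "j div ?n \<le> k" "j mod ?n < ?n" "j div ?n * ?n + j mod ?n = j" if "j < N" for j
    proof -
      have "j < ?n * Suc k" using that by (simp add: N_def mult.commute)
      then have "j div ?n < Suc k" by (rule less_mult_imp_div_less[of j "Suc k" ?n, unfolded mult.commute[of "Suc k"]])
      then show "j div ?n \<le> k" by simp
      show "j mod ?n < ?n" using that by (cases "?n = 0") (auto simp: N_def)
    qed simp
    have "chart_on (product_topology (\<lambda>_. mtop X) {..k}) N (\<Pi>\<^sub>E i\<in>{..k}. U i, \<Phi>)"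
    proof (rule chart_onI[where S = S and \<psi> = \<Psi>])
      show "openin (product_topology (\<lambda>_. mtop X) {..k}) (\<Pi>\<^sub>E i\<in>{..k}. U i)"
        using chart_on_open(1)[OF ch] by (simp add: openin_PiE)
      show "openin (Euclidean_space N) S" unfolding S_def
        by (intro openin_INT2 openin_continuous_map_preimage[OF continuous_map_block] chart_on_open(2)[OF ch]) auto
      let ?Z = "subtopology (product_topology (\<lambda>_. mtop X) {..k}) (\<Pi>\<^sub>E i\<in>{..k}. U i)"
      have "continuous_map ?Z (Euclidean_space ?n) (\<lambda>z. \<phi> i (z i))" if "i \<le> k" for i
      proof (rule continuous_map_chart_compose[OF ch[OF that]])
        show "continuous_map ?Z (mtop X) (\<lambda>z. z i)"
          using that by (intro continuous_map_from_subtopology continuous_map_product_projection) simp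
      qed (use that in auto)
      then have "continuous_map ?Z euclideanreal (\<lambda>z. \<Phi> z j)" if "j < N" for j
        using jdiv[OF that] that unfolding continuous_map_Euclidean_iff \<Phi>_def by simp
      then show "continuous_map ?Z (Euclidean_space N) \<Phi>"
        unfolding continuous_map_Euclidean_iff using \<Phi>E by blast
      show "continuous_map (subtopology (Euclidean_space N) S) (product_topology (\<lambda>_. mtop X) {..k}) \<Psi>"
        unfolding continuous_map_componentwise
      proof (intro conjI ballI)
        show "\<Psi> ` topspace (subtopology (Euclidean_space N) S) \<subseteq> extensional {..k}"
          by (auto simp: \<Psi>_def)
        fix i assume i: "i \<in> {..k}"
        have "continuous_map (subtopology (Euclidean_space N) S) (mtop X)
            (\<lambda>z. inv_into (U i) (\<phi> i) (block (i * ?n) ?n z))"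
        proof (rule continuous_map_chart_inverse_compose[OF ch])
          show "continuous_map (subtopology (Euclidean_space N) S) (Euclidean_space ?n) (block (i * ?n) ?n)"
            by (intro continuous_map_from_subtopology continuous_map_block)
        qed (use i in \<open>auto simp: S_def\<close>)
        then show "continuous_map (subtopology (Euclidean_space N) S) (mtop X) (\<lambda>z. \<Psi> z i)"
          using i by (simp add: \<Psi>_def)
      qed
      show "\<Phi> x \<in> S \<and> \<Psi> (\<Phi> x) = x" if "x \<in> (\<Pi>\<^sub>E i\<in>{..k}. U i)" for x
      proof
        have xi: "x i \<in> U i" if "i \<le> k" for i using \<open>x \<in> _\<close> that by auto
        show "\<Phi> x \<in> S" using xi \<Phi>E \<Phi>blk by (auto simp: S_def)
        show "\<Psi> (\<Phi> x) = x"
        proof (rule extensionalityI)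
          show "\<Psi> (\<Phi> x) \<in> extensional {..k}" by (simp add: \<Psi>_def)
          show "x \<in> extensional {..k}" using that by (simp add: PiE_iff)
          show "\<Psi> (\<Phi> x) i = x i" if "i \<in> {..k}" for i
            using that xi[of i] \<Phi>blk[of x i] chart_on_inj[OF ch, of i] by (simp add: \<Psi>_def)
        qed
      qed
      show "\<Psi> z \<in> (\<Pi>\<^sub>E i\<in>{..k}. U i) \<and> \<Phi> (\<Psi> z) = z" if z: "z \<in> S" for z
      proof
        have zi: "block (i * ?n) ?n z \<in> \<phi> i ` U i" if "i \<le> k" for i using z that by (auto simp: S_def)
        have zE: "z \<in> Espace N" using z by (auto simp: S_def)
        show "\<Psi> z \<in> (\<Pi>\<^sub>E i\<in>{..k}. U i)" using zi by (auto simp: \<Psi>_def intro: inv_into_into)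
        show "\<Phi> (\<Psi> z) = z"
        proof (rule Espace_eqI[OF \<Phi>E zE])
          fix j assume j: "j < N"
          have "\<phi> (j div ?n) (\<Psi> z (j div ?n)) = block (j div ?n * ?n) ?n z"
            using jdiv(1)[OF j] f_inv_into_f[OF zi[OF jdiv(1)[OF j]]] by (simp add: \<Psi>_def)
          then show "\<Phi> (\<Psi> z) j = z j" using j jdiv[OF j] by (simp add: \<Phi>_def block_def)
        qed
      qed
    qed
    then show ?thesis unfolding \<Phi>_def U_def \<phi>_def .
  qed
  moreover have "(\<Union>c\<in>matlas (power_manifold k X). fst c) = pts (power_manifold k X)"
  proof
    show "(\<Union>c\<in>matlas (power_manifold k X). fst c) \<subseteq> pts (power_manifold k X)"
    proof
      fix x assume "x \<in> (\<Union>c\<in>matlas (power_manifold k X). fst c)"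
      then obtain c where c: "\<forall>i\<le>k. c i \<in> matlas X" "x \<in> (\<Pi>\<^sub>E i\<in>{..k}. fst (c i))"
        by (auto simp: power_manifold_def)
      have xi: "x i \<in> pts X" if "i \<le> k" for i
      proof -
        have "x i \<in> fst (c i)" "c i \<in> matlas X" using c that by auto
        then show ?thesis using X unfolding charted_def by blast
      qed
      show "x \<in> pts (power_manifold k X)"
        using xi c(2) by (auto simp: pts_power_manifold PiE_iff)
    qed
    show "pts (power_manifold k X) \<subseteq> (\<Union>c\<in>matlas (power_manifold k X). fst c)"
    proof
      fix x assume x: "x \<in> pts (power_manifold k X)"
      have "\<exists>c. c \<in> matlas X \<and> x i \<in> fst c" if "i \<le> k" for i
      proof -
        have "x i \<in> pts X" using x that by (auto simp: pts_power_manifold)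
        then obtain V \<kappa> where "(V, \<kappa>) \<in> matlas X" "x i \<in> V" by (rule charted_obtain[OF X])
        then show ?thesis by (intro exI[of _ "(V, \<kappa>)"]) simp
      qed
      then obtain c where c: "\<forall>i\<le>k. c i \<in> matlas X \<and> x i \<in> fst (c i)" by metis
      have "x \<in> (\<Pi>\<^sub>E i\<in>{..k}. fst (c i))" using c x by (auto simp: pts_power_manifold PiE_iff)
      moreover obtain \<Phi> where "(\<Pi>\<^sub>E i\<in>{..k}. fst (c i), \<Phi>) \<in> matlas (power_manifold k X)"
        using c by (auto simp: power_manifold_def)
      ultimately show "x \<in> (\<Union>c\<in>matlas (power_manifold k X). fst c)"
        by (metis (no_types, lifting) UN_I fst_conv)
    qed
  qed
  ultimately show ?thesis
    unfolding charted_def by (auto simp: power_manifold_def N_def)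
qed

lemma smooth_map_power_projection:
  assumes X: "charted X" "smooth_map X X (\<lambda>x. x)" and i: "i \<le> k"
  shows "smooth_map (power_manifold k X) X (\<lambda>x. x i)"
proof (rule smooth_map_block_projection[OF charted_power_manifold[OF X(1)] X, where b = "i * mdim X"])
  show "continuous_map (mtop (power_manifold k X)) (mtop X) (\<lambda>x. x i)"
    using continuous_map_product_projection[of i "{..k}" "\<lambda>_. mtop X"] i by (simp add: power_manifold_def)
  fix V \<Phi> assume "(V, \<Phi>) \<in> matlas (power_manifold k X)"
  then obtain c where c: "\<forall>i\<le>k. c i \<in> matlas X" "V = (\<Pi>\<^sub>E i\<in>{..k}. fst (c i))"
    "\<Phi> = (\<lambda>x j. if j < Suc k * mdim X
                   then snd (c (j div mdim X)) (x (j div mdim X)) (j mod mdim X) else 0)"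
    by (auto simp: power_manifold_def)
  have ci: "(fst (c i), snd (c i)) \<in> matlas X" using c i by simp
  have "snd (c i) (y i) = block (i * mdim X) (mdim X) (\<Phi> y)" if "y \<in> V" for y
  proof (rule Espace_eqI[OF _ block_in_Espace])
    show "snd (c i) (y i) \<in> Espace (mdim X)"
      using that i c(2) by (intro chart_on_Espace[OF charted_chart_on[OF X(1) ci]]) auto
    fix j assume "j < mdim X"
    then show "snd (c i) (y i) j = block (i * mdim X) (mdim X) (\<Phi> y) j"
      using block_index[OF i \<open>j < mdim X\<close>] by (simp add: block_def c(3))
  qed
  then show "\<exists>W \<kappa>. (W, \<kappa>) \<in> matlas X \<and> (\<lambda>x. x i) ` V \<subseteq> W \<and>
      (\<forall>y\<in>V. \<kappa> (y i) = block (i * mdim X) (mdim X) (\<Phi> y))"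
    using ci i c(2) by (intro exI[of _ "fst (c i)"] exI[of _ "snd (c i)"]) auto
qed

lemma smooth_map_tuple:
  assumes X: "charted X" and A: "charted A" and f: "\<And>i. i \<le> k \<Longrightarrow> smooth_map X A (f i)"
  shows "smooth_map X (power_manifold k A) (\<lambda>x. \<lambda>i\<in>{..k}. f i x)"
  unfolding smooth_map_iff[OF X charted_power_manifold[OF A]]
proof (intro conjI ballI)
  have "continuous_map (mtop X) (mtop A) (f i)" if "i \<le> k" for i
    using f[OF that] by (simp add: smooth_map_def)
  then show "continuous_map (mtop X) (mtop (power_manifold k A)) (\<lambda>x. \<lambda>i\<in>{..k}. f i x)"
    by (auto simp: power_manifold_def continuous_map_componentwise)
  fix x C assume x: "x \<in> pts X" and "C \<in> matlas (power_manifold k A)"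
  then obtain c where c: "\<forall>i\<le>k. c i \<in> matlas A" "C = ((\<Pi>\<^sub>E i\<in>{..k}. fst (c i)),
    (\<lambda>x j. if j < Suc k * mdim A
                   then snd (c (j div mdim A)) (x (j div mdim A)) (j mod mdim A) else 0))"
    by (auto simp: power_manifold_def)
  have fx: "smooth_at X A (f i) x" if "i \<le> k" for i
    using f[OF that] x by (simp add: smooth_map_iff_smooth_at X A)
  have "smooth_real_at X (\<lambda>y. if j < Suc k * mdim A
        then snd (c (j div mdim A)) ((\<lambda>i\<in>{..k}. f i y) (j div mdim A)) (j mod mdim A) else 0) x"
    if fc: "(\<lambda>i\<in>{..k}. f i x) \<in> (\<Pi>\<^sub>E i\<in>{..k}. fst (c i))" and j: "j < Suc k * mdim A" for j
  proof -
    \<comment> \<open>Coordinate \<open>j\<close> of the tuple involves component \<open>i\<close>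
      alone, so its smoothness is that of \<open>f i\<close>.\<close>
    define i where "i = j div mdim A"
    have "i < Suc k" unfolding i_def using j by (rule less_mult_imp_div_less)
    then have i: "i \<le> k" by simp
    have "f i x \<in> fst (c i)" using fc i by (auto simp: PiE_iff)
    moreover have "j mod mdim A < mdim A" using j by (cases "mdim A = 0") auto
    moreover have "(fst (c i), snd (c i)) \<in> matlas A" using c(1) i by simp
    ultimately have "smooth_real_at X (\<lambda>y. snd (c i) (f i y) (j mod mdim A)) x"
      using smooth_atD(3)[OF fx[OF i]] by blast
    then show ?thesis using j i unfolding i_def[symmetric] by simp
  qed
  then show "case C of (W, \<psi>) \<Rightarrow> (\<lambda>i\<in>{..k}. f i x) \<in> W \<longrightarrow>
      (\<forall>j<mdim (power_manifold k A). smooth_real_at X (\<lambda>y. \<psi> (\<lambda>i\<in>{..k}. f i y) j) x)"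
    unfolding c(2) prod.case by (simp add: power_manifold_def)
qed

section \<open>Gauge transformations as equivariant maps\<close>

context group
begin

lemma inv_mult_cancel: "x \<in> carrier G \<Longrightarrow> y \<in> carrier G \<Longrightarrow> inv x \<otimes> (x \<otimes> y) = y"
  by (simp flip: m_assoc)

lemma mult_inv_cancel: "x \<in> carrier G \<Longrightarrow> y \<in> carrier G \<Longrightarrow> x \<otimes> (inv x \<otimes> y) = y"
  by (simp flip: m_assoc)

end

text \<open>The assumptions on \<open>X\<close> and \<open>act\<close> are those consequences of being a principal bundle that are
  needed; they are stated for maps out of \<open>X\<close>, so that they can be verified componentwise on the nerve.\<close>

locale smooth_free_action = group K for K :: "'k lie_group" (structure) +
  fixes X :: "'x manifold" and \<pi> :: "'x \<Rightarrow> 'b" and act :: "'k \<Rightarrow> 'x \<Rightarrow> 'x"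
  assumes pts_K: "pts (gmfd K) = carrier K"
    and charted_K: "charted (gmfd K)" and charted_X: "charted X"
    and smooth_id: "smooth_map X X (\<lambda>x. x)"
    and smooth_mult: "\<And>\<sigma> \<tau>. smooth_map X (gmfd K) \<sigma> \<Longrightarrow> smooth_map X (gmfd K) \<tau> \<Longrightarrow>
          smooth_map X (gmfd K) (\<lambda>x. \<sigma> x \<otimes> \<tau> x)"
    and smooth_inv: "\<And>\<tau>. smooth_map X (gmfd K) \<tau> \<Longrightarrow> smooth_map X (gmfd K) (\<lambda>x. inv (\<tau> x))"
    and smooth_act: "\<And>\<tau>. smooth_map X (gmfd K) \<tau> \<Longrightarrow> smooth_map X X (\<lambda>x. act (\<tau> x) x)"
    and act_closed: "\<And>a x. a \<in> carrier K \<Longrightarrow> x \<in> pts X \<Longrightarrow> act a x \<in> pts X"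
    and act_one: "\<And>x. x \<in> pts X \<Longrightarrow> act \<one> x = x"
    and act_mult: "\<And>a b x. a \<in> carrier K \<Longrightarrow> b \<in> carrier K \<Longrightarrow> x \<in> pts X \<Longrightarrow>
          act (a \<otimes> b) x = act a (act b x)"
    and proj_act: "\<And>a x. a \<in> carrier K \<Longrightarrow> x \<in> pts X \<Longrightarrow> \<pi> (act a x) = \<pi> x"
    and free: "\<And>a x. a \<in> carrier K \<Longrightarrow> x \<in> pts X \<Longrightarrow> act a x = x \<Longrightarrow> a = \<one>"
    and division: "\<And>f. smooth_map X X f \<Longrightarrow> \<forall>x\<in>pts X. \<pi> (f x) = \<pi> x \<Longrightarrow>
          \<exists>\<tau>. smooth_map X (gmfd K) \<tau> \<and> (\<forall>x\<in>pts X. f x = act (\<tau> x) x)"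
begin

lemma act_cancel:
  assumes "a \<in> carrier K" "b \<in> carrier K" "x \<in> pts X" "act a x = act b x"
  shows "a = b"
proof -
  have "act (inv b \<otimes> a) x = x"
    using assms by (simp add: act_mult act_closed) (simp flip: act_mult add: act_one)
  then have "inv b \<otimes> a = \<one>" using free assms by simp
  then have "b \<otimes> (inv b \<otimes> a) = b" using assms by simp
  then show ?thesis using assms by (simp flip: m_assoc)
qed

lemma smooth_map_in_carrier: "smooth_map X (gmfd K) \<tau> \<Longrightarrow> x \<in> pts X \<Longrightarrow> \<tau> x \<in> carrier K"
  using smooth_map_in_pts[of X "gmfd K"] pts_K by simp

text \<open>Division applied to the identity map yields a smooth \<open>\<tau>\<close> with
  \<open>\<tau> x\<close> fixing \<open>x\<close>; by freeness it is constantly the unit.\<close>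

lemma smooth_one: "smooth_map X (gmfd K) (\<lambda>_. \<one>)"
proof -
  obtain \<tau> where \<tau>: "smooth_map X (gmfd K) \<tau>" "\<forall>x\<in>pts X. x = act (\<tau> x) x"
    using division[OF smooth_id] by auto
  have "\<tau> x = \<one>" if "x \<in> pts X" for x
    using \<tau> that smooth_map_in_carrier free by metis
  then show ?thesis by (rule smooth_map_cong[OF charted_X charted_K \<tau>(1)])
qed

abbreviation "Eq \<equiv> equivariant_maps K X act"
abbreviation "Gauge \<equiv> gauge_group K X \<pi> act"

lemma EqI:
  assumes "smooth_map X (gmfd K) \<tau>"
    "\<And>a x. a \<in> carrier K \<Longrightarrow> x \<in> pts X \<Longrightarrow> \<tau> (act a x) = a \<otimes> \<tau> x \<otimes> inv a"
  shows "(\<lambda>x\<in>pts X. \<tau> x) \<in> carrier Eq"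
  using smooth_map_cong[OF charted_X charted_K assms(1), of "\<lambda>x\<in>pts X. \<tau> x"] assms(2)
  by (simp add: equivariant_maps_def act_closed)

lemma EqD:
  assumes "\<tau> \<in> carrier Eq"
  shows "smooth_map X (gmfd K) \<tau>" "\<tau> \<in> extensional (pts X)"
    "\<And>a x. a \<in> carrier K \<Longrightarrow> x \<in> pts X \<Longrightarrow> \<tau> (act a x) = a \<otimes> \<tau> x \<otimes> inv a"
    "\<And>x. x \<in> pts X \<Longrightarrow> \<tau> x \<in> carrier K"
  using assms smooth_map_in_carrier[of \<tau>] by (auto simp: equivariant_maps_def)

lemma group_equivariant_maps: "group Eq"
proof (rule groupI)
  have one: "\<one>\<^bsub>Eq\<^esub> = (\<lambda>x\<in>pts X. \<one>)" by (simp add: equivariant_maps_def)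
  have mult: "\<sigma> \<otimes>\<^bsub>Eq\<^esub> \<tau> = (\<lambda>x\<in>pts X. \<sigma> x \<otimes> \<tau> x)" for \<sigma> \<tau> by (simp add: equivariant_maps_def)
  show "\<one>\<^bsub>Eq\<^esub> \<in> carrier Eq" unfolding one by (rule EqI[OF smooth_one]) simp
  show "\<sigma> \<otimes>\<^bsub>Eq\<^esub> \<tau> \<in> carrier Eq" if "\<sigma> \<in> carrier Eq" "\<tau> \<in> carrier Eq" for \<sigma> \<tau>
    unfolding mult
  proof (rule EqI[OF smooth_mult[OF EqD(1)[OF that(1)] EqD(1)[OF that(2)]]])
    fix a x assume "a \<in> carrier K" "x \<in> pts X"
    then show "\<sigma> (act a x) \<otimes> \<tau> (act a x) = a \<otimes> (\<sigma> x \<otimes> \<tau> x) \<otimes> inv a"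
      using EqD(3,4)[OF that(1)] EqD(3,4)[OF that(2)] by (simp add: m_assoc inv_mult_cancel)
  qed
  show "\<rho> \<otimes>\<^bsub>Eq\<^esub> \<sigma> \<otimes>\<^bsub>Eq\<^esub> \<tau> = \<rho> \<otimes>\<^bsub>Eq\<^esub> (\<sigma> \<otimes>\<^bsub>Eq\<^esub> \<tau>)"
    if "\<rho> \<in> carrier Eq" "\<sigma> \<in> carrier Eq" "\<tau> \<in> carrier Eq" for \<rho> \<sigma> \<tau>
    unfolding mult using that by (intro restrict_ext) (simp add: EqD(4) m_assoc)
  show "\<one>\<^bsub>Eq\<^esub> \<otimes>\<^bsub>Eq\<^esub> \<tau> = \<tau>" if "\<tau> \<in> carrier Eq" for \<tau>
    unfolding mult one using EqD(2,4)[OF that] by (intro extensionalityI[of _ "pts X"]) auto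
  show "\<exists>\<sigma>\<in>carrier Eq. \<sigma> \<otimes>\<^bsub>Eq\<^esub> \<tau> = \<one>\<^bsub>Eq\<^esub>" if \<tau>: "\<tau> \<in> carrier Eq" for \<tau>
  proof
    show "(\<lambda>x\<in>pts X. inv (\<tau> x)) \<in> carrier Eq"
      by (rule EqI[OF smooth_inv[OF EqD(1)[OF \<tau>]]])
        (simp add: EqD(3,4)[OF \<tau>] inv_mult_group m_assoc)
    show "(\<lambda>x\<in>pts X. inv (\<tau> x)) \<otimes>\<^bsub>Eq\<^esub> \<tau> = \<one>\<^bsub>Eq\<^esub>"
      unfolding mult one using EqD(4)[OF \<tau>] by (intro restrict_ext) simp
  qed
qed

text \<open>Conjugation equivariance says that the inverse of \<open>\<tau> (act a x)\<close>,
  multiplied by \<open>a\<close> on the right, equals \<open>a \<otimes> inv (\<tau> x)\<close>.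
  Acting on \<open>x\<close> with both sides gives equivariance of the gauge map.\<close>

lemma gauge_of_map_in_Gauge:
  assumes \<tau>: "\<tau> \<in> carrier Eq"
  shows "gauge_of_map K X act \<tau> \<in> carrier Gauge"
proof -
  have "smooth_map X X (gauge_of_map K X act \<tau>)"
    by (rule smooth_map_cong[OF charted_X charted_X smooth_act[OF smooth_inv[OF EqD(1)[OF \<tau>]]]])
      (simp add: gauge_of_map_def)
  moreover have "gauge_of_map K X act \<tau> (act a x) = act a (gauge_of_map K X act \<tau> x)"
    if "a \<in> carrier K" "x \<in> pts X" for a x
    using that EqD(3,4)[OF \<tau>]
    by (simp add: gauge_of_map_def act_closed inv_mult_group m_assoc flip: act_mult)
  ultimately show ?thesis
    using EqD(4)[OF \<tau>] by (simp add: gauge_group_def proj_act) (simp add: gauge_of_map_def proj_act)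
qed

lemma gauge_of_map_surj:
  assumes f: "f \<in> carrier Gauge"
  obtains \<tau> where "\<tau> \<in> carrier Eq" "f = gauge_of_map K X act \<tau>"
proof -
  have fs: "smooth_map X X f" "\<forall>x\<in>pts X. \<pi> (f x) = \<pi> x" "f \<in> extensional (pts X)"
    and feq: "\<And>a x. a \<in> carrier K \<Longrightarrow> x \<in> pts X \<Longrightarrow> f (act a x) = act a (f x)"
    using f by (auto simp: gauge_group_def)
  obtain \<sigma> where \<sigma>: "smooth_map X (gmfd K) \<sigma>" "\<forall>x\<in>pts X. f x = act (\<sigma> x) x"
    using division[OF fs(1,2)] by auto
  note \<sigma>K = smooth_map_in_carrier[OF \<sigma>(1)]
  have \<sigma>eq: "\<sigma> (act a x) = a \<otimes> \<sigma> x \<otimes> inv a" if "a \<in> carrier K" "x \<in> pts X" for a x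
  proof -
    \<comment> \<open>Both sides are \<open>f (act a x)\<close>: the left by the defining property
      of \<open>\<sigma>\<close> at \<open>act a x\<close>, the right by equivariance of
      \<open>f\<close>. Freeness then removes \<open>x\<close>.\<close>
    have "act (\<sigma> (act a x) \<otimes> a) x = act (a \<otimes> \<sigma> x) x"
      using feq[OF that] \<sigma>(2) that by (simp add: act_closed act_mult \<sigma>K)
    then have "\<sigma> (act a x) \<otimes> a = a \<otimes> \<sigma> x"
      using that by (intro act_cancel[of _ _ x]) (simp_all add: act_closed \<sigma>K)
    then have "\<sigma> (act a x) \<otimes> a \<otimes> inv a = a \<otimes> \<sigma> x \<otimes> inv a" by simp
    then show ?thesis using that by (simp add: m_assoc act_closed \<sigma>K)
  qed
  show ?thesis
  proof
    show "(\<lambda>x\<in>pts X. inv (\<sigma> x)) \<in> carrier Eq"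
      by (rule EqI[OF smooth_inv[OF \<sigma>(1)]]) (simp add: \<sigma>eq \<sigma>K inv_mult_group m_assoc)
    show "f = gauge_of_map K X act (\<lambda>x\<in>pts X. inv (\<sigma> x))"
      using fs(3) \<sigma>(2) \<sigma>K by (intro extensionalityI[of _ "pts X"]) (auto simp: gauge_of_map_def)
  qed
qed

text \<open>The gauge map of \<open>\<sigma>\<close> commutes with the action of
  \<open>inv (\<tau> x)\<close>, so the composite sends \<open>x\<close> to its translate by
  \<open>inv (\<tau> x) \<otimes> inv (\<sigma> x)\<close>, which is the inverse of
  \<open>\<sigma> x \<otimes> \<tau> x\<close>.\<close>

lemma gauge_of_map_hom: "gauge_of_map K X act \<in> hom Eq Gauge"
proof (rule homI[OF gauge_of_map_in_Gauge])
  fix \<sigma> \<tau> assume \<sigma>: "\<sigma> \<in> carrier Eq" and \<tau>: "\<tau> \<in> carrier Eq"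
  have "gauge_of_map K X act (\<sigma> \<otimes>\<^bsub>Eq\<^esub> \<tau>) x =
      compose (pts X) (gauge_of_map K X act \<sigma>) (gauge_of_map K X act \<tau>) x" if x: "x \<in> pts X" for x
  proof -
    have "gauge_of_map K X act \<sigma> (act (inv (\<tau> x)) x) = act (inv (\<tau> x)) (gauge_of_map K X act \<sigma> x)"
      using gauge_of_map_in_Gauge[OF \<sigma>] EqD(4)[OF \<tau> x] x by (simp add: gauge_group_def)
    then show ?thesis
      using x EqD(4)[OF \<tau> x] EqD(4)[OF \<sigma> x]
      by (simp add: equivariant_maps_def gauge_of_map_def compose_def inv_mult_group act_mult act_closed)
  qed
  then show "gauge_of_map K X act (\<sigma> \<otimes>\<^bsub>Eq\<^esub> \<tau>) = gauge_of_map K X act \<sigma> \<otimes>\<^bsub>Gauge\<^esub> gauge_of_map K X act \<tau>"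
    unfolding gauge_group_def monoid.simps
    by (intro extensionalityI[of _ "pts X"]) (auto simp: gauge_of_map_def)
qed

lemma gauge_of_map_inj: "inj_on (gauge_of_map K X act) (carrier Eq)"
proof (rule inj_onI)
  fix \<sigma> \<tau> assume \<sigma>: "\<sigma> \<in> carrier Eq" and \<tau>: "\<tau> \<in> carrier Eq"
    and eq: "gauge_of_map K X act \<sigma> = gauge_of_map K X act \<tau>"
  have "\<sigma> x = \<tau> x" if x: "x \<in> pts X" for x
  proof -
    have "act (inv (\<sigma> x)) x = act (inv (\<tau> x)) x"
      using fun_cong[OF eq, of x] x by (simp add: gauge_of_map_def)
    then have "inv (\<sigma> x) = inv (\<tau> x)"
      using x EqD(4)[OF \<sigma> x] EqD(4)[OF \<tau> x] by (intro act_cancel[of _ _ x]) auto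
    then show ?thesis using EqD(4)[OF \<sigma> x] EqD(4)[OF \<tau> x] inv_inv by metis
  qed
  then show "\<sigma> = \<tau>" using EqD(2)[OF \<sigma>] EqD(2)[OF \<tau>] by (intro extensionalityI[of _ "pts X"])
qed

lemma gauge_of_map_iso: "gauge_of_map K X act \<in> iso Eq Gauge"
proof (rule isoI[OF gauge_of_map_hom])
  have "carrier Gauge \<subseteq> gauge_of_map K X act ` carrier Eq"
  proof
    fix f assume "f \<in> carrier Gauge"
    then show "f \<in> gauge_of_map K X act ` carrier Eq"
      by (rule gauge_of_map_surj) (rule image_eqI)
  qed
  then have "gauge_of_map K X act ` carrier Eq = carrier Gauge"
    using gauge_of_map_in_Gauge by (intro equalityI image_subsetI)
  then show "bij_betw (gauge_of_map K X act) (carrier Eq) (carrier Gauge)"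
    using gauge_of_map_inj by (simp add: bij_betw_def)
qed

text \<open>An image of a group under a homomorphism is a group. Since \<open>gauge_of_map\<close>
  is onto and sends unit to unit, the record update in the image group changes nothing, and that
  group is \<open>Gauge\<close> itself.\<close>

lemma group_gauge_group: "group Gauge"
proof -
  interpret Eq: group Eq by (rule group_equivariant_maps)
  have img: "gauge_of_map K X act ` carrier Eq = carrier Gauge"
    using gauge_of_map_iso by (simp add: iso_def bij_betw_def)
  have one: "gauge_of_map K X act \<one>\<^bsub>Eq\<^esub> = \<one>\<^bsub>Gauge\<^esub>"
    unfolding gauge_of_map_def by (simp add: equivariant_maps_def gauge_group_def act_one cong: restrict_cong)
  have "group (Gauge\<lparr>carrier := gauge_of_map K X act ` carrier Eq, one := gauge_of_map K X act \<one>\<^bsub>Eq\<^esub>\<rparr>)"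
    by (rule Eq.hom_imp_img_group[OF gauge_of_map_hom])
  then show ?thesis by (simp add: img one)
qed

end

section \<open>Principal bundles\<close>

lemma lie_groupD:
  assumes "is_lie_group G"
  shows "group G" "pts (gmfd G) = carrier G" "charted (gmfd G)" "smooth_map (gmfd G) (gmfd G) (\<lambda>x. x)"
  using assms smooth_manifold_imp_charted smooth_map_id by (auto simp: is_lie_group_def)

lemma lie_group_smooth_mult:
  assumes G: "is_lie_group G" and X: "charted X"
    and u: "smooth_map X (gmfd G) u" and v: "smooth_map X (gmfd G) v"
  shows "smooth_map X (gmfd G) (\<lambda>x. u x \<otimes>\<^bsub>G\<^esub> v x)"
proof -
  note charted = lie_groupD(3)[OF G]
  have "smooth_map (prod_manifold (gmfd G) (gmfd G)) (gmfd G) (\<lambda>(a, b). a \<otimes>\<^bsub>G\<^esub> b)"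
    using G by (simp add: is_lie_group_def)
  from smooth_map_compose[OF X charted_prod_manifold[OF charted charted] charted
      smooth_map_Pair[OF X charted charted u v] this]
  show ?thesis by simp
qed

lemma lie_group_smooth_inv:
  assumes G: "is_lie_group G" and X: "charted X" and u: "smooth_map X (gmfd G) u"
  shows "smooth_map X (gmfd G) (\<lambda>x. inv\<^bsub>G\<^esub> (u x))"
  using G smooth_map_compose[OF X lie_groupD(3)[OF G] lie_groupD(3)[OF G] u, of "\<lambda>a. inv\<^bsub>G\<^esub> a"]
  by (simp add: is_lie_group_def)

lemma local_trivializationD:
  assumes "local_trivialization G P M \<pi> act U \<Phi>"
  shows "openin (mtop M) U"
    and "smooth_map (open_submanifold P {p\<in>pts P. \<pi> p \<in> U}) (prod_manifold (open_submanifold M U) (gmfd G)) \<Phi>"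
    and "inj_on \<Phi> {p\<in>pts P. \<pi> p \<in> U}"
    and "\<And>p. p \<in> pts P \<Longrightarrow> \<pi> p \<in> U \<Longrightarrow> fst (\<Phi> p) = \<pi> p"
    and "\<And>p. p \<in> pts P \<Longrightarrow> \<pi> p \<in> U \<Longrightarrow> snd (\<Phi> p) \<in> pts (gmfd G)"
    and "\<And>p g. p \<in> pts P \<Longrightarrow> \<pi> p \<in> U \<Longrightarrow> g \<in> carrier G \<Longrightarrow> \<Phi> (act g p) = (\<pi> p, g \<otimes>\<^bsub>G\<^esub> snd (\<Phi> p))"
proof -
  let ?S = "{p\<in>pts P. \<pi> p \<in> U}"
  have *: "bij_betw \<Phi> (pts P \<inter> ?S) ((pts M \<inter> U) \<times> pts (gmfd G))"
    using assms by (simp add: local_trivialization_def diffeomorphism_def pts_open_submanifold pts_prod_manifold)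
  moreover have PS: "pts P \<inter> ?S = ?S" by auto
  ultimately show "inj_on \<Phi> ?S" by (simp add: bij_betw_def)
  show "snd (\<Phi> p) \<in> pts (gmfd G)" if "p \<in> pts P" "\<pi> p \<in> U" for p
  proof -
    have "\<Phi> p \<in> (pts M \<inter> U) \<times> pts (gmfd G)" using that bij_betwE[OF *] by auto
    then show ?thesis by auto
  qed
qed (use assms in \<open>auto simp: local_trivialization_def diffeomorphism_def\<close>)

locale principal_G_bundle =
  fixes G :: "'g lie_group" (structure) and P :: "'p manifold" and M :: "'m manifold"
    and \<pi> :: "'p \<Rightarrow> 'm" and act :: "'g \<Rightarrow> 'p \<Rightarrow> 'p"
  assumes principal: "principal_bundle G P M \<pi> act"
begin

lemma lie: "is_lie_group G"
  using principal by (simp add: principal_bundle_def)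

lemmas pts_G = lie_groupD(2)[OF lie] and charted_G = lie_groupD(3)[OF lie]

lemma charted_P: "charted P" and charted_M: "charted M" and smooth_id_P: "smooth_map P P (\<lambda>x. x)"
  using principal smooth_manifold_imp_charted smooth_map_id by (auto simp: principal_bundle_def)

lemma smooth_proj: "smooth_map P M \<pi>"
  using principal by (simp add: principal_bundle_def)

sublocale group G by (rule lie_groupD(1)[OF lie])

sublocale group_action G "pts P" act
  using principal by (simp add: principal_bundle_def)

lemma P_act_closed: "a \<in> carrier G \<Longrightarrow> p \<in> pts P \<Longrightarrow> act a p \<in> pts P"
  by (rule element_image) auto

lemma P_act_one: "p \<in> pts P \<Longrightarrow> act \<one> p = p"
  using id_eq_one by (metis restrict_apply')

lemma P_act_mult: "a \<in> carrier G \<Longrightarrow> b \<in> carrier G \<Longrightarrow> p \<in> pts P \<Longrightarrow> act (a \<otimes> b) p = act a (act b p)"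
  using composition_rule by blast

lemma P_proj_act: "a \<in> carrier G \<Longrightarrow> p \<in> pts P \<Longrightarrow> \<pi> (act a p) = \<pi> p"
  using principal by (simp add: principal_bundle_def)

lemma obtain_trivialization:
  assumes "p \<in> pts P"
  obtains U \<Phi> where "\<pi> p \<in> U" "local_trivialization G P M \<pi> act U \<Phi>"
proof -
  have "\<pi> p \<in> pts M" using smooth_map_in_pts[OF smooth_proj assms] .
  then show ?thesis using principal that unfolding principal_bundle_def by blast
qed

text \<open>In a trivialization \<open>a\<close> multiplies the fibre coordinate from the left; a
  fixed point therefore yields \<open>a \<otimes> s = s\<close> in the group.\<close>

lemma P_free:
  assumes "a \<in> carrier G" "p \<in> pts P" "act a p = p"
  shows "a = \<one>"
proof -
  obtain U \<Phi> where U: "\<pi> p \<in> U" and triv: "local_trivialization G P M \<pi> act U \<Phi>"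
    using obtain_trivialization[OF assms(2)] .
  have s: "snd (\<Phi> p) \<in> carrier G" using local_trivializationD(5)[OF triv assms(2) U] pts_G by simp
  have "a \<otimes> snd (\<Phi> p) = snd (\<Phi> p)"
    using local_trivializationD(6)[OF triv assms(2) U assms(1)] assms(3) by (metis snd_conv)
  then show ?thesis using s assms(1) by (metis l_one one_closed right_cancel)
qed

lemma P_act_cancel:
  assumes "a \<in> carrier G" "b \<in> carrier G" "p \<in> pts P" "act a p = act b p"
  shows "a = b"
proof -
  have "act (inv b \<otimes> a) p = p"
    using assms by (simp add: P_act_mult P_act_closed) (simp flip: P_act_mult add: P_act_one)
  then have "inv b \<otimes> a = \<one>" using P_free assms by simp
  then have "b \<otimes> (inv b \<otimes> a) = b" using assms by simp
  then show ?thesis using assms by (simp flip: m_assoc)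
qed

lemma P_smooth_act:
  assumes X: "charted X" and \<tau>: "smooth_map X (gmfd G) \<tau>" and f: "smooth_map X P f"
  shows "smooth_map X P (\<lambda>x. act (\<tau> x) (f x))"
proof -
  have "smooth_map (prod_manifold (gmfd G) P) P (\<lambda>(g, p). act g p)"
    using principal by (simp add: principal_bundle_def)
  from smooth_map_compose[OF X charted_prod_manifold[OF charted_G charted_P] charted_P
      smooth_map_Pair[OF X charted_G charted_P \<tau> f] this]
  show ?thesis by simp
qed

text \<open>The trivialization is smooth only on the open submanifold over \<open>U\<close>. Stating
  the result at a point of \<open>P\<close> discards that restriction.\<close>

lemma trivialization_fibre_smooth:
  assumes triv: "local_trivialization G P M \<pi> act U \<Phi>" and p: "p \<in> pts P" "\<pi> p \<in> U"
  shows "smooth_at P (gmfd G) (\<lambda>p. snd (\<Phi> p)) p"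
proof -
  let ?S = "{p\<in>pts P. \<pi> p \<in> U}"
  have "continuous_map (mtop P) (mtop M) \<pi>" using smooth_proj by (simp add: smooth_map_def)
  then have S: "openin (mtop P) ?S"
    using openin_continuous_map_preimage local_trivializationD(1)[OF triv] unfolding pts_def by blast
  note cS = charted_open_submanifold[OF charted_P S]
    and cU = charted_open_submanifold[OF charted_M local_trivializationD(1)[OF triv]]
  have "smooth_map (open_submanifold P ?S) (gmfd G) (\<lambda>p. snd (\<Phi> p))"
    by (rule smooth_map_compose[OF cS charted_prod_manifold[OF cU charted_G] charted_G
          local_trivializationD(2)[OF triv] smooth_map_snd[OF cU charted_G lie_groupD(4)[OF lie]]])
  then have "smooth_at (open_submanifold P ?S) (gmfd G) (\<lambda>p. snd (\<Phi> p)) p"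
    using p unfolding smooth_map_iff_smooth_at[OF cS charted_G] pts_open_submanifold by blast
  then show ?thesis using smooth_at_open_submanifold[OF charted_P S, of p] p by blast
qed

text \<open>In a local trivialization the group element translating \<open>v x\<close> to \<open>u x\<close> is the quotient of the
  fibre coordinates, hence it depends smoothly on \<open>x\<close>.\<close>

lemma division_smooth:
  assumes X: "charted X" and u: "smooth_map X P u" and v: "smooth_map X P v"
    and uv: "\<And>x. x \<in> pts X \<Longrightarrow> \<pi> (u x) = \<pi> (v x)"
  obtains \<tau> where "smooth_map X (gmfd G) \<tau>" "\<And>x. x \<in> pts X \<Longrightarrow> u x = act (\<tau> x) (v x)"
proof -
  note uP = smooth_map_in_pts[OF u] and vP = smooth_map_in_pts[OF v]
  \<comment> \<open>With fibre coordinates \<open>?a\<close> of \<open>u x\<close> and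
    \<open>?b\<close> of \<open>v x\<close>, left multiplication by
    \<open>?a \<otimes> inv ?b\<close> carries \<open>?b\<close> to \<open>?a\<close>. The base
    points agree, so injectivity of the trivialization identifies the translated \<open>v x\<close>
    with \<open>u x\<close>.\<close>
  have quotient: "snd (\<Phi> (u x)) \<otimes> inv (snd (\<Phi> (v x))) \<in> carrier G \<and>
      u x = act (snd (\<Phi> (u x)) \<otimes> inv (snd (\<Phi> (v x)))) (v x)"
    if triv: "local_trivialization G P M \<pi> act U \<Phi>" and x: "x \<in> pts X" "\<pi> (v x) \<in> U" for U \<Phi> x
  proof -
    let ?a = "snd (\<Phi> (u x))" and ?b = "snd (\<Phi> (v x))"
    have ux: "\<pi> (u x) \<in> U" using uv[OF x(1)] x(2) by simp
    have ab: "?a \<in> carrier G" "?b \<in> carrier G"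
      using local_trivializationD(5)[OF triv uP[OF x(1)] ux] local_trivializationD(5)[OF triv vP[OF x(1)] x(2)]
        pts_G by auto
    have "\<Phi> (act (?a \<otimes> inv ?b) (v x)) = (\<pi> (v x), ?a)"
      using local_trivializationD(6)[OF triv vP[OF x(1)] x(2), of "?a \<otimes> inv ?b"] ab by (simp add: m_assoc)
    also have "\<dots> = \<Phi> (u x)"
      using local_trivializationD(4)[OF triv uP[OF x(1)] ux] uv[OF x(1)] by (metis prod.collapse)
    finally have "act (?a \<otimes> inv ?b) (v x) = u x"
      using inj_onD[OF local_trivializationD(3)[OF triv], of "act (?a \<otimes> inv ?b) (v x)" "u x"]
        uP[OF x(1)] vP[OF x(1)] ux x(2) ab by (simp add: P_act_closed P_proj_act)
    then show ?thesis using ab by simp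
  qed
  \<comment> \<open>The choice is made globally and without reference to a trivialization.
    Smoothness is recovered afterwards, since freeness forces \<open>\<tau>\<close> to agree with
    the quotient of fibre coordinates in every trivialization.\<close>
  define \<tau> where "\<tau> x = (SOME g. g \<in> carrier G \<and> u x = act g (v x))" for x
  have \<tau>: "\<tau> x \<in> carrier G \<and> u x = act (\<tau> x) (v x)" if x: "x \<in> pts X" for x
  proof -
    obtain U \<Phi> where "\<pi> (v x) \<in> U" "local_trivialization G P M \<pi> act U \<Phi>"
      using obtain_trivialization[OF vP[OF x]] .
    from quotient[OF this(2) x this(1)] show ?thesis unfolding \<tau>_def by (rule someI)
  qed
  have "smooth_at X (gmfd G) \<tau> x" if x: "x \<in> pts X" for x
  proof -
    obtain U \<Phi> where U: "\<pi> (v x) \<in> U" and triv: "local_trivialization G P M \<pi> act U \<Phi>"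
      using obtain_trivialization[OF vP[OF x]] .
    define S where "S = {y \<in> pts X. \<pi> (v y) \<in> U}"
    have "continuous_map (mtop X) (mtop M) (\<lambda>y. \<pi> (v y))"
      using smooth_map_compose[OF X charted_P charted_M v smooth_proj] by (simp add: smooth_map_def)
    from openin_continuous_map_preimage[OF this local_trivializationD(1)[OF triv]]
    have S: "openin (mtop X) S" by (simp add: S_def pts_def)
    have xS: "x \<in> S" using x U by (simp add: S_def)
    note cS = charted_open_submanifold[OF X S]
    have coord: "smooth_map (open_submanifold X S) (gmfd G) (\<lambda>y. snd (\<Phi> (w y)))"
      if w: "smooth_map X P w" and wS: "\<And>y. y \<in> S \<Longrightarrow> \<pi> (w y) \<in> U" for w
      unfolding smooth_map_iff_smooth_at[OF cS charted_G]
    proof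
      fix y assume "y \<in> pts (open_submanifold X S)"
      then have y: "y \<in> pts X" "y \<in> S" by (auto simp: pts_open_submanifold)
      have "smooth_at X P w y" using w y by (simp add: smooth_map_iff_smooth_at X charted_P)
      then have "smooth_at X (gmfd G) (\<lambda>y. snd (\<Phi> (w y))) y"
        by (rule smooth_at_compose[OF X charted_P])
          (rule trivialization_fibre_smooth[OF triv smooth_map_in_pts[OF w y(1)] wS[OF y(2)]])
      then show "smooth_at (open_submanifold X S) (gmfd G) (\<lambda>y. snd (\<Phi> (w y))) y"
        unfolding smooth_at_open_submanifold[OF X S y(2)] .
    qed
    have "smooth_map (open_submanifold X S) (gmfd G) (\<lambda>y. snd (\<Phi> (u y)) \<otimes> inv (snd (\<Phi> (v y))))"
      by (intro lie_group_smooth_mult[OF lie cS] lie_group_smooth_inv[OF lie cS] coord u v)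
        (auto simp: S_def uv)
    then have "smooth_at (open_submanifold X S) (gmfd G) (\<lambda>y. snd (\<Phi> (u y)) \<otimes> inv (snd (\<Phi> (v y)))) x"
      using x xS by (simp add: smooth_map_iff_smooth_at cS charted_G pts_open_submanifold)
    then have "smooth_at X (gmfd G) (\<lambda>y. snd (\<Phi> (u y)) \<otimes> inv (snd (\<Phi> (v y)))) x"
      unfolding smooth_at_open_submanifold[OF X S xS] .
    then show ?thesis
    proof (rule smooth_at_cong[OF X _ S xS])
      fix y assume "y \<in> S"
      then have y: "y \<in> pts X" "\<pi> (v y) \<in> U" by (auto simp: S_def)
      show "snd (\<Phi> (u y)) \<otimes> inv (snd (\<Phi> (v y))) = \<tau> y"
        using quotient[OF triv y] \<tau>[OF y(1)] vP[OF y(1)] by (intro P_act_cancel[of _ _ "v y"]) auto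
    qed
  qed
  then have "smooth_map X (gmfd G) \<tau>" by (simp add: smooth_map_iff_smooth_at X charted_G)
  then show ?thesis using that \<tau> by blast
qed

end

section \<open>The nerve\<close>

lemma carrier_nerve_group: "carrier (nerve_group k G) = (\<Pi>\<^sub>E i\<in>{..k}. carrier G)"
  and mult_nerve_group: "a \<otimes>\<^bsub>nerve_group k G\<^esub> b = (\<lambda>i\<in>{..k}. if i = 0 then a 0 \<otimes>\<^bsub>G\<^esub> b 0
      else a i \<otimes>\<^bsub>G\<^esub> (a 0 \<otimes>\<^bsub>G\<^esub> b i \<otimes>\<^bsub>G\<^esub> inv\<^bsub>G\<^esub> (a 0)))"
  and one_nerve_group: "\<one>\<^bsub>nerve_group k G\<^esub> = (\<lambda>i\<in>{..k}. \<one>\<^bsub>G\<^esub>)"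
  and gmfd_nerve_group: "gmfd (nerve_group k G) = power_manifold k (gmfd G)"
  by (simp_all add: nerve_group_def)

lemmas nerve_group_simps = carrier_nerve_group mult_nerve_group one_nerve_group gmfd_nerve_group

lemma nerve_group_memD: "a \<in> carrier (nerve_group k G) \<Longrightarrow> i \<le> k \<Longrightarrow> a i \<in> carrier G"
  by (auto simp: carrier_nerve_group)

lemma nerve_group_eqI:
  assumes "a \<in> carrier (nerve_group k G)" "b \<in> carrier (nerve_group k G)" "\<And>i. i \<le> k \<Longrightarrow> a i = b i"
  shows "a = b"
  using assms by (intro PiE_ext[of a "{..k}" "\<lambda>_. carrier G" b]) (auto simp: carrier_nerve_group)

text \<open>The semidirect product inverse of (h, g), with \<open>inv g\<close> in place 0 and the
  inverses of the h_i conjugated by \<open>inv g\<close>. An explicit formula lets smoothness of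
  inversion be checked by components.\<close>

definition nerve_inv :: "nat \<Rightarrow> 'g lie_group \<Rightarrow> (nat \<Rightarrow> 'g) \<Rightarrow> (nat \<Rightarrow> 'g)" where
  "nerve_inv k G a = (\<lambda>i\<in>{..k}. if i = 0 then inv\<^bsub>G\<^esub> (a 0)
      else inv\<^bsub>G\<^esub> (a 0) \<otimes>\<^bsub>G\<^esub> inv\<^bsub>G\<^esub> (a i) \<otimes>\<^bsub>G\<^esub> a 0)"

lemma nerve_inv:
  fixes G :: "'g lie_group"
  assumes G: "group G" and a: "a \<in> carrier (nerve_group k G)"
  shows "nerve_inv k G a \<in> carrier (nerve_group k G)"
    and "nerve_inv k G a \<otimes>\<^bsub>nerve_group k G\<^esub> a = \<one>\<^bsub>nerve_group k G\<^esub>"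
proof -
  interpret group G by (rule G)
  note mem = nerve_group_memD[OF a]
  show "nerve_inv k G a \<in> carrier (nerve_group k G)"
    by (auto simp: carrier_nerve_group nerve_inv_def mem)
  show "nerve_inv k G a \<otimes>\<^bsub>nerve_group k G\<^esub> a = \<one>\<^bsub>nerve_group k G\<^esub>"
    unfolding mult_nerve_group one_nerve_group
    by (rule restrict_ext) (simp add: nerve_inv_def mem m_assoc mult_inv_cancel inv_mult_cancel)
qed

lemma nerve_group_mult_closed:
  fixes G :: "'g lie_group"
  assumes G: "group G" and a: "a \<in> carrier (nerve_group k G)" and b: "b \<in> carrier (nerve_group k G)"
  shows "a \<otimes>\<^bsub>nerve_group k G\<^esub> b \<in> carrier (nerve_group k G)"
proof -
  interpret group G by (rule G)
  show ?thesis
    by (auto simp: nerve_group_simps nerve_group_memD[OF a] nerve_group_memD[OF b])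
qed

lemma group_nerve_group:
  fixes G :: "'g lie_group"
  assumes G: "group G"
  shows "group (nerve_group k G)"
proof (rule groupI)
  interpret group G by (rule G)
  let ?N = "nerve_group k G"
  note mem = nerve_group_memD[of _ k G] and closed = nerve_group_mult_closed[OF G, of _ k]
  show "a \<otimes>\<^bsub>?N\<^esub> b \<in> carrier ?N" if "a \<in> carrier ?N" "b \<in> carrier ?N" for a b
    using that by (rule closed)
  show one: "\<one>\<^bsub>?N\<^esub> \<in> carrier ?N" by (auto simp: nerve_group_simps)
  show "a \<otimes>\<^bsub>?N\<^esub> b \<otimes>\<^bsub>?N\<^esub> c = a \<otimes>\<^bsub>?N\<^esub> (b \<otimes>\<^bsub>?N\<^esub> c)"
    if a: "a \<in> carrier ?N" and b: "b \<in> carrier ?N" and c: "c \<in> carrier ?N" for a b c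
  proof (rule nerve_group_eqI[OF closed[OF closed[OF a b] c] closed[OF a closed[OF b c]]])
    fix i assume "i \<le> k"
    then show "(a \<otimes>\<^bsub>?N\<^esub> b \<otimes>\<^bsub>?N\<^esub> c) i = (a \<otimes>\<^bsub>?N\<^esub> (b \<otimes>\<^bsub>?N\<^esub> c)) i"
      by (simp add: mult_nerve_group mem[OF a] mem[OF b] mem[OF c] m_assoc inv_mult_group inv_mult_cancel)
  qed
  show "\<one>\<^bsub>?N\<^esub> \<otimes>\<^bsub>?N\<^esub> a = a" if a: "a \<in> carrier ?N" for a
  proof (rule nerve_group_eqI[OF closed[OF one a] a])
    fix i assume "i \<le> k"
    then show "(\<one>\<^bsub>?N\<^esub> \<otimes>\<^bsub>?N\<^esub> a) i = a i"
      by (simp add: mult_nerve_group one_nerve_group mem[OF a])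
  qed
  show "\<exists>b\<in>carrier ?N. b \<otimes>\<^bsub>?N\<^esub> a = \<one>\<^bsub>?N\<^esub>" if a: "a \<in> carrier ?N" for a
    using nerve_inv[OF G a] by blast
qed

lemma inv_nerve_group:
  fixes G :: "'g lie_group"
  assumes "group G" "a \<in> carrier (nerve_group k G)"
  shows "inv\<^bsub>nerve_group k G\<^esub> a = nerve_inv k G a"
  using assms nerve_inv[OF assms] by (intro group.inv_equality[OF group_nerve_group])

lemma smooth_map_component:
  assumes "charted X" "charted A" "smooth_map A A (\<lambda>x. x)" "smooth_map X (power_manifold k A) f" "i \<le> k"
  shows "smooth_map X A (\<lambda>x. f x i)"
  using smooth_map_compose[OF assms(1) charted_power_manifold[OF assms(2)] assms(2,4)
      smooth_map_power_projection[OF assms(2,3,5)]] .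

section \<open>Free smooth actions on the bundle and on its nerve\<close>

context principal_G_bundle
begin

lemma smooth_free_action_bundle: "smooth_free_action G P \<pi> act"
proof unfold_locales
  show "\<exists>\<tau>. smooth_map P (gmfd G) \<tau> \<and> (\<forall>x\<in>pts P. f x = act (\<tau> x) x)"
    if "smooth_map P P f" "\<forall>x\<in>pts P. \<pi> (f x) = \<pi> x" for f
    using division_smooth[OF charted_P that(1) smooth_id_P] that(2) by metis
qed (fact pts_G charted_G charted_P smooth_id_P lie_group_smooth_mult[OF lie charted_P]
      lie_group_smooth_inv[OF lie charted_P] P_smooth_act[OF charted_P _ smooth_id_P]
      P_act_closed P_act_one P_act_mult P_proj_act P_free)+

text \<open>Everything reduces to the action on \<open>P\<close>: a map into a power is smooth once
  its components are, and on component \<open>i\<close> the element \<open>a\<close> acts through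
  \<open>a 0\<close> if \<open>i = 0\<close> and through \<open>a i \<otimes> a 0\<close>
  otherwise.\<close>

lemma smooth_free_action_nerve:
  "smooth_free_action (nerve_group k G) (power_manifold k P) (nerve_proj k \<pi>) (nerve_action k G act)"
proof -
  let ?N = "nerve_group k G" and ?X = "power_manifold k P" and ?act = "nerve_action k G act"
  note cX = charted_power_manifold[OF charted_P, of k] and cN = charted_power_manifold[OF charted_G, of k]
    and idG = lie_groupD(4)[OF lie] and mem = nerve_group_memD[of _ k G]
  have ptsN: "pts (gmfd ?N) = carrier ?N" by (simp add: nerve_group_simps pts_power_manifold pts_G)
  have ptX: "x i \<in> pts P" if "x \<in> pts ?X" "i \<le> k" for x i
    using that by (auto simp: pts_power_manifold)
  have X_eqI: "x = y" if "x \<in> pts ?X" "y \<in> pts ?X" "\<And>i. i \<le> k \<Longrightarrow> x i = y i" for x y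
    using that by (intro PiE_ext[of x "{..k}" "\<lambda>_. pts P" y]) (auto simp: pts_power_manifold)
  have act_in: "?act a x \<in> pts ?X" if "a \<in> carrier ?N" "x \<in> pts ?X" for a x
    using that by (auto simp: nerve_action_def pts_power_manifold P_act_closed ptX mem)
  have comp: "smooth_map ?X (gmfd G) (\<lambda>x. \<tau> x i)" if "smooth_map ?X (gmfd ?N) \<tau>" "i \<le> k" for \<tau> i
    using that unfolding gmfd_nerve_group by (intro smooth_map_component[OF cX charted_G idG])
  note mult = lie_group_smooth_mult[OF lie cX] and inverse = lie_group_smooth_inv[OF lie cX]
    and proj = smooth_map_power_projection[OF charted_P smooth_id_P]
  interpret N: group ?N by (rule group_nerve_group) (rule is_group)
  show ?thesis
  proof unfold_locales
    show "pts (gmfd ?N) = carrier ?N" by (rule ptsN)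
    show "charted (gmfd ?N)" "charted ?X" using cN cX by (simp_all add: gmfd_nerve_group)
    have "smooth_map ?X ?X (\<lambda>x. \<lambda>i\<in>{..k}. x i)"
      by (rule smooth_map_tuple[OF cX charted_P proj])
    then show "smooth_map ?X ?X (\<lambda>x. x)"
    proof (rule smooth_map_cong[OF cX cX])
      show "(\<lambda>i\<in>{..k}. x i) = x" if "x \<in> pts ?X" for x
        using that by (auto simp: pts_power_manifold)
    qed
    show "smooth_map ?X (gmfd ?N) (\<lambda>x. \<sigma> x \<otimes>\<^bsub>?N\<^esub> \<tau> x)"
      if "smooth_map ?X (gmfd ?N) \<sigma>" "smooth_map ?X (gmfd ?N) \<tau>" for \<sigma> \<tau>
      unfolding mult_nerve_group gmfd_nerve_group
    proof (rule smooth_map_tuple[OF cX charted_G])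
      fix i assume "i \<le> k"
      then show "smooth_map ?X (gmfd G) (\<lambda>x. if i = 0 then \<sigma> x 0 \<otimes> \<tau> x 0
          else \<sigma> x i \<otimes> (\<sigma> x 0 \<otimes> \<tau> x i \<otimes> inv (\<sigma> x 0)))"
        by (cases "i = 0") (simp_all add: mult inverse comp that)
    qed
    show "smooth_map ?X (gmfd ?N) (\<lambda>x. inv\<^bsub>?N\<^esub> (\<tau> x))" if \<tau>: "smooth_map ?X (gmfd ?N) \<tau>" for \<tau>
    proof (rule smooth_map_cong[OF cX])
      show "charted (gmfd ?N)" using cN by (simp add: gmfd_nerve_group)
      show "smooth_map ?X (gmfd ?N) (\<lambda>x. nerve_inv k G (\<tau> x))"
        unfolding nerve_inv_def gmfd_nerve_group
      proof (rule smooth_map_tuple[OF cX charted_G])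
        fix i assume "i \<le> k"
        then show "smooth_map ?X (gmfd G) (\<lambda>x. if i = 0 then inv (\<tau> x 0)
            else inv (\<tau> x 0) \<otimes> inv (\<tau> x i) \<otimes> \<tau> x 0)"
          by (cases "i = 0") (simp_all add: mult inverse comp \<tau>)
      qed
      show "nerve_inv k G (\<tau> x) = inv\<^bsub>?N\<^esub> (\<tau> x)" if "x \<in> pts ?X" for x
        using smooth_map_in_pts[OF \<tau> that] ptsN by (simp add: inv_nerve_group is_group)
    qed
    show "smooth_map ?X ?X (\<lambda>x. ?act (\<tau> x) x)" if "smooth_map ?X (gmfd ?N) \<tau>" for \<tau>
      unfolding nerve_action_def
    proof (rule smooth_map_tuple[OF cX charted_P])
      fix i assume "i \<le> k"
      then show "smooth_map ?X P (\<lambda>x. if i = 0 then act (\<tau> x 0) (x 0) else act (\<tau> x i \<otimes> \<tau> x 0) (x i))"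
        by (cases "i = 0") (simp_all add: P_smooth_act[OF cX] mult comp that proj)
    qed
    show "?act a x \<in> pts ?X" if "a \<in> carrier ?N" "x \<in> pts ?X" for a x
      using that by (rule act_in)
    show "?act \<one>\<^bsub>?N\<^esub> x = x" if x: "x \<in> pts ?X" for x
    proof (rule X_eqI[OF act_in[OF N.one_closed x] x])
      show "?act \<one>\<^bsub>?N\<^esub> x i = x i" if "i \<le> k" for i
        using that ptX[OF x] by (simp add: nerve_action_def one_nerve_group P_act_one)
    qed
    show "?act (a \<otimes>\<^bsub>?N\<^esub> b) x = ?act a (?act b x)"
      if ab: "a \<in> carrier ?N" "b \<in> carrier ?N" and x: "x \<in> pts ?X" for a b x
    proof (rule X_eqI[OF act_in[OF N.m_closed[OF ab] x] act_in[OF ab(1) act_in[OF ab(2) x]]])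
      \<comment> \<open>For \<open>i > 0\<close> the conjugation by \<open>a 0\<close> inside the
        product cancels against the trailing \<open>a 0 \<otimes> b 0\<close>, leaving
        \<open>a i \<otimes> a 0 \<otimes> (b i \<otimes> b 0)\<close>.\<close>
      show "?act (a \<otimes>\<^bsub>?N\<^esub> b) x i = ?act a (?act b x) i" if "i \<le> k" for i
        using that ptX[OF x] mem[OF ab(1)] mem[OF ab(2)]
        by (simp add: nerve_action_def mult_nerve_group m_assoc inv_mult_cancel flip: P_act_mult)
    qed
    show "nerve_proj k \<pi> (?act a x) = nerve_proj k \<pi> x" if "a \<in> carrier ?N" "x \<in> pts ?X" for a x
      unfolding nerve_proj_def
      by (rule restrict_ext) (use that in \<open>simp add: nerve_action_def P_proj_act mem ptX\<close>)
    show "a = \<one>\<^bsub>?N\<^esub>" if a: "a \<in> carrier ?N" and x: "x \<in> pts ?X" and fixed: "?act a x = x" for a x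
    proof (rule nerve_group_eqI[OF a N.one_closed])
      \<comment> \<open>Component 0 comes first: the other components only show that
        \<open>a i \<otimes> a 0\<close> is the unit.\<close>
      have a0: "a 0 = \<one>"
        using fun_cong[OF fixed, of 0] mem[OF a] ptX[OF x] by (intro P_free[of _ "x 0"]) (auto simp: nerve_action_def)
      fix i assume i: "i \<le> k"
      have "a i \<otimes> a 0 = \<one>" if "i \<noteq> 0"
        using fun_cong[OF fixed, of i] that i mem[OF a] ptX[OF x]
        by (intro P_free[of _ "x i"]) (auto simp: nerve_action_def)
      then show "a i = \<one>\<^bsub>?N\<^esub> i" using a0 i mem[OF a i] by (cases "i = 0") (auto simp: one_nerve_group)
    qed
    show "\<exists>\<tau>. smooth_map ?X (gmfd ?N) \<tau> \<and> (\<forall>x\<in>pts ?X. f x = ?act (\<tau> x) x)"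
      if f: "smooth_map ?X ?X f" and cover: "\<forall>x\<in>pts ?X. nerve_proj k \<pi> (f x) = nerve_proj k \<pi> x" for f
    proof -
      have "\<exists>d. smooth_map ?X (gmfd G) d \<and> (\<forall>x\<in>pts ?X. f x i = act (d x) (x i))" if i: "i \<le> k" for i
      proof -
        have "\<pi> (f x i) = \<pi> (x i)" if "x \<in> pts ?X" for x
          using fun_cong[OF bspec[OF cover that], of i] i by (simp add: nerve_proj_def)
        then show ?thesis
          using division_smooth[OF cX smooth_map_component[OF cX charted_P smooth_id_P f i] proj[OF i]] by metis
      qed
      then obtain d where d: "\<And>i. i \<le> k \<Longrightarrow> smooth_map ?X (gmfd G) (d i)"
        "\<And>i x. i \<le> k \<Longrightarrow> x \<in> pts ?X \<Longrightarrow> f x i = act (d i x) (x i)" by metis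
      \<comment> \<open>The factor \<open>inv (d 0 x)\<close> compensates for the \<open>a 0\<close>
        that the action multiplies onto every later component.\<close>
      define \<tau> where "\<tau> x = (\<lambda>i\<in>{..k}. if i = 0 then d 0 x else d i x \<otimes> inv (d 0 x))" for x
      have \<tau>: "smooth_map ?X (gmfd ?N) \<tau>"
        unfolding \<tau>_def gmfd_nerve_group
      proof (rule smooth_map_tuple[OF cX charted_G])
        fix i assume "i \<le> k"
        then show "smooth_map ?X (gmfd G) (\<lambda>x. if i = 0 then d 0 x else d i x \<otimes> inv (d 0 x))"
          by (cases "i = 0") (simp_all add: mult inverse d)
      qed
      have "f x = ?act (\<tau> x) x" if x: "x \<in> pts ?X" for x
      proof (rule X_eqI[OF smooth_map_in_pts[OF f x] act_in[OF _ x]])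
        show "\<tau> x \<in> carrier ?N" using smooth_map_in_pts[OF \<tau> x] ptsN by simp
        have dG: "d i x \<in> carrier G" if "i \<le> k" for i
          using smooth_map_in_pts[OF d(1)[OF that] x] pts_G by simp
        show "f x i = ?act (\<tau> x) x i" if "i \<le> k" for i
          using that d(2)[OF that x] dG[OF that] dG[of 0] by (simp add: nerve_action_def \<tau>_def m_assoc)
      qed
      with \<tau> show ?thesis by blast
    qed
  qed
qed

section \<open>The canonical injections of gauge groups\<close>

abbreviation "AutP \<equiv> gauge_group G P \<pi> act"
abbreviation "AutP1 \<equiv> pair_groupoid_gauge_group G P \<pi> act"
abbreviation "AutN \<equiv> nerve_gauge_group G P \<pi> act"

lemma group_AutP: "group AutP"
  by (rule smooth_free_action.group_gauge_group[OF smooth_free_action_bundle])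

lemma group_AutN: "group (AutN k)"
  unfolding nerve_gauge_group_def
  by (rule smooth_free_action.group_gauge_group[OF smooth_free_action_nerve])

lemma AutPD:
  assumes "f \<in> carrier AutP"
  shows "f \<in> extensional (pts P)" "smooth_map P P f"
    and "\<And>a p. a \<in> carrier G \<Longrightarrow> p \<in> pts P \<Longrightarrow> f (act a p) = act a (f p)"
    and "\<And>p. p \<in> pts P \<Longrightarrow> \<pi> (f p) = \<pi> p" "\<And>p. p \<in> pts P \<Longrightarrow> f p \<in> pts P"
  using assms smooth_map_in_pts[of P P f] by (auto simp: gauge_group_def)

lemma hat_apply: "p \<in> pts P \<Longrightarrow> q \<in> pts P \<Longrightarrow> fst (hat P f) (p, q) = (f p, f q)"
  by (simp add: hat_def pts_prod_manifold)

lemma hat_in_AutP1: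
  assumes f: "f \<in> carrier AutP"
  shows "hat P f \<in> carrier AutP1"
proof -
  let ?PP = "prod_manifold P P"
  note cPP = charted_prod_manifold[OF charted_P charted_P] and fD = AutPD[OF f]
  have "smooth_map ?PP ?PP (\<lambda>x. (f (fst x), f (snd x)))"
    by (intro smooth_map_Pair cPP charted_P smooth_map_compose[OF cPP charted_P charted_P _ fD(2)]
        smooth_map_fst smooth_map_snd smooth_id_P)
  then have "smooth_map ?PP ?PP (fst (hat P f))"
    by (rule smooth_map_cong[OF cPP cPP]) (auto simp: pts_prod_manifold hat_apply)
  then have smooth: "smooth_map ?PP ?PP (\<lambda>(p, q)\<in>pts ?PP. (f p, f q))" by (simp add: hat_def)
  show ?thesis
    unfolding pair_groupoid_gauge_group_def Let_def lie_groupoid_morphism_def pair_groupoid_def hat_def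
    using smooth fD
    by (auto simp: pts_prod_manifold two_group_arrows_def arrow_action_def P_act_closed)
qed

text \<open>A morphism of pair groupoids is determined by its object map, because an arrow is determined by
  its source and target.\<close>

lemma AutP1_obtain_hat:
  assumes "F \<in> carrier AutP1"
  obtains f where "f \<in> carrier AutP" "F = hat P f"
proof -
  obtain F1 f where F: "F = (F1, f)" by (cases F)
  let ?PP = "prod_manifold P P"
  have F1: "F1 \<in> extensional (pts ?PP)" and f: "f \<in> carrier AutP"
    and st: "\<And>x. x \<in> pts ?PP \<Longrightarrow> snd (F1 x) = f (snd x) \<and> fst (F1 x) = f (fst x)"
    using assms unfolding F
    by (auto simp: pair_groupoid_gauge_group_def lie_groupoid_morphism_def pair_groupoid_def gauge_group_def)
  have "F1 = fst (hat P f)"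
  proof (rule extensionalityI[OF F1])
    show "fst (hat P f) \<in> extensional (pts ?PP)" by (simp add: hat_def)
    show "F1 x = fst (hat P f) x" if "x \<in> pts ?PP" for x
      using st[OF that] that by (auto simp: hat_def prod_eq_iff case_prod_beta)
  qed
  then have "F = hat P f" by (simp add: F hat_def)
  with f that show ?thesis by blast
qed

lemma hat_compose:
  assumes "f \<in> carrier AutP" "g \<in> carrier AutP"
  shows "hat P (f \<otimes>\<^bsub>AutP\<^esub> g) = hat P f \<otimes>\<^bsub>AutP1\<^esub> hat P g"
  using AutPD(5)[OF assms(2)]
  by (auto simp: hat_def gauge_group_def pair_groupoid_gauge_group_def pair_groupoid_def Let_def
      compose_def pts_prod_manifold restrict_def fun_eq_iff)

lemma hat_mon: "hat P \<in> mon AutP AutP1"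
proof -
  have "inj_on (hat P) (carrier AutP)" by (auto simp: inj_on_def hat_def)
  then show ?thesis using hat_in_AutP1 hat_compose by (simp add: mon_def homI)
qed

text \<open>By \<open>AutP1_obtain_hat\<close> the homomorphism \<open>hat P\<close> is onto, so
  \<open>AutP1\<close> is the image of the group \<open>AutP\<close>; inverses of groupoid
  automorphisms come from there.\<close>

lemma group_AutP1: "group AutP1"
proof -
  interpret A: group AutP by (rule group_AutP)
  have img: "hat P ` carrier AutP = carrier AutP1"
  proof
    show "hat P ` carrier AutP \<subseteq> carrier AutP1" using hat_in_AutP1 by blast
    show "carrier AutP1 \<subseteq> hat P ` carrier AutP"
      by (rule subsetI, erule AutP1_obtain_hat) (rule image_eqI)
  qed
  have one: "hat P \<one>\<^bsub>AutP\<^esub> = \<one>\<^bsub>AutP1\<^esub>"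
    by (auto simp: hat_def gauge_group_def pair_groupoid_gauge_group_def pair_groupoid_def Let_def
        pts_prod_manifold fun_eq_iff)
  have "group (AutP1\<lparr>carrier := hat P ` carrier AutP, one := hat P \<one>\<^bsub>AutP\<^esub>\<rparr>)"
    using hat_mon by (intro A.hom_imp_img_group) (simp add: mon_def)
  then show ?thesis by (simp add: img one)
qed

text \<open>Edge \<open>i\<close> is sent to the pair of images of its end points, and reading the
  vertices back takes vertex \<open>i\<close> from the target of edge \<open>i\<close> and vertex 0
  from the source of edge 1. At \<open>k = 0\<close> there are no edges and the object map is
  used.\<close>

lemma nerve_map_hat:
  "nerve_map P k (hat P f) = (\<lambda>x\<in>pts (power_manifold k P). \<lambda>i\<in>{..k}. f (x i))"
proof (cases "k = 0")
  case True
  then show ?thesis by (simp add: nerve_map_def hat_def)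
next
  case False
  have "nerve_vertices k (\<lambda>i\<in>{1..k}. fst (hat P f) (nerve_edges k x i)) = (\<lambda>i\<in>{..k}. f (x i))"
    if x: "x \<in> pts (power_manifold k P)" for x
  proof -
    have xP: "x i \<in> pts P" if "i \<le> k" for i using x that by (auto simp: pts_power_manifold)
    have e: "fst (hat P f) (nerve_edges k x i) = (f (x i), f (x (i - 1)))" if "i \<in> {1..k}" for i
    proof -
      have "x i \<in> pts P" "x (i - 1) \<in> pts P" using that by (auto intro: xP)
      then show ?thesis using that by (simp add: nerve_edges_def hat_apply)
    qed
    show ?thesis unfolding nerve_vertices_def
    proof (rule restrict_ext)
      fix i assume "i \<in> {..k}"
      then show "(if i = 0 then snd ((\<lambda>i\<in>{1..k}. fst (hat P f) (nerve_edges k x i)) 1)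
          else fst ((\<lambda>i\<in>{1..k}. fst (hat P f) (nerve_edges k x i)) i)) = f (x i)"
        \<comment> \<open>The instance at 1 serves vertex 0; edge 1 exists because \<open>k\<close>
          is not 0.\<close>
        using e[of i] e[of 1] False by (cases "i = 0") auto
    qed
  qed
  then show ?thesis using False by (simp add: nerve_map_def case_prod_beta cong: restrict_cong)
qed

text \<open>The group acts on each component through a single element of \<open>G\<close>, with
  which \<open>f\<close> commutes. The different elements used on different components therefore do
  not interfere.\<close>

lemma nerve_map_hat_in_AutN:
  assumes f: "f \<in> carrier AutP"
  shows "nerve_map P k (hat P f) \<in> carrier (AutN k)"
proof -
  let ?X = "power_manifold k P"
  note cX = charted_power_manifold[OF charted_P, of k] and fD = AutPD[OF f]
  have ptX: "x i \<in> pts P" if "x \<in> pts ?X" "i \<le> k" for x i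
    using that by (auto simp: pts_power_manifold)
  have "smooth_map ?X ?X (\<lambda>x. \<lambda>i\<in>{..k}. f (x i))"
    by (intro smooth_map_tuple[OF cX charted_P] smooth_map_compose[OF cX charted_P charted_P _ fD(2)]
        smooth_map_power_projection charted_P smooth_id_P)
  then have "smooth_map ?X ?X (nerve_map P k (hat P f))"
    by (rule smooth_map_cong[OF cX cX]) (simp add: nerve_map_hat)
  moreover have "nerve_map P k (hat P f) (nerve_action k G act a x) =
      nerve_action k G act a (nerve_map P k (hat P f) x)"
    if a: "a \<in> carrier (nerve_group k G)" and x: "x \<in> pts ?X" for a x
  proof -
    interpret N: smooth_free_action "nerve_group k G" ?X "nerve_proj k \<pi>" "nerve_action k G act"
      by (rule smooth_free_action_nerve)
    have "(\<lambda>i\<in>{..k}. f (nerve_action k G act a x i)) = nerve_action k G act a (\<lambda>i\<in>{..k}. f (x i))"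
      unfolding nerve_action_def
      by (rule restrict_ext) (use fD(3) ptX[OF x] nerve_group_memD[OF a] in simp)
    then show ?thesis using x N.act_closed[OF a x] by (simp add: nerve_map_hat)
  qed
  moreover have "nerve_proj k \<pi> (nerve_map P k (hat P f) x) = nerve_proj k \<pi> x" if "x \<in> pts ?X" for x
    unfolding nerve_proj_def
    by (rule restrict_ext) (use that fD(4) ptX in \<open>simp add: nerve_map_hat\<close>)
  ultimately show ?thesis
    by (simp add: nerve_gauge_group_def gauge_group_def) (simp add: nerve_map_hat)
qed

text \<open>Both arguments may be taken to be hats, which turns composition into composition of maps
  of \<open>P\<close> applied to each component. Compositions in \<open>AutP\<close> and
  \<open>AutN k\<close> are restricted to their carriers, so the intermediate tuple must be shown to
  lie in the power.\<close>

lemma nerve_map_mon: "nerve_map P k \<in> mon AutP1 (AutN k)"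
proof -
  let ?X = "power_manifold k P"
  have "nerve_map P k (F \<otimes>\<^bsub>AutP1\<^esub> H) = nerve_map P k F \<otimes>\<^bsub>AutN k\<^esub> nerve_map P k H"
    if F: "F \<in> carrier AutP1" and H: "H \<in> carrier AutP1" for F H
  proof -
    obtain f where f: "f \<in> carrier AutP" "F = hat P f" using AutP1_obtain_hat[OF F] .
    obtain h where h: "h \<in> carrier AutP" "H = hat P h" using AutP1_obtain_hat[OF H] .
    have "(\<lambda>x\<in>pts ?X. \<lambda>i\<in>{..k}. compose (pts P) f h (x i)) =
        compose (pts ?X) (\<lambda>x\<in>pts ?X. \<lambda>i\<in>{..k}. f (x i)) (\<lambda>x\<in>pts ?X. \<lambda>i\<in>{..k}. h (x i))"
      unfolding compose_def
    proof (rule restrict_ext)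
      fix x assume x: "x \<in> pts ?X"
      then have "x i \<in> pts P" if "i \<le> k" for i using that by (auto simp: pts_power_manifold)
      moreover have "(\<lambda>i\<in>{..k}. h (x i)) \<in> pts ?X"
        using x AutPD(5)[OF h(1)] by (auto simp: pts_power_manifold PiE_iff)
      ultimately show "(\<lambda>i\<in>{..k}. (\<lambda>x\<in>pts P. f (h x)) (x i)) =
          (\<lambda>x\<in>pts ?X. \<lambda>i\<in>{..k}. f (x i)) ((\<lambda>x\<in>pts ?X. \<lambda>i\<in>{..k}. h (x i)) x)"
        using x by (auto intro!: restrict_ext)
    qed
    then show ?thesis
      unfolding f(2) h(2) hat_compose[OF f(1) h(1), symmetric] nerve_map_hat
      by (simp add: nerve_gauge_group_def gauge_group_def)
  qed
  moreover have "nerve_map P k F \<in> carrier (AutN k)" if "F \<in> carrier AutP1" for F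
    using that by (rule AutP1_obtain_hat) (simp add: nerve_map_hat_in_AutN)
  ultimately have "nerve_map P k \<in> hom AutP1 (AutN k)" by (intro homI)
  moreover have "inj_on (nerve_map P k) (carrier AutP1)"
  proof (rule inj_onI)
    fix F H assume F: "F \<in> carrier AutP1" and H: "H \<in> carrier AutP1" and eq: "nerve_map P k F = nerve_map P k H"
    obtain f where f: "f \<in> carrier AutP" "F = hat P f" using AutP1_obtain_hat[OF F] .
    obtain h where h: "h \<in> carrier AutP" "H = hat P h" using AutP1_obtain_hat[OF H] .
    have "f = h"
    proof (rule extensionalityI[OF AutPD(1)[OF f(1)] AutPD(1)[OF h(1)]])
      \<comment> \<open>Index 0 is present in every tuple, so the constant tuple at \<open>p\<close>
        recovers the object map at every level, including \<open>k = 0\<close>.\<close>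
      fix p assume "p \<in> pts P"
      then have "(\<lambda>i\<in>{..k}. p) \<in> pts ?X" by (simp add: pts_power_manifold)
      then show "f p = h p"
        using fun_cong[OF fun_cong[OF eq, of "\<lambda>i\<in>{..k}. p"], of 0] by (simp add: f(2) h(2) nerve_map_hat)
    qed
    then show "F = H" by (simp add: f(2) h(2))
  qed
  ultimately show ?thesis by (simp add: mon_def)
qed

text \<open>Homomorphy is inherited from the levels; for injectivity a single level suffices, and
  level 0 is taken.\<close>

lemma nerve_map_product_mon: "(\<lambda>F k. nerve_map P k F) \<in> mon AutP1 (product_group UNIV AutN)"
proof -
  have hom: "nerve_map P k \<in> hom AutP1 (AutN k)" and inj: "inj_on (nerve_map P k) (carrier AutP1)" for k
    using nerve_map_mon[of k] by (auto simp: mon_def)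
  have "(\<lambda>F k. nerve_map P k F) \<in> hom AutP1 (product_group UNIV AutN)"
    using hom by (auto simp: hom_def product_group_def Pi_iff)
  moreover have "inj_on (\<lambda>F k. nerve_map P k F) (carrier AutP1)"
    using inj[of 0] by (auto simp: inj_on_def fun_eq_iff)
  ultimately show ?thesis by (simp add: mon_def)
qed

end

theorem theorem4p5:
  fixes G :: "'g lie_group" and P :: "'p manifold" and M :: "'m manifold"
    and \<pi> :: "'p \<Rightarrow> 'm" and act :: "'g \<Rightarrow> 'p \<Rightarrow> 'p"
  assumes "principal_bundle G P M \<pi> act"
  defines "AutP \<equiv> gauge_group G P \<pi> act"
    and "AutP1 \<equiv> pair_groupoid_gauge_group G P \<pi> act"
    and "AutN \<equiv> nerve_gauge_group G P \<pi> act"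
    and "EqN \<equiv> nerve_equivariant_maps G P act"
  shows "group AutP \<and> group AutP1 \<and> (\<forall>k. group (AutN k)) \<and> (\<forall>k. group (EqN k)) \<and>
    hat P \<in> mon AutP AutP1 \<and>
    (\<lambda>F. \<lambda>k. nerve_map P k F) \<in> mon AutP1 (product_group UNIV AutN) \<and>
    (\<forall>k. nerve_map P k \<in> mon AutP1 (AutN k)) \<and>
    (\<forall>f\<in>carrier AutP. \<forall>k. \<forall>x\<in>pts (power_manifold k P).
       nerve_map P k (hat P f) x = (\<lambda>i\<in>{..k}. f (x i))) \<and>
    (\<forall>k. gauge_of_map (nerve_group k G) (power_manifold k P) (nerve_action k G act)
           \<in> iso (EqN k) (AutN k))"
proof -
  interpret principal_G_bundle G P M \<pi> act by unfold_locales (rule assms(1))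
  note nerve = smooth_free_action_nerve
  show ?thesis
    unfolding AutP_def AutP1_def AutN_def EqN_def
  proof (intro conjI allI ballI)
    show "nerve_map P k (hat P f) x = (\<lambda>i\<in>{..k}. f (x i))" if "x \<in> pts (power_manifold k P)" for f k x
      using that by (simp add: nerve_map_hat)
    show "group (nerve_equivariant_maps G P act k)" for k
      unfolding nerve_equivariant_maps_def
      by (rule smooth_free_action.group_equivariant_maps[OF nerve])
    show "gauge_of_map (nerve_group k G) (power_manifold k P) (nerve_action k G act)
        \<in> iso (nerve_equivariant_maps G P act k) (nerve_gauge_group G P \<pi> act k)" for k
      unfolding nerve_equivariant_maps_def nerve_gauge_group_def
      by (rule smooth_free_action.gauge_of_map_iso[OF nerve])
  qed (rule group_AutP group_AutP1 group_AutN hat_mon nerve_map_product_mon nerve_map_mon)+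
qed

end
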